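(* Let $\Lambda=\{\lambda_k\}_{k\ge 0}$ be a non-decreasing sequence of positive numbers tending to $\infty$, and let $\{a_k\}_{k\ge1}$ be a sequence of complex numbers. (1) Let $1\le p<\infty$. If the sequences $$s^1_n(t)=\sum_{k=1}^n a_k\cos kt\quad\text{and}\quad s^2_n(t)=\sum_{k=1}^n a_k\sin kt\qquad(n=0,1,\dots)$$ both converge $\Lambda^2$-strongly in the $L^p$-metric restricted to a set $A\subseteq[0,2\pi)$ of positive Lebesgue measure, then $$\lim_{n\to\infty}\frac1{\lambda_n}\sum_{k=1}^n\lambda_{k-1}|a_k|=0.\qquad( * )$$ (2) Consequently, let $1<p<\infty$ and let $f,g\in L^p$ have Fourier series $\frac12a_0+\sum_{k=1}^\infty a_k\cos kt$ and $\sum_{k=1}^\infty a_k\sin kt$, respectively (with the same coefficients $a_k$, $k\ge1$). Then the partial sums of both series converge $\Lambda^2$-strongly in the $L^p$-metric, to $f$ and $g$ respectively, if and only if the coefficients $a_k$ satisfy $( * )$.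
   Context: Convention: $\lambda_{-1}=\lambda_{-2}=0$ and, for any sequence $\{s_k\}_{k\ge0}$ of numbers or functions, $s_{-1}=s_{-2}=0$; empty sums are $0$. $L^p$ is the usual space of (classes of a.e. equal) $2\pi$-periodic complex-valued measurable functions with $|f|^p$ integrable over a period, with its usual norm $\|\cdot\|_p$. For a measurable set $A$, a sequence of functions $\{s_k\}_{k\ge0}$ converges $\Lambda^2$-strongly to a function $h\in L^p(A)$ in the $L^p$-metric restricted to $A$ if $$\lim_{n\to\infty}\left\|\frac1{\lambda_n}\sum_{k=0}^n|\lambda_k(s_k-h)-\lambda_{k-2}(s_{k-2}-h)|\right\|_{L^p(A)}=0;$$ it converges $\Lambda^2$-strongly in that metric if this holds for some $h\in L^p(A)$. Convergence in the $L^p$-metric without restriction means $A=[0,2\pi)$. The $k$th partial sum of a Fourier series $\frac12a_0+\sum_{k\ge1}(a_k\cos kt+b_k\sin kt)$ for $k=0$ is $\frac12a_0$. *)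

theory Defs
  imports "HOL-Analysis.Analysis"
begin

text \<open>
  Elements of \<open>L\<^sup>p(A)\<close> are handled through representatives; norms, Fourier coefficients and
  strong convergence do not depend on the choice of representative.
\<close>

definition Lp_on :: "real \<Rightarrow> real set \<Rightarrow> (real \<Rightarrow> complex) set" where
  "Lp_on p A = {f. f \<in> borel_measurable (lebesgue_on A) \<and>
                   integrable (lebesgue_on A) (\<lambda>t. norm (f t) powr p)}"

definition Lp_norm :: "real \<Rightarrow> real set \<Rightarrow> (real \<Rightarrow> 'b::real_normed_vector) \<Rightarrow> real" where
  "Lp_norm p A f = (LINT t|lebesgue_on A. norm (f t) powr p) powr (1 / p)"

definition Lp_periodic :: "real \<Rightarrow> (real \<Rightarrow> complex) set" where
  "Lp_periodic p = {f. (\<forall>t. f (t + 2 * pi) = f t) \<and> f \<in> Lp_on p {0..<2 * pi}}"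

text \<open>\<open>back2 s k\<close> is \<open>s\<^bsub>k-2\<^esub>\<close>, with the convention that terms of negative index vanish.\<close>

definition back2 :: "(nat \<Rightarrow> 'b::zero) \<Rightarrow> nat \<Rightarrow> 'b" where
  "back2 s k = (if k < 2 then 0 else s (k - 2))"

text \<open>
  Membership of \<open>s k\<close> and \<open>h\<close> in \<open>L\<^sup>p(A)\<close> guarantees that the integral inside \<open>Lp_norm\<close> is
  a genuine one, not the default value of a divergent integral.
\<close>

definition Lambda2_strongly_to ::
    "(nat \<Rightarrow> real) \<Rightarrow> real \<Rightarrow> real set \<Rightarrow> (nat \<Rightarrow> real \<Rightarrow> complex) \<Rightarrow> (real \<Rightarrow> complex) \<Rightarrow> bool" where
  "Lambda2_strongly_to lam p A s h \<longleftrightarrow>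
     (\<forall>k. s k \<in> Lp_on p A) \<and> h \<in> Lp_on p A \<and>
     (\<lambda>n. Lp_norm p A (\<lambda>t. 1 / lam n *
        (\<Sum>k=0..n. cmod (of_real (lam k) * (s k t - h t)
                      - of_real (back2 lam k) * (back2 (\<lambda>j. s j t) k - h t))))) \<longlonglongrightarrow> 0"

definition Lambda2_strongly_convergent ::
    "(nat \<Rightarrow> real) \<Rightarrow> real \<Rightarrow> real set \<Rightarrow> (nat \<Rightarrow> real \<Rightarrow> complex) \<Rightarrow> bool" where
  "Lambda2_strongly_convergent lam p A s \<longleftrightarrow> (\<exists>h. Lambda2_strongly_to lam p A s h)"

definition fourier_cos_coeff :: "(real \<Rightarrow> complex) \<Rightarrow> nat \<Rightarrow> complex" where
  "fourier_cos_coeff f k =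
     of_real (1 / pi) * (LINT t|lebesgue_on {0..<2 * pi}. f t * of_real (cos (real k * t)))"

definition fourier_sin_coeff :: "(real \<Rightarrow> complex) \<Rightarrow> nat \<Rightarrow> complex" where
  "fourier_sin_coeff f k =
     of_real (1 / pi) * (LINT t|lebesgue_on {0..<2 * pi}. f t * of_real (sin (real k * t)))"

text \<open>
  The Fourier series of \<open>f\<close> is \<open>a\<^sub>0/2 + \<Sum>\<^bsub>k\<ge>1\<^esub> (a\<^sub>k cos kt + b\<^sub>k sin kt)\<close>. The value \<open>b 0\<close> is
  irrelevant, both here and in the partial sums.
\<close>

definition has_fourier_series ::
    "(real \<Rightarrow> complex) \<Rightarrow> (nat \<Rightarrow> complex) \<Rightarrow> (nat \<Rightarrow> complex) \<Rightarrow> bool" where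
  "has_fourier_series f a b \<longleftrightarrow>
     (\<forall>k. fourier_cos_coeff f k = a k) \<and> (\<forall>k\<ge>1. fourier_sin_coeff f k = b k)"

definition fourier_partial_sum ::
    "(nat \<Rightarrow> complex) \<Rightarrow> (nat \<Rightarrow> complex) \<Rightarrow> nat \<Rightarrow> real \<Rightarrow> complex" where
  "fourier_partial_sum a b n t =
     a 0 / 2 + (\<Sum>k=1..n. a k * of_real (cos (real k * t)) + b k * of_real (sin (real k * t)))"

end

theory Submission
  imports Defs
begin

text \<open>
  Write \<open>e\<^sub>k = s\<^sub>k - h\<close> and \<open>D\<^sub>k = \<lambda>\<^sub>k e\<^sub>k - \<lambda>\<^bsub>k-2\<^esub> e\<^bsub>k-2\<^esub>\<close>. Telescoping gives \<open>\<lambda>\<^sub>n |e\<^sub>n| \<le> \<Sum>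
      |D\<^sub>k|\<close>, so strong
  convergence forces \<open>e\<^sub>n \<rightarrow> 0\<close>. In
  \<open>D\<^sub>k = (\<lambda>\<^sub>k - \<lambda>\<^bsub>k-2\<^esub>) e\<^sub>k + \<lambda>\<^bsub>k-2\<^esub> (s\<^sub>k - s\<^bsub>k-2\<^esub>)\<close> the first summand is therefore negligible after
      averaging.
  For the cosine and sine sums together, the second one dominates
  \<open>\<lambda>\<^bsub>k-2\<^esub> |a\<^sub>k exp (it) + a\<^bsub>k-1\<^esub>|\<close>, whose integral over \<open>A\<close> is at least \<open>c \<lambda>\<^bsub>k-2\<^esub> |a\<^bsub>k-1\<^esub>|\<close>.

  Conversely, the coefficient condition controls the second summand uniformly in \<open>t\<close>, and the first
      one
  needs \<open>e\<^sub>k \<rightarrow> 0\<close> in \<open>L\<^sup>p\<close>, which is M. Riesz's theorem. For an analytic polynomial \<open>F\<close> with real \<open>F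
      0\<close> the
  inequality \<open>\<parallel>F\<parallel>\<^sub>p \<le> C \<parallel>Re F\<parallel>\<^sub>p\<close> follows by integrating \<open>H \<circ> F\<close> over the circle for an explicit
      subharmonic
  \<open>H\<close> that is nonnegative on the real axis and bounded above by \<open>C |Re z|\<^sup>p - c |z|\<^sup>p\<close>; frequency
      shifts then
  give uniform bounds for the partial sum operators, and density of trigonometric polynomials gives
      convergence.
\<close>

section \<open>Mean values of subharmonic functions of polynomials\<close>

text \<open>Because the increments have lag two, the coefficients come in pairs, and at a given
  point t the two terms of s_k - s_(k-2) may cancel. Cosine and sine sums are taken together so that
  only the modulus of a_k exp(it) + a_(k-1) matters; cancellation throughout \<open>A\<close> is
  then impossible because exp(it) is not constant almost everywhere on a set of positive measure. Of
  each pair only a_(k-1) is retained: its factor \<lambda>_(k-2) is exactly its weight in the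
  coefficient condition. The last coefficient a_n of the sum, with weight \<lambda>_(n-1), has no
  such partner and is handled through a_n tending to 0. This direction works with L^1 norms over
  \<open>A\<close>, so p = 1 is within reach. The converse is where p > 1 enters. There, as in the
  averaging above, the weights \<lambda>_k - \<lambda>_(k-2) are nonnegative with total mass between
  \<lambda>_n and 2 \<lambda>_n, so dividing by \<lambda>_n gives averages up to a factor of at most
  2, and null sequences keep the limit 0.\<close>

text \<open>
  In the coordinates \<open>z = exp (s + it)\<close> the angular part of the Laplacian integrates to \<open>0\<close> over a
      period,
  so the circle mean \<open>m s\<close> is convex in \<open>s\<close>; having a finite limit as \<open>s \<rightarrow> -\<infinity>\<close>, it is nondecreasing.
\<close>

lemma subharmonic_mean_exp:
  fixes H Hx Hy Hxx Hxy Hyy :: "complex \<Rightarrow> real" and g g' g'' :: "complex \<Rightarrow> complex"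
  assumes dH: "\<And>z. (H has_derivative (\<lambda>d. Hx z * Re d + Hy z * Im d)) (at z)"
    and dHx: "\<And>z. (Hx has_derivative (\<lambda>d. Hxx z * Re d + Hxy z * Im d)) (at z)"
    and dHy: "\<And>z. (Hy has_derivative (\<lambda>d. Hxy z * Re d + Hyy z * Im d)) (at z)"
    and cont: "continuous_on UNIV Hxx" "continuous_on UNIV Hxy" "continuous_on UNIV Hyy"
    and sub: "\<And>z. Hxx z + Hyy z \<ge> 0"
    and dg: "\<And>z. (g has_field_derivative g' z) (at z)"
    and dg': "\<And>z. (g' has_field_derivative g'' z) (at z)"
    and cg'': "continuous_on UNIV g''"
    and per: "\<And>s. g (Complex s (2 * pi)) = g (Complex s 0)" "\<And>s. g' (Complex s (2 * pi)) = g'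
        (Complex s 0)"
    and lim: "\<And>e. e > 0 \<Longrightarrow> \<exists>S. \<forall>s\<le>S. \<forall>t. norm (g (Complex s t) - L) < e"
  shows "2 * pi * H L \<le> integral {0..2*pi} (\<lambda>t. H (g (Complex 0 t)))"
proof -
  define A where "A = (\<lambda>s t. H (g (Complex s t)))"
  define As where "As = (\<lambda>s t. let z = Complex s t in Hx (g z) * Re (g' z) + Hy (g z) * Im (g' z))"
  define Ass where "Ass = (\<lambda>s t. let z = Complex s t in Hxx (g z) * (Re (g' z))\<^sup>2 + 2 * Hxy (g z) *
      Re (g' z) * Im (g' z)
      + Hyy (g z) * (Im (g' z))\<^sup>2 + Hx (g z) * Re (g'' z) + Hy (g z) * Im (g'' z))"
  define At where "At = (\<lambda>s t. let z = Complex s t in - Hx (g z) * Im (g' z) + Hy (g z) * Re (g'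
      z))"
  define Att where "Att = (\<lambda>s t. let z = Complex s t in Hxx (g z) * (Im (g' z))\<^sup>2 - 2 * Hxy (g z) *
      Re (g' z) * Im (g' z)
      + Hyy (g z) * (Re (g' z))\<^sup>2 - Hx (g z) * Re (g'' z) - Hy (g z) * Im (g'' z))"
  have cs: "((\<lambda>s. Complex s t) has_derivative (\<lambda>d. of_real d)) (at s)" for s t
    unfolding Complex_eq by (auto intro!: derivative_eq_intros)
  have ct: "((\<lambda>t. Complex s t) has_derivative (\<lambda>d. \<i> * of_real d)) (at t)" for s t
    unfolding Complex_eq by (auto intro!: derivative_eq_intros)
  have ds: "((\<lambda>s. \<phi> (Complex s t)) has_derivative (\<lambda>d. \<phi>' (Complex s t) * of_real d)) (at s)"
    if "\<And>z. (\<phi> has_field_derivative \<phi>' z) (at z)" for \<phi> \<phi>' :: "complex \<Rightarrow> complex" and s t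
    using has_derivative_compose[OF cs that[unfolded has_field_derivative_def]] .
  have dt: "((\<lambda>t. \<phi> (Complex s t)) has_derivative (\<lambda>d. \<phi>' (Complex s t) * (\<i> * of_real d))) (at t)"
    if "\<And>z. (\<phi> has_field_derivative \<phi>' z) (at z)" for \<phi> \<phi>' :: "complex \<Rightarrow> complex" and s t
    using has_derivative_compose[OF ct that[unfolded has_field_derivative_def]] .
  note gs = ds[OF dg] and gs' = ds[OF dg'] and gt = dt[OF dg] and gt' = dt[OF dg']
  have 1: "((\<lambda>s. A s t) has_real_derivative As s t) (at s)" for s t
    unfolding A_def As_def has_field_derivative_def Let_def
    by (rule has_derivative_eq_rhs[OF has_derivative_compose[OF gs dH]]) (simp add: algebra_simps
        fun_eq_iff)
  have 2: "((\<lambda>s. As s t) has_real_derivative Ass s t) (at s)" for s t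
    unfolding As_def Ass_def has_field_derivative_def Let_def
    by (rule has_derivative_eq_rhs[OF has_derivative_add[OF
          has_derivative_mult[OF has_derivative_compose[OF gs dHx] has_derivative_Re[OF gs']]
          has_derivative_mult[OF has_derivative_compose[OF gs dHy] has_derivative_Im[OF gs']]]])
       (simp add: algebra_simps fun_eq_iff power2_eq_square)
  have 3: "((\<lambda>t. A s t) has_real_derivative At s t) (at t)" for s t
    unfolding A_def At_def has_field_derivative_def Let_def
    by (rule has_derivative_eq_rhs[OF has_derivative_compose[OF gt dH]]) (simp add: algebra_simps
        fun_eq_iff)
  have 4: "((\<lambda>t. At s t) has_real_derivative Att s t) (at t)" for s t
    unfolding At_def Att_def has_field_derivative_def Let_def
    by (rule has_derivative_eq_rhs[OF has_derivative_add[OF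
          has_derivative_mult[OF has_derivative_minus[OF has_derivative_compose[OF gt dHx]]
              has_derivative_Im[OF gt']]
          has_derivative_mult[OF has_derivative_compose[OF gt dHy] has_derivative_Re[OF gt']]]])
       (simp add: algebra_simps fun_eq_iff power2_eq_square)
  have cgz: "continuous_on UNIV g" "continuous_on UNIV g'"
    by (rule DERIV_continuous_on, rule dg dg')+
  have cHz: "continuous_on UNIV H" "continuous_on UNIV Hx" "continuous_on UNIV Hy"
    by (rule has_derivative_continuous_on, rule dH dHx dHy)+
  have cC: "continuous_on UNIV (\<lambda>x::real\<times>real. Complex (fst x) (snd x))"
    by (simp add: Complex_eq) (intro continuous_intros)
  have comp: "continuous_on UNIV (\<lambda>x::real\<times>real. \<phi> (Complex (fst x) (snd x)))" if "continuous_on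
      UNIV \<phi>"
    for \<phi> :: "complex \<Rightarrow> 'b::topological_space"
    by (rule continuous_on_compose2[OF that cC]) auto
  have compH: "continuous_on UNIV (\<lambda>x::real\<times>real. \<phi> (g (Complex (fst x) (snd x))))" if
      "continuous_on UNIV \<phi>"
    for \<phi> :: "complex \<Rightarrow> real"
    by (rule continuous_on_compose2[OF that comp[OF cgz(1)]]) auto
  note cc = comp[OF cgz(2)] comp[OF cg''] compH[OF cHz(1)] compH[OF cHz(2)] compH[OF cHz(3)]
     compH[OF cont(1)] compH[OF cont(2)] compH[OF cont(3)]
  have c2: "continuous_on UNIV (\<lambda>x. As (fst x) (snd x))"
    unfolding As_def Let_def by (intro continuous_intros cc)
  have c3: "continuous_on UNIV (\<lambda>x. Ass (fst x) (snd x))"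
    unfolding Ass_def Let_def by (intro continuous_intros cc)
  have c4: "continuous_on UNIV (\<lambda>x. A (fst x) (snd x))"
    unfolding A_def Let_def by (intro continuous_intros cc)
  have slice: "continuous_on B (\<phi> s)" if "continuous_on UNIV (\<lambda>x. \<phi> (fst x) (snd x))" for \<phi> :: "real
      \<Rightarrow> real \<Rightarrow> real" and s B
    using continuous_on_compose2[OF that, of B "\<lambda>t. (s,t)"] by (simp add: continuous_on_Pair)
  note int = integrable_continuous_real[OF slice]
  define m where "m = (\<lambda>s. integral {0..2*pi} (A s))"
  define m1 where "m1 = (\<lambda>s. integral {0..2*pi} (As s))"
  define m2 where "m2 = (\<lambda>s. integral {0..2*pi} (Ass s))"
  have dm: "(m has_real_derivative m1 s) (at s)" for s
    unfolding m_def m1_def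
    using leibniz_rule_field_derivative[of UNIV 0 "2*pi" A As s] 1 int[OF c4]
        continuous_on_subset[OF c2]
    by (simp add: case_prod_unfold)
  have dm1: "(m1 has_real_derivative m2 s) (at s)" for s
    unfolding m2_def m1_def
    using leibniz_rule_field_derivative[of UNIV 0 "2*pi" As Ass s] 2 int[OF c2]
        continuous_on_subset[OF c3]
    by (simp add: case_prod_unfold)
  have m2: "m2 s \<ge> 0" for s
  proof -
    have "(Att s has_integral (At s (2*pi) - At s 0)) {0..2*pi}"
      by (rule fundamental_theorem_of_calculus)
         (auto simp: has_real_derivative_iff_has_vector_derivative[symmetric] intro: 4 DERIV_subset)
    moreover have "At s (2*pi) = At s 0" by (simp add: At_def Let_def per)
    ultimately have "((\<lambda>t. Ass s t + Att s t) has_integral (m2 s + 0)) {0..2*pi}"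
      unfolding m2_def using int[OF c3] by (intro has_integral_add) (auto simp: integrable_integral)
    moreover have "Ass s t + Att s t \<ge> 0" for t
    proof -
      \<comment> \<open>Since \<open>g\<close> is holomorphic, the mixed second derivatives and the
        terms with \<open>g''\<close> cancel; what is left is the Laplacian of \<open>H\<close> at
        \<open>g\<close> times |g'|^2.\<close>
      have "Ass s t + Att s t = (Hxx (g (Complex s t)) + Hyy (g (Complex s t))) * ((Re (g' (Complex
          s t)))\<^sup>2 + (Im (g' (Complex s t)))\<^sup>2)"
        by (simp add: Ass_def Att_def Let_def algebra_simps)
      also have "\<dots> \<ge> 0" by (intro mult_nonneg_nonneg sub) auto
      finally show ?thesis .
    qed
    ultimately show ?thesis using has_integral_nonneg[of "\<lambda>t. Ass s t + Att s t" "m2 s"] by simp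
  qed
  have limm: "(m \<longlongrightarrow> 2 * pi * H L) at_bot"
  proof (rule tendstoI)
    fix e :: real assume "e > 0"
    then have "e / (4*pi) > 0" by simp
    then obtain d where d: "d > 0" "\<And>z. norm (z - L) < d \<Longrightarrow> \<bar>H z - H L\<bar> < e / (4*pi)"
      using cHz(1) unfolding continuous_on_iff dist_norm by (metis UNIV_I real_norm_def)
    from lim[OF d(1)] obtain S where S: "\<And>s t. s \<le> S \<Longrightarrow> norm (g (Complex s t) - L) < d" by blast
    have "dist (m s) (2*pi*H L) < e" if "s \<le> S" for s
    proof -
      have "integral {0..2*pi} (\<lambda>t. A s t - H L) = m s - 2 * pi * H L"
        unfolding m_def using int[OF c4] by (subst integral_diff) auto
      moreover have "norm (integral {0..2*pi} (\<lambda>t. A s t - H L)) \<le> e / (4*pi) * (2*pi - 0)"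
        by (rule integral_bound) (use S d(2) that in \<open>auto simp: A_def less_imp_le intro!:
            continuous_intros slice[OF c4, unfolded A_def]\<close>)
      ultimately show ?thesis using \<open>e > 0\<close> by (simp add: dist_norm)
    qed
    then show "\<forall>\<^sub>F s in at_bot. dist (m s) (2 * pi * H L) < e"
      unfolding eventually_at_bot_linorder by blast
  qed
  have mono1: "m1 a \<le> m1 b" if "a \<le> b" for a b
    using DERIV_nonneg_imp_nondecreasing[OF that] dm1 m2 by blast
  have m1: "m1 s \<ge> 0" for s
  proof (rule ccontr)
    assume "\<not> 0 \<le> m1 s"
    then have neg: "m1 s < 0" by simp
    \<comment> \<open>As \<open>m1\<close> is nondecreasing, \<open>m\<close> lies above its tangent
      at \<open>s\<close>; a negative slope would make it unbounded towards -infinity, against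
      \<open>limm\<close>.\<close>
    have ge: "m x \<ge> m s + (- m1 s) * (s - x)" if "x \<le> s" for x
    proof -
      have d: "((\<lambda>x. m x - m1 s * x) has_real_derivative m1 y - m1 s) (at y)" for y
        by (rule derivative_eq_intros dm refl)+ simp
      have "m s - m1 s * s \<le> m x - m1 s * x"
        by (rule DERIV_nonpos_imp_nonincreasing[OF that]) (use d mono1 in force)
      then show ?thesis by (simp add: algebra_simps)
    qed
    have "\<forall>\<^sub>F x in at_bot. m x < 2 * pi * H L + 1"
      by (rule order_tendstoD[OF limm]) simp
    then obtain S where S: "\<And>x. x \<le> S \<Longrightarrow> m x < 2 * pi * H L + 1"
      unfolding eventually_at_bot_linorder by blast
    \<comment> \<open>The height that the tangent has to climb from \<open>m s\<close> in order to
      exceed the limit by one; going left by \<open>K / (- m1 s)\<close> achieves it.\<close>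
    define K where "K = max 0 (2 * pi * H L + 1 - m s)"
    define x where "x = min S (s - K / (- m1 s))"
    have "K / (- m1 s) \<ge> 0" using neg by (intro divide_nonneg_pos) (auto simp: K_def)
    then have "x \<le> s" by (simp add: x_def min_def)
    have "K / (- m1 s) \<le> s - x" by (simp add: x_def)
    then have "K \<le> (- m1 s) * (s - x)" using neg by (simp add: divide_le_eq
        minus_divide_right[symmetric] field_simps)
    moreover have "m x < 2 * pi * H L + 1" by (rule S) (simp add: x_def)
    ultimately show False using ge[OF \<open>x \<le> s\<close>] by (auto simp: K_def)
  qed
  have "m s \<le> m 0" if "s \<le> 0" for s
    using DERIV_nonneg_imp_nondecreasing[OF that] dm m1 by blast
  then have "2 * pi * H L \<le> m 0"
    by (intro tendsto_upperbound[OF limm]) (auto simp: eventually_at_bot_linorder)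
  then show ?thesis by (simp add: m_def A_def)
qed

text \<open>Composition with \<open>exp\<close> turns circles around the origin into vertical
  segments; the radius \<open>exp s\<close> tends to 0 as \<open>s\<close> tends to -infinity, which
  is why the centre value is \<open>poly p 0\<close>.\<close>

lemma subharmonic_mean_poly:
  fixes H Hx Hy Hxx Hxy Hyy :: "complex \<Rightarrow> real" and p :: "complex poly"
  assumes dH: "\<And>z. (H has_derivative (\<lambda>d. Hx z * Re d + Hy z * Im d)) (at z)"
    and dHx: "\<And>z. (Hx has_derivative (\<lambda>d. Hxx z * Re d + Hxy z * Im d)) (at z)"
    and dHy: "\<And>z. (Hy has_derivative (\<lambda>d. Hxy z * Re d + Hyy z * Im d)) (at z)"
    and cont: "continuous_on UNIV Hxx" "continuous_on UNIV Hxy" "continuous_on UNIV Hyy"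
    and sub: "\<And>z. Hxx z + Hyy z \<ge> 0"
  shows "2 * pi * H (poly p 0) \<le> integral {0..2*pi} (\<lambda>t. H (poly p (cis t)))"
proof -
  have e: "exp (Complex s (2*pi)) = exp (Complex s 0)" for s
    by (simp add: exp_eq_polar)
  have "2 * pi * H (poly p 0) \<le> integral {0..2*pi} (\<lambda>t. H (poly p (exp (Complex 0 t))))"
  proof (rule subharmonic_mean_exp[OF assms, where g' = "\<lambda>z. poly (pderiv p) (exp z) * exp z"
        and g'' = "\<lambda>z. poly (pderiv (pderiv p)) (exp z) * exp z * exp z + poly (pderiv p) (exp z) *
            exp z"])
    fix z show "((\<lambda>z. poly p (exp z)) has_field_derivative poly (pderiv p) (exp z) * exp z) (at z)"
      by (rule DERIV_chain2[OF poly_DERIV DERIV_exp])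
    show "((\<lambda>z. poly (pderiv p) (exp z) * exp z) has_field_derivative
          poly (pderiv (pderiv p)) (exp z) * exp z * exp z + poly (pderiv p) (exp z) * exp z) (at
              z)"
      by (rule derivative_eq_intros DERIV_chain2[OF poly_DERIV DERIV_exp] refl)+ simp
  next
    show "continuous_on UNIV (\<lambda>z. poly (pderiv (pderiv p)) (exp z) * exp z * exp z + poly (pderiv p)
        (exp z) * exp z)"
      by (intro continuous_intros)
  next
    fix e :: real assume "e > 0"
    then obtain d where d: "d > 0" "\<And>z. norm z < d \<Longrightarrow> norm (poly p z - poly p 0) < e"
      using poly_isCont[where x=0 and p=p] unfolding continuous_at_eps_delta dist_norm by auto
    have "norm (poly p (exp (Complex s t)) - poly p 0) < e" if "s \<le> ln (d/2)" for s t
    proof (rule d(2))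
      have "norm (exp (Complex s t)) = exp s" by (simp add: norm_exp_eq_Re)
      also have "\<dots> \<le> d/2" using that d(1) by (metis exp_le_cancel_iff exp_ln half_gt_zero)
      finally show "norm (exp (Complex s t)) < d" using d(1) by simp
    qed
    then show "\<exists>S. \<forall>s\<le>S. \<forall>t. norm (poly p (exp (Complex s t)) - poly p 0) < e" by blast
  qed (simp_all add: e)
  then show ?thesis by (simp add: exp_eq_polar)
qed

section \<open>M. Riesz's inequality for analytic polynomials\<close>

lemma has_derivative_powr_const:
  fixes W :: "'a::real_normed_vector \<Rightarrow> real"
  assumes "(W has_derivative W') (at z)" "W z > 0"
  shows "((\<lambda>z. W z powr q) has_derivative (\<lambda>d. q * W z powr (q - 1) * W' d)) (at z)"
  using has_derivative_compose[OF assms(1) has_real_derivative_powr[OF assms(2), unfolded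
      has_field_derivative_def]]
  by simp

text \<open>
  The subharmonic function is \<open>C |Re z|\<^sup>p - |z|\<^sup>p\<close>; adding \<open>e\<close> to the squares removes the
      singularity of its
  second derivatives on the imaginary axis.
\<close>

lemma conjugate_bound_regularized_le_2:
  fixes p e :: real and F :: "complex poly"
  assumes p: "1 < p" "p \<le> 2" and e: "e > 0" and F0: "Im (poly F 0) = 0"
  shows "2 * pi * norm (poly F 0) powr p + integral {0..2*pi} (\<lambda>t. norm (poly F (cis t)) powr p)
     \<le> 2 / (p - 1) * integral {0..2*pi} (\<lambda>t. ((Re (poly F (cis t)))\<^sup>2 + e) powr (p / 2))"
proof -
  define q where "q = p / 2"
  \<comment> \<open>With this value, \<open>C * (2 * q - 1) = 2\<close>: the lower bound for the
    Laplacian of \<open>C * X powr q\<close> then has the same coefficient \<open>4 * q\<close> as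
    the upper bound for that of \<open>W powr q\<close>.\<close>
  define C where "C = 2 / (p - 1)"
  have q: "1/2 < q" "q \<le> 1" using p by (auto simp: q_def)
  have C: "C \<ge> 2" "C * (2 * q - 1) = 2" using p by (auto simp: C_def q_def field_simps)
  define X where "X = (\<lambda>z. (Re z)\<^sup>2 + e)"
  define W where "W = (\<lambda>z. (Re z)\<^sup>2 + (Im z)\<^sup>2 + e)"
  have pos: "X z > 0" "W z > 0" for z
    using e by (auto simp: X_def W_def add_nonneg_pos)
  have XW: "X z \<le> W z" for z by (simp add: X_def W_def)
  have dX: "(X has_derivative (\<lambda>d. 2 * Re z * Re d)) (at z)" for z
    unfolding X_def by (auto intro!: derivative_eq_intros simp: fun_eq_iff)
  have dW: "(W has_derivative (\<lambda>d. 2 * Re z * Re d + 2 * Im z * Im d)) (at z)" for z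
    unfolding W_def by (auto intro!: derivative_eq_intros simp: fun_eq_iff)
  note dXq = has_derivative_powr_const[OF dX pos(1)] and dWq = has_derivative_powr_const[OF dW
      pos(2)]
  have cX: "continuous_on S X" and cW: "continuous_on S W" for S
    unfolding X_def W_def by (intro continuous_intros)+
  have cXq: "continuous_on S (\<lambda>z. X z powr r)" and cWq: "continuous_on S (\<lambda>z. W z powr r)" for S r
    using pos by (auto intro!: continuous_on_powr cX cW continuous_on_const simp:
        less_imp_neq[symmetric])
  have cF: "continuous_on S (\<lambda>t. poly F (cis t))" for S
    by (intro continuous_intros)
  have cXF: "continuous_on S (\<lambda>t. X (poly F (cis t)) powr r)" and cWF: "continuous_on S (\<lambda>t. W (poly
      F (cis t)) powr r)" for S r
    by (rule continuous_on_compose2[OF cXq[of UNIV] cF] continuous_on_compose2[OF cWq[of UNIV] cF],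
        simp)+
  have dRe: "(Re has_derivative Re) (at z)" and dIm: "(Im has_derivative Im) (at z)" for z
    by (auto intro!: derivative_eq_intros)
  define H where "H = (\<lambda>z. C * X z powr q - W z powr q)"
  have "2 * pi * H (poly F 0) \<le> integral {0..2*pi} (\<lambda>t. H (poly F (cis t)))"
  proof (rule subharmonic_mean_poly[where Hx = "\<lambda>z. 2 * q * Re z * (C * X z powr (q - 1) - W z powr
      (q - 1))"
      and Hy = "\<lambda>z. - 2 * q * Im z * W z powr (q - 1)"
      and Hxx = "\<lambda>z. 2 * q * (C * X z powr (q - 1) - W z powr (q - 1))
          + 4 * q * (q - 1) * (Re z)\<^sup>2 * (C * X z powr (q - 1 - 1) - W z powr (q - 1 - 1))"
      and Hxy = "\<lambda>z. - 4 * q * (q - 1) * Re z * Im z * W z powr (q - 1 - 1)"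
      and Hyy = "\<lambda>z. - 2 * q * W z powr (q - 1) - 4 * q * (q - 1) * (Im z)\<^sup>2 * W z powr (q - 1 -
          1)"])
    fix z
    show "(H has_derivative (\<lambda>d. 2 * q * Re z * (C * X z powr (q - 1) - W z powr (q - 1)) * Re d +
                   - 2 * q * Im z * W z powr (q - 1) * Im d)) (at z)"
      unfolding H_def
      by (rule has_derivative_eq_rhs[OF has_derivative_diff[OF has_derivative_mult_right[OF dXq]
          dWq]])
         (simp add: fun_eq_iff algebra_simps)
    show "((\<lambda>z. 2 * q * Re z * (C * X z powr (q - 1) - W z powr (q - 1))) has_derivative
          (\<lambda>d. (2 * q * (C * X z powr (q - 1) - W z powr (q - 1))
          + 4 * q * (q - 1) * (Re z)\<^sup>2 * (C * X z powr (q - 1 - 1) - W z powr (q - 1 - 1))) * Re d +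
            (- 4 * q * (q - 1) * Re z * Im z * W z powr (q - 1 - 1)) * Im d)) (at z)"
      by (rule has_derivative_eq_rhs[OF has_derivative_mult[OF has_derivative_mult_right[OF dRe]
          has_derivative_diff[OF has_derivative_mult_right[OF dXq] dWq]]])
         (simp add: fun_eq_iff algebra_simps power2_eq_square)
    show "((\<lambda>z. - 2 * q * Im z * W z powr (q - 1)) has_derivative
          (\<lambda>d. - 4 * q * (q - 1) * Re z * Im z * W z powr (q - 1 - 1) * Re d +
               (- 2 * q * W z powr (q - 1) - 4 * q * (q - 1) * (Im z)\<^sup>2 * W z powr (q - 1 - 1)) * Im
                   d)) (at z)"
      by (rule has_derivative_eq_rhs[OF has_derivative_mult[OF has_derivative_mult_right[OF dIm]
          dWq]])
         (simp add: fun_eq_iff algebra_simps power2_eq_square)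
    define x where "x = (Re z)\<^sup>2" define y where "y = (Im z)\<^sup>2"
    have xy: "x \<ge> 0" "y \<ge> 0" "x \<le> X z" "x + y \<le> W z" using e by (auto simp: x_def y_def X_def W_def)
    have X1: "X z powr (q - 1) = X z * X z powr (q - 1 - 1)" and W1: "W z powr (q - 1) = W z * W z
        powr (q - 1 - 1)"
      using pos[of z] powr_mult_base[of "X z" "q - 1 - 1"] powr_mult_base[of "W z" "q - 1 - 1"] by
          auto
    \<comment> \<open>The chain ascends to the Laplacian of \<open>H\<close>. It starts from
      \<open>X z \<le> W z\<close> and the exponent \<open>q - 1 \<le> 0\<close>, then uses
      \<open>x \<le> X z\<close> and \<open>(q - 1) * (x + y) \<le> 0\<close>.\<close>
    have "0 \<le> 4 * q * (X z powr (q - 1) - W z powr (q - 1))"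
      using q pos[of z] XW[of z] by (intro mult_nonneg_nonneg) (auto intro!: powr_mono2')
    also have "\<dots> = 2 * q * C * ((2 * q - 1) * X z) * X z powr (q - 1 - 1) - 4 * q * W z * W z powr
        (q - 1 - 1)"
    proof -
      have "2 * q * C * ((2 * q - 1) * X z) * X z powr (q - 1 - 1) = 2 * q * (C * (2 * q - 1)) * X z
          * X z powr (q - 1 - 1)"
        by simp
      then show ?thesis unfolding X1 W1 C(2) by (simp add: algebra_simps)
    qed
    also have "\<dots> \<le> 2 * q * C * (X z + 2 * (q - 1) * x) * X z powr (q - 1 - 1) - 4 * q * (W z + (q -
        1) * (x + y)) * W z powr (q - 1 - 1)"
    proof (intro diff_mono mult_right_mono mult_left_mono)
      have "(1 - q) * x \<le> (1 - q) * X z" using q xy by (intro mult_left_mono) auto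
      then show "(2 * q - 1) * X z \<le> X z + 2 * (q - 1) * x" by (simp add: algebra_simps)
      have "(1 - q) * (x + y) \<ge> 0" using q xy by simp
      then show "W z + (q - 1) * (x + y) \<le> W z" by (simp add: algebra_simps)
    qed (use q C in auto)
    also have "\<dots> = 2 * q * (C * X z powr (q - 1) - W z powr (q - 1)) +
             4 * q * (q - 1) * x * (C * X z powr (q - 1 - 1) - W z powr (q - 1 - 1)) +
             (- 2 * q * W z powr (q - 1) - 4 * q * (q - 1) * y * W z powr (q - 1 - 1))"
      unfolding X1 W1 by (simp add: algebra_simps)
    finally show "0 \<le> 2 * q * (C * X z powr (q - 1) - W z powr (q - 1)) +
             4 * q * (q - 1) * (Re z)\<^sup>2 * (C * X z powr (q - 1 - 1) - W z powr (q - 1 - 1)) +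
             (- 2 * q * W z powr (q - 1) - 4 * q * (q - 1) * (Im z)\<^sup>2 * W z powr (q - 1 - 1))"
      unfolding x_def y_def .
  qed (rule cXq cWq continuous_on_const continuous_on_add continuous_on_diff continuous_on_mult
      continuous_on_minus continuous_on_power continuous_on_Re continuous_on_Im continuous_on_id)+
  also have "\<dots> = C * integral {0..2*pi} (\<lambda>t. X (poly F (cis t)) powr q) - integral {0..2*pi} (\<lambda>t. W
      (poly F (cis t)) powr q)"
    unfolding H_def
    by (subst integral_diff) (auto intro!: integrable_continuous_real continuous_on_mult
        continuous_on_const cXF cWF)
  finally have main: "2 * pi * H (poly F 0) + integral {0..2*pi} (\<lambda>t. W (poly F (cis t)) powr q)
      \<le> C * integral {0..2*pi} (\<lambda>t. X (poly F (cis t)) powr q)" by simp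
  have np: "norm z powr p \<le> W z powr q" for z
  proof -
    have "norm z powr p = (norm z powr 2) powr q" unfolding powr_powr by (simp add: q_def)
    also have "\<dots> = ((norm z)\<^sup>2) powr q" by simp
    also have "\<dots> \<le> W z powr q" using e q by (intro powr_mono2) (auto simp: W_def cmod_power2)
    finally show ?thesis .
  qed
  \<comment> \<open>On the real axis \<open>X\<close> and \<open>W\<close> agree, so
    \<open>H\<close> is \<open>(C - 1) * W powr q\<close> there; this is where \<open>F0\<close>
    enters.\<close>
  have "norm (poly F 0) powr p \<le> 1 * W (poly F 0) powr q" using np by simp
  also have "\<dots> \<le> (C - 1) * W (poly F 0) powr q" using C by (intro mult_right_mono) auto
  also have "\<dots> = H (poly F 0)" by (simp add: H_def X_def W_def F0 algebra_simps)
  finally have "2 * pi * norm (poly F 0) powr p \<le> 2 * pi * H (poly F 0)" by simp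
  moreover have "integral {0..2*pi} (\<lambda>t. norm (poly F (cis t)) powr p) \<le> integral {0..2*pi} (\<lambda>t. W
      (poly F (cis t)) powr q)"
    using p by (intro integral_le np integrable_continuous_real cWF continuous_on_powr'
        continuous_on_norm cF continuous_on_const) auto
  ultimately have "2 * pi * norm (poly F 0) powr p + integral {0..2*pi} (\<lambda>t. norm (poly F (cis t))
      powr p)
     \<le> C * integral {0..2*pi} (\<lambda>t. X (poly F (cis t)) powr q)" using main by linarith
  then show ?thesis by (simp only: C_def q_def X_def)
qed

text \<open>
  For \<open>p > 2\<close> the Laplacian of \<open>|Re z|\<^sup>p\<close> vanishes on the imaginary axis and cannot compensate that
      of \<open>|z|\<^sup>p\<close>.
  The Laplacian of \<open>(Re z)\<^sup>2 |z|\<^bsup>p-2\<^esup>\<close> is at least \<open>2 |z|\<^bsup>p-2\<^esup>\<close>, so this function takes its place,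
      and it is
  absorbed into \<open>|z|\<^sup>p / 2 + C |Re z|\<^sup>p\<close> afterwards.
\<close>

lemma conjugate_bound_regularized_ge_2:
  fixes p e :: real and F :: "complex poly"
  assumes p: "2 \<le> p" and e: "e > 0" and F0: "Im (poly F 0) = 0"
  shows "2 * pi * norm (poly F 0) powr p + integral {0..2*pi} (\<lambda>t. norm (poly F (cis t)) powr p)
     \<le> 2 * (p\<^sup>2) powr (p / 2) * integral {0..2*pi} (\<lambda>t. ((Re (poly F (cis t)))\<^sup>2 + e) powr (p / 2))"
proof -
  define q where "q = p / 2"
  \<comment> \<open>\<open>2 * K\<close> is \<open>p\<^sup>2\<close>, the factor in the Laplacian
    p^2 |z|^(p-2) of |z|^p, which \<open>K\<close> times the lower bound 2 |z|^(p-2) just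
    balances.\<close>
  define K where "K = 2 * q\<^sup>2"
  have q: "q \<ge> 1" using p by (auto simp: q_def)
  have K: "K \<ge> 2" using q by (simp add: K_def)
  define X where "X = (\<lambda>z. (Re z)\<^sup>2 + e)"
  define W where "W = (\<lambda>z. (Re z)\<^sup>2 + (Im z)\<^sup>2 + e)"
  have pos: "X z > 0" "W z > 0" for z
    using e by (auto simp: X_def W_def add_nonneg_pos)
  have dX: "(X has_derivative (\<lambda>d. 2 * Re z * Re d)) (at z)" for z
    unfolding X_def by (auto intro!: derivative_eq_intros simp: fun_eq_iff)
  have dW: "(W has_derivative (\<lambda>d. 2 * Re z * Re d + 2 * Im z * Im d)) (at z)" for z
    unfolding W_def by (auto intro!: derivative_eq_intros simp: fun_eq_iff)
  note dWq = has_derivative_powr_const[OF dW pos(2)]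
  have cX: "continuous_on S X" and cW: "continuous_on S W" for S
    unfolding X_def W_def by (intro continuous_intros)+
  have cXq: "continuous_on S (\<lambda>z. X z powr r)" and cWq: "continuous_on S (\<lambda>z. W z powr r)" for S r
    using pos by (auto intro!: continuous_on_powr cX cW continuous_on_const simp:
        less_imp_neq[symmetric])
  have cF: "continuous_on S (\<lambda>t. poly F (cis t))" for S
    by (intro continuous_intros)
  have cXF: "continuous_on S (\<lambda>t. X (poly F (cis t)) powr r)" and cWF: "continuous_on S (\<lambda>t. W (poly
      F (cis t)) powr r)" for S r
    by (rule continuous_on_compose2[OF cXq[of UNIV] cF] continuous_on_compose2[OF cWq[of UNIV] cF],
        simp)+
  have dRe: "(Re has_derivative Re) (at z)" and dIm: "(Im has_derivative Im) (at z)" for z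
    by (auto intro!: derivative_eq_intros)
  define H where "H = (\<lambda>z. K * (X z * W z powr (q - 1)) - W z powr q)"
  have "2 * pi * H (poly F 0) \<le> integral {0..2*pi} (\<lambda>t. H (poly F (cis t)))"
  proof (rule subharmonic_mean_poly[where Hx = "\<lambda>z. Re z * ((2 * K - 2 * q) * W z powr (q - 1) + 2 *
      K * (q - 1) * (X z * W z powr (q - 1 - 1)))"
      and Hy = "\<lambda>z. Im z * (2 * K * (q - 1) * (X z * W z powr (q - 1 - 1)) - 2 * q * W z powr (q -
          1))"
      and Hxx = "\<lambda>z. (2 * K - 2 * q) * W z powr (q - 1) + 2 * K * (q - 1) * (X z * W z powr (q - 1 -
          1))
         + (Re z)\<^sup>2 * ((2 * K - 2 * q) * (2 * (q - 1) * W z powr (q - 1 - 1))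
              + 4 * K * (q - 1) * (W z powr (q - 1 - 1) + (q - 1 - 1) * X z * W z powr (q - 1 - 1 -
                  1)))"
      and Hxy = "\<lambda>z. Re z * Im z * ((2 * K - 2 * q) * (2 * (q - 1) * W z powr (q - 1 - 1))
              + 4 * K * (q - 1) * (q - 1 - 1) * X z * W z powr (q - 1 - 1 - 1))"
      and Hyy = "\<lambda>z. 2 * K * (q - 1) * (X z * W z powr (q - 1 - 1)) - 2 * q * W z powr (q - 1)
         + (Im z)\<^sup>2 * (4 * K * (q - 1) * (q - 1 - 1) * X z * W z powr (q - 1 - 1 - 1) - 4 * q * (q -
             1) * W z powr (q - 1 - 1))"])
    fix z
    show "(H has_derivative (\<lambda>d. Re z * ((2 * K - 2 * q) * W z powr (q - 1) + 2 * K * (q - 1) * (X z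
        * W z powr (q - 1 - 1))) * Re d +
        Im z * (2 * K * (q - 1) * (X z * W z powr (q - 1 - 1)) - 2 * q * W z powr (q - 1)) * Im d))
            (at z)"
      unfolding H_def
      by (rule has_derivative_eq_rhs[OF has_derivative_diff[OF has_derivative_mult_right[OF
          has_derivative_mult[OF dX dWq]] dWq]])
         (simp add: fun_eq_iff algebra_simps)
    show "((\<lambda>z. Re z * ((2 * K - 2 * q) * W z powr (q - 1) + 2 * K * (q - 1) * (X z * W z powr (q -
        1 - 1)))) has_derivative
       (\<lambda>d. ((2 * K - 2 * q) * W z powr (q - 1) + 2 * K * (q - 1) * (X z * W z powr (q - 1 - 1))
         + (Re z)\<^sup>2 * ((2 * K - 2 * q) * (2 * (q - 1) * W z powr (q - 1 - 1))
              + 4 * K * (q - 1) * (W z powr (q - 1 - 1) + (q - 1 - 1) * X z * W z powr (q - 1 - 1 -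
                  1)))) * Re d +
        (Re z * Im z * ((2 * K - 2 * q) * (2 * (q - 1) * W z powr (q - 1 - 1))
              + 4 * K * (q - 1) * (q - 1 - 1) * X z * W z powr (q - 1 - 1 - 1))) * Im d)) (at z)"
      by (rule has_derivative_eq_rhs[OF has_derivative_mult[OF dRe has_derivative_add[OF
          has_derivative_mult_right[OF dWq]
            has_derivative_mult_right[OF has_derivative_mult[OF dX dWq]]]]])
         (simp add: fun_eq_iff algebra_simps power2_eq_square)
    show "((\<lambda>z. Im z * (2 * K * (q - 1) * (X z * W z powr (q - 1 - 1)) - 2 * q * W z powr (q - 1)))
        has_derivative
        (\<lambda>d. (Re z * Im z * ((2 * K - 2 * q) * (2 * (q - 1) * W z powr (q - 1 - 1))
              + 4 * K * (q - 1) * (q - 1 - 1) * X z * W z powr (q - 1 - 1 - 1))) * Re d +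
          (2 * K * (q - 1) * (X z * W z powr (q - 1 - 1)) - 2 * q * W z powr (q - 1)
         + (Im z)\<^sup>2 * (4 * K * (q - 1) * (q - 1 - 1) * X z * W z powr (q - 1 - 1 - 1) - 4 * q * (q -
             1) * W z powr (q - 1 - 1))) * Im d)) (at z)"
      by (rule has_derivative_eq_rhs[OF has_derivative_mult[OF dIm has_derivative_diff[OF
            has_derivative_mult_right[OF has_derivative_mult[OF dX dWq]]
                has_derivative_mult_right[OF dWq]]]])
         (simp add: fun_eq_iff algebra_simps power2_eq_square)
    define x where "x = (Re z)\<^sup>2" define y where "y = (Im z)\<^sup>2"
    define V where "V = W z powr (q - 1 - 1 - 1)"
    have xy: "x \<ge> 0" "y \<ge> 0" "x + y \<le> W z" using e by (auto simp: x_def y_def W_def)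
    have V: "V \<ge> 0" by (simp add: V_def)
    have W2: "W z powr (q - 1 - 1) = W z * V"
      using pos[of z] powr_mult_base[of "W z" "q - 1 - 1 - 1"] by (auto simp: V_def)
    have "W z powr (q - 1) = W z * W z powr (q - 1 - 1)"
      using pos[of z] powr_mult_base[of "W z" "q - 1 - 1"] by auto
    then have W1: "W z powr (q - 1) = W z * (W z * V)" unfolding W2 .
    have "W z + (q - 1 - 1) * (x + y) = (W z - (x + y)) + (q - 1) * (x + y)" by (simp add:
        algebra_simps)
    also have "\<dots> \<ge> 0" using xy q by (intro add_nonneg_nonneg mult_nonneg_nonneg) auto
    finally have 1: "W z + (q - 1 - 1) * (x + y) \<ge> 0" .
    \<comment> \<open>Three nonnegative groups add up to the Laplacian of \<open>H\<close>; the
      first one relies on \<open>2 * K - 4 * q = 4 * q * (q - 1)\<close>, the property that fixes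
      \<open>K\<close>.\<close>
    have "0 \<le> 4 * q * (q - 1) * (W z * V) * (W z - (x + y)) + 8 * K * (q - 1) * x * (W z * V)
          + 4 * K * (q - 1) * X z * V * (W z + (q - 1 - 1) * (x + y))"
      using q K pos[of z] xy V by (intro add_nonneg_nonneg mult_nonneg_nonneg[OF _ 1]) auto
    also have "\<dots> = (2 * K - 2 * q) * (W z * (W z * V)) + 2 * K * (q - 1) * (X z * (W z * V))
         + x * ((2 * K - 2 * q) * (2 * (q - 1) * (W z * V))
              + 4 * K * (q - 1) * ((W z * V) + (q - 1 - 1) * X z * V))
        + (2 * K * (q - 1) * (X z * (W z * V)) - 2 * q * (W z * (W z * V))
         + y * (4 * K * (q - 1) * (q - 1 - 1) * X z * V - 4 * q * (q - 1) * (W z * V)))"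
      unfolding K_def by (simp add: algebra_simps power2_eq_square)
    finally show "0 \<le> (2 * K - 2 * q) * W z powr (q - 1) + 2 * K * (q - 1) * (X z * W z powr (q - 1
        - 1))
         + (Re z)\<^sup>2 * ((2 * K - 2 * q) * (2 * (q - 1) * W z powr (q - 1 - 1))
              + 4 * K * (q - 1) * (W z powr (q - 1 - 1) + (q - 1 - 1) * X z * W z powr (q - 1 - 1 -
                  1)))
        + (2 * K * (q - 1) * (X z * W z powr (q - 1 - 1)) - 2 * q * W z powr (q - 1)
         + (Im z)\<^sup>2 * (4 * K * (q - 1) * (q - 1 - 1) * X z * W z powr (q - 1 - 1 - 1) - 4 * q * (q -
             1) * W z powr (q - 1 - 1)))"
      unfolding x_def y_def W1 W2 V_def .
  qed (rule cX cWq continuous_on_const continuous_on_add continuous_on_diff continuous_on_mult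
      continuous_on_minus continuous_on_power continuous_on_Re continuous_on_Im continuous_on_id)+
  also have "\<dots> \<le> integral {0..2*pi} (\<lambda>t. (2 * K) powr q * X (poly F (cis t)) powr q - 1/2 * W (poly
      F (cis t)) powr q)"
  proof (rule integral_le)
    show "(\<lambda>t. H (poly F (cis t))) integrable_on {0..2 * pi}"
      unfolding H_def by (intro integrable_continuous_real continuous_on_diff continuous_on_mult
          continuous_on_const continuous_on_compose2[OF cX[of UNIV] cF] cWF) auto
    show "(\<lambda>t. (2 * K) powr q * X (poly F (cis t)) powr q - 1/2 * W (poly F (cis t)) powr q)
        integrable_on {0..2 * pi}"
      by (intro integrable_continuous_real continuous_on_diff continuous_on_mult continuous_on_const
          cXF cWF)
    fix t
    define z where "z = poly F (cis t)"
    have Wq: "W z * W z powr (q - 1) = W z powr q" using pos[of z] powr_mult_base[of "W z" "q - 1"]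
        by auto
    \<comment> \<open>A splitting in the manner of Young's inequality: if
      \<open>2 * K * X z \<le> W z\<close>, the mixed term costs at most half of
      \<open>W z powr q\<close>; otherwise \<open>W z\<close> is itself bounded by
      \<open>2 * K * X z\<close>.\<close>
    have "K * (X z * W z powr (q - 1)) \<le> 1/2 * W z powr q + (2 * K) powr q * X z powr q"
    proof (cases "2 * K * X z \<le> W z")
      case True
      then have "2 * K * X z * W z powr (q - 1) \<le> W z * W z powr (q - 1)" by (rule mult_right_mono)
          simp
      moreover have "0 \<le> (2 * K) powr q * X z powr q" by simp
      ultimately show ?thesis unfolding Wq by linarith
    next
      case False
      have "2 * (K * (X z * W z powr (q - 1))) \<le> (2 * K * X z) * (2 * K * X z) powr (q - 1)"
        using False q K pos[of z] by (auto intro!: mult_left_mono powr_mono2)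
      also have "\<dots> = (2 * K * X z) powr q"
        using K pos[of z] powr_mult_base[of "2 * K * X z" "q - 1"] by auto
      also have "\<dots> = (2 * K) powr q * X z powr q" using K pos[of z] by (subst powr_mult) auto
      finally have "2 * (K * (X z * W z powr (q - 1))) \<le> (2 * K) powr q * X z powr q" .
      moreover have "0 \<le> (2 * K) powr q * X z powr q" "0 \<le> W z powr q" by simp_all
      ultimately show ?thesis by linarith
    qed
    then show "H (poly F (cis t)) \<le> (2 * K) powr q * X (poly F (cis t)) powr q - 1/2 * W (poly F
        (cis t)) powr q"
      unfolding H_def z_def by simp
  qed
  also have "\<dots> = (2 * K) powr q * integral {0..2*pi} (\<lambda>t. X (poly F (cis t)) powr q) - 1/2 *
      integral {0..2*pi} (\<lambda>t. W (poly F (cis t)) powr q)"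
    by (subst integral_diff) (auto intro!: integrable_continuous_real continuous_on_mult
        continuous_on_const cXF cWF)
  finally have main: "2 * (2 * pi * H (poly F 0)) + integral {0..2*pi} (\<lambda>t. W (poly F (cis t)) powr
      q)
      \<le> 2 * (2 * K) powr q * integral {0..2*pi} (\<lambda>t. X (poly F (cis t)) powr q)" by simp
  have np: "norm z powr p \<le> W z powr q" for z
  proof -
    have "norm z powr p = (norm z powr 2) powr q" unfolding powr_powr by (simp add: q_def)
    also have "\<dots> = ((norm z)\<^sup>2) powr q" by simp
    also have "\<dots> \<le> W z powr q" using e q by (intro powr_mono2) (auto simp: W_def cmod_power2)
    finally show ?thesis .
  qed
  have "norm (poly F 0) powr p \<le> 1 * W (poly F 0) powr q" using np by simp
  also have "\<dots> \<le> (K - 1) * W (poly F 0) powr q" using K by (intro mult_right_mono) auto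
  also have "\<dots> = H (poly F 0)"
  proof -
    have "W (poly F 0) * W (poly F 0) powr (q - 1) = W (poly F 0) powr q"
      using pos(2)[of "poly F 0"] powr_mult_base[of "W (poly F 0)" "q - 1"] by auto
    moreover have "X (poly F 0) = W (poly F 0)" by (simp add: X_def W_def F0)
    ultimately show ?thesis by (simp add: H_def left_diff_distrib)
  qed
  finally have "norm (poly F 0) powr p \<le> H (poly F 0)" .
  moreover have "0 \<le> norm (poly F 0) powr p" by simp
  ultimately have "norm (poly F 0) powr p \<le> 2 * H (poly F 0)" by linarith
  then have "2 * pi * norm (poly F 0) powr p \<le> 2 * (2 * pi * H (poly F 0))" by simp
  moreover have "integral {0..2*pi} (\<lambda>t. norm (poly F (cis t)) powr p) \<le> integral {0..2*pi} (\<lambda>t. W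
      (poly F (cis t)) powr q)"
    using p by (intro integral_le np integrable_continuous_real cWF continuous_on_powr'
        continuous_on_norm cF continuous_on_const) auto
  ultimately have "2 * pi * norm (poly F 0) powr p + integral {0..2*pi} (\<lambda>t. norm (poly F (cis t))
      powr p)
     \<le> 2 * (2 * K) powr q * integral {0..2*pi} (\<lambda>t. X (poly F (cis t)) powr q)" using main by
         linarith
  moreover have "2 * K = p\<^sup>2" by (simp add: K_def q_def power2_eq_square)
  ultimately show ?thesis by (simp only: q_def X_def)
qed

text \<open>The constants of both regularized bounds are free of \<open>e\<close>, so
  \<open>e\<close> can go to 0 under the integral. The summand with \<open>F 0\<close> is carried
  along because the completion used later is \<open>F + F 0\<close> rather than
  \<open>F\<close>.\<close>

theorem riesz_conjugate_bound:
  fixes p :: real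
  assumes p: "1 < p"
  shows "\<exists>C\<ge>0. \<forall>F. Im (poly F 0) = 0 \<longrightarrow>
    2 * pi * norm (poly F 0) powr p + integral {0..2*pi} (\<lambda>t. norm (poly F (cis t)) powr p)
      \<le> C * integral {0..2*pi} (\<lambda>t. \<bar>Re (poly F (cis t))\<bar> powr p)"
proof -
  define C where "C = (if p \<le> 2 then 2 / (p - 1) else 2 * (p\<^sup>2) powr (p / 2))"
  have "2 * pi * norm (poly F 0) powr p + integral {0..2*pi} (\<lambda>t. norm (poly F (cis t)) powr p)
      \<le> C * integral {0..2*pi} (\<lambda>t. \<bar>Re (poly F (cis t))\<bar> powr p)" (is "?L \<le> _")
    if F0: "Im (poly F 0) = 0" for F
  proof -
    define m where "m = (\<lambda>e. integral (cbox 0 (2*pi)) (\<lambda>t. ((Re (poly F (cis t)))\<^sup>2 + e) powr (p /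
        2)))"
    have le: "?L \<le> C * m e" if "e > 0" for e
      using conjugate_bound_regularized_le_2[OF p _ that F0] conjugate_bound_regularized_ge_2[OF _
          that F0]
      by (auto simp: C_def m_def)
    have "continuous_on {0..} m"
      unfolding m_def using p
      by (intro integral_continuous_on_param)
         (auto simp: case_prod_unfold intro!: continuous_intros continuous_on_powr')
    then have "(m \<longlongrightarrow> m 0) (at 0 within {0..})" by (simp add: continuous_on)
    then have "(m \<longlongrightarrow> m 0) (at_right 0)" by (rule tendsto_within_subset) auto
    then have "((\<lambda>e. C * m e) \<longlongrightarrow> C * m 0) (at_right 0)" by (intro tendsto_intros)
    then have "?L \<le> C * m 0"
      by (rule tendsto_lowerbound) (auto simp: eventually_at_right_less intro!:
          eventually_at_rightI[of 0 1] le)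
    moreover have "(x\<^sup>2) powr (p / 2) = \<bar>x\<bar> powr p" for x :: real
    proof -
      have "(x\<^sup>2) powr (p / 2) = (\<bar>x\<bar> powr 2) powr (p / 2)" by simp
      then show ?thesis unfolding powr_powr by simp
    qed
    ultimately show ?thesis by (simp add: m_def)
  qed
  moreover have "C \<ge> 0" using p by (simp add: C_def)
  ultimately show ?thesis by blast
qed

section \<open>Partial sum operators on trigonometric polynomials\<close>

text \<open>With coefficients on all integers and a separate frequency set, restricting a
  trigonometric polynomial to a band of frequencies is just an intersection.\<close>

definition trig_sum :: "(int \<Rightarrow> complex) \<Rightarrow> int set \<Rightarrow> real \<Rightarrow> complex" where
  "trig_sum c K t = (\<Sum>k\<in>K. c k * cis (of_int k * t))"

text \<open>A crude form of Minkowski's inequality: estimates are made for integrals of p-th powers,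
  where a factor 2^p per addition is harmless.\<close>

lemma norm_add_powr_le:
  fixes x y :: "'a::real_normed_vector"
  assumes "p \<ge> 0"
  shows "norm (x + y) powr p \<le> 2 powr p * (norm x powr p + norm y powr p)"
proof -
  have "norm (x + y) powr p \<le> (2 * max (norm x) (norm y)) powr p"
    using norm_triangle_ineq[of x y] assms by (intro powr_mono2) auto
  also have "\<dots> = 2 powr p * max (norm x) (norm y) powr p"
    by (rule powr_mult)
  also have "max (norm x) (norm y) powr p \<le> norm x powr p + norm y powr p"
    by (simp add: max_def)
  finally show ?thesis by simp
qed

lemma norm_diff_powr_le:
  fixes x y :: "'a::real_normed_vector"
  assumes "p \<ge> 0"
  shows "norm (x - y) powr p \<le> 2 powr p * (norm x powr p + norm y powr p)"
  using norm_add_powr_le[OF assms, of x "- y"] by simp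

lemma integrable_norm_powr:
  fixes f :: "real \<Rightarrow> 'a::real_normed_vector"
  assumes "continuous_on {a..b} f" "p > 0"
  shows "(\<lambda>t. norm (f t) powr p) integrable_on {a..b}"
  using assms by (intro integrable_continuous_real continuous_on_powr' continuous_on_norm
      continuous_on_const) auto

text \<open>
  The polynomial on the left is \<open>F + F 0\<close> for the analytic \<open>F\<close> with \<open>Re F = Re T\<close> on the circle,
      where \<open>T\<close> is
  the trigonometric polynomial on the right.
\<close>

lemma analytic_completion_bound:
  fixes p :: real
  assumes p: "1 < p"
  shows "\<exists>C\<ge>0. \<forall>\<alpha> \<beta> (N::nat).
     integral {0..2*pi} (\<lambda>t. norm (2 * of_real (Re (\<alpha> 0)) + (\<Sum>k=1..N. (\<alpha> k + cnj (\<beta> k)) * cis (real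
         k * t))) powr p)
     \<le> C * integral {0..2*pi} (\<lambda>t. norm (\<alpha> 0 + (\<Sum>k=1..N. \<alpha> k * cis (real k * t) + \<beta> k * cis (- (real
         k * t)))) powr p)"
proof -
  obtain C where C: "C \<ge> 0" and bound: "\<And>F. Im (poly F 0) = 0 \<Longrightarrow>
    2 * pi * norm (poly F 0) powr p + integral {0..2*pi} (\<lambda>t. norm (poly F (cis t)) powr p)
      \<le> C * integral {0..2*pi} (\<lambda>t. \<bar>Re (poly F (cis t))\<bar> powr p)"
    using riesz_conjugate_bound[OF p] by auto
  show ?thesis
  proof (rule exI[of _ "2 powr p * C"], safe)
    show "0 \<le> 2 powr p * C" using C by simp
    fix \<alpha> \<beta> :: "nat \<Rightarrow> complex" and N :: nat
    define T where "T = (\<lambda>t. \<alpha> 0 + (\<Sum>k=1..N. \<alpha> k * cis (real k * t) + \<beta> k * cis (- (real k * t))))"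
    define G where "G = (\<lambda>t. of_real (Re (\<alpha> 0)) + (\<Sum>k=1..N. (\<alpha> k + cnj (\<beta> k)) * cis (real k * t)))"
    define F where "F = [:of_real (Re (\<alpha> 0)):] + (\<Sum>k=1..N. monom (\<alpha> k + cnj (\<beta> k)) k)"
    have F0: "poly F 0 = of_real (Re (\<alpha> 0))"
      by (simp add: F_def poly_sum poly_monom power_0_left)
    have Ft: "poly F (cis t) = G t" for t
      by (simp add: F_def G_def poly_sum poly_monom Complex.DeMoivre)
    \<comment> \<open>Conjugating \<open>\<beta> k * cis (- (real k * t))\<close> keeps its real
      part and flips its frequency, which is how \<open>G\<close> becomes analytic.\<close>
    have Re: "Re (G t) = Re (T t)" for t
    proof -
      have "Re ((\<alpha> k + cnj (\<beta> k)) * cis (real k * t)) = Re (\<alpha> k * cis (real k * t) + \<beta> k * cis (-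
          (real k * t)))" for k
        by (simp add: algebra_simps)
      then show ?thesis by (simp add: G_def T_def Re_sum)
    qed
    have contT: "continuous_on {0..2*pi} T" unfolding T_def by (intro continuous_intros)
    have contG: "continuous_on {0..2*pi} G" unfolding G_def by (intro continuous_intros)
    have p0: "p > 0" using p by simp
    have int: "(\<lambda>t. norm (G t) powr p) integrable_on {0..2*pi}"
      by (intro integrable_norm_powr contG p0)
    \<comment> \<open>The constant term is doubled to be on a par with the others: two completions
      recover \<open>2 * \<alpha> k\<close> for \<open>k \<ge> 1\<close>, but without doubling only
      a single \<open>\<alpha> 0\<close>.\<close>
    have "integral {0..2*pi} (\<lambda>t. norm (of_real (Re (\<alpha> 0)) + G t) powr p)
       \<le> integral {0..2*pi} (\<lambda>t. 2 powr p * (norm (poly F 0) powr p + norm (G t) powr p))"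
      using norm_add_powr_le[of p "of_real (Re (\<alpha> 0))" "G _"] p
      by (intro integral_le integrable_norm_powr continuous_on_add continuous_on_const contG p0
          integrable_on_mult_right Henstock_Kurzweil_Integration.integrable_add integrable_const_ivl
          int)
         (auto simp: F0)
    also have "\<dots> = 2 powr p * (2 * pi * norm (poly F 0) powr p + integral {0..2*pi} (\<lambda>t. norm (G t)
        powr p))"
      by (simp add: integral_add[OF integrable_const_ivl int])
    also have "\<dots> \<le> 2 powr p * (C * integral {0..2*pi} (\<lambda>t. \<bar>Re (T t)\<bar> powr p))"
      using bound[of F] by (intro mult_left_mono) (auto simp: F0 Ft Re)
    also have "\<dots> \<le> 2 powr p * (C * integral {0..2*pi} (\<lambda>t. norm (T t) powr p))"
      using C p0 abs_Re_le_cmod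
      by (intro mult_left_mono integral_le integrable_norm_powr contT p0 powr_mono2
           integrable_norm_powr[where 'a = real, unfolded real_norm_def] continuous_on_Re) auto
    finally show "integral {0..2*pi} (\<lambda>t. norm (2 * of_real (Re (\<alpha> 0)) + (\<Sum>k=1..N. (\<alpha> k + cnj (\<beta> k))
        * cis (real k * t))) powr p)
     \<le> 2 powr p * C * integral {0..2*pi} (\<lambda>t. norm (\<alpha> 0 + (\<Sum>k=1..N. \<alpha> k * cis (real k * t) + \<beta> k *
         cis (- (real k * t)))) powr p)"
      by (simp add: G_def T_def algebra_simps)
  qed
qed

text \<open>Completion is only real linear. For a real linear map R, the combination R(T) + i R(-iT)
  is complex linear in T, and here it removes the conjugated coefficients.\<close>

lemma analytic_part_bound:
  fixes p :: real
  assumes p: "1 < p"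
  shows "\<exists>C\<ge>0. \<forall>\<alpha> \<beta> (N::nat).
     integral {0..2*pi} (\<lambda>t. norm (\<Sum>k\<le>N. \<alpha> k * cis (real k * t)) powr p)
     \<le> C * integral {0..2*pi} (\<lambda>t. norm (\<alpha> 0 + (\<Sum>k=1..N. \<alpha> k * cis (real k * t) + \<beta> k * cis (- (real
         k * t)))) powr p)"
proof -
  obtain C where C: "C \<ge> 0" and bound: "\<And>\<alpha> \<beta> (N::nat).
     integral {0..2*pi} (\<lambda>t. norm (2 * of_real (Re (\<alpha> 0)) + (\<Sum>k=1..N. (\<alpha> k + cnj (\<beta> k)) * cis (real
         k * t))) powr p)
     \<le> C * integral {0..2*pi} (\<lambda>t. norm (\<alpha> 0 + (\<Sum>k=1..N. \<alpha> k * cis (real k * t) + \<beta> k * cis (- (real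
         k * t)))) powr p)"
    using analytic_completion_bound[OF p] by auto
  show ?thesis
  proof (rule exI[of _ "2 * C"], safe)
    show "0 \<le> 2 * C" using C by simp
    fix \<alpha> \<beta> :: "nat \<Rightarrow> complex" and N :: nat
    define T where "T = (\<lambda>t. \<alpha> 0 + (\<Sum>k=1..N. \<alpha> k * cis (real k * t) + \<beta> k * cis (- (real k * t))))"
    define A where "A = (\<lambda>t. 2 * of_real (Re (\<alpha> 0)) + (\<Sum>k=1..N. (\<alpha> k + cnj (\<beta> k)) * cis (real k *
        t)))"
    define B where "B = (\<lambda>t. 2 * of_real (Re (- \<i> * \<alpha> 0)) + (\<Sum>k=1..N. (- \<i> * \<alpha> k + cnj (- \<i> * \<beta> k))
        * cis (real k * t)))"
    \<comment> \<open>Completing both \<open>T\<close> and \<open>- \<i> * T\<close> isolates the analytic part of \<open>T\<close>, see \<open>AB\<close>.\<close>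
    have T': "- \<i> * \<alpha> 0 + (\<Sum>k=1..N. - \<i> * \<alpha> k * cis (real k * t) + - \<i> * \<beta> k * cis (- (real k * t)))
        = - \<i> * T t" for t
      by (simp add: T_def sum_distrib_left algebra_simps)
    have bA: "integral {0..2*pi} (\<lambda>t. norm (A t) powr p) \<le> C * integral {0..2*pi} (\<lambda>t. norm (T t)
        powr p)"
      unfolding A_def T_def by (rule bound)
    have bB: "integral {0..2*pi} (\<lambda>t. norm (B t) powr p) \<le> C * integral {0..2*pi} (\<lambda>t. norm (T t)
        powr p)"
      using bound[of "\<lambda>k. - \<i> * \<alpha> k" "\<lambda>k. - \<i> * \<beta> k" N] unfolding T' by (simp add: norm_mult B_def)
    have AB: "(\<Sum>k\<le>N. \<alpha> k * cis (real k * t)) = (A t + \<i> * B t) / 2" for t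
    proof -
      have "A t + \<i> * B t = 2 * (of_real (Re (\<alpha> 0)) + \<i> * of_real (Im (\<alpha> 0))) +
          (\<Sum>k=1..N. (\<alpha> k + cnj (\<beta> k)) * cis (real k * t) + \<i> * ((- \<i> * \<alpha> k + cnj (- \<i> * \<beta> k)) * cis
              (real k * t)))"
        unfolding A_def B_def sum.distrib sum_distrib_left[symmetric] by (simp add: distrib_left)
      also have "\<dots> = 2 * \<alpha> 0 + (\<Sum>k=1..N. 2 * (\<alpha> k * cis (real k * t)))"
        by (intro arg_cong2[of _ _ _ _ "(+)"] sum.cong) (simp_all add: algebra_simps flip:
            complex_eq)
      also have "\<dots> = 2 * (\<Sum>k\<le>N. \<alpha> k * cis (real k * t))"
        by (simp add: sum.atMost_shift sum_distrib_left atMost_atLeast0 sum.atLeast_Suc_atMost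
            algebra_simps)
      finally show ?thesis by simp
    qed
    have p0: "p > 0" using p by simp
    have contA: "continuous_on {0..2*pi} A" and contB: "continuous_on {0..2*pi} B"
      unfolding A_def B_def by (intro continuous_intros)+
    have "integral {0..2*pi} (\<lambda>t. norm (\<Sum>k\<le>N. \<alpha> k * cis (real k * t)) powr p)
       \<le> integral {0..2*pi} (\<lambda>t. norm (A t) powr p + norm (B t) powr p)"
    proof (intro integral_le integrable_norm_powr p0 Henstock_Kurzweil_Integration.integrable_add
        contA contB)
      fix t
      have "norm (\<Sum>k\<le>N. \<alpha> k * cis (real k * t)) powr p \<le> 2 powr p * (norm (A t / 2) powr p + norm (\<i>
          * B t / 2) powr p)"
        unfolding AB using norm_add_powr_le[of p "A t / 2" "\<i> * B t / 2"] p0 by (simp add: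
            add_divide_distrib)
      also have "\<dots> = norm (A t) powr p + norm (B t) powr p"
        by (simp add: norm_mult norm_divide powr_divide field_simps)
      finally show "norm (\<Sum>k\<le>N. \<alpha> k * cis (real k * t)) powr p \<le> norm (A t) powr p + norm (B t) powr
          p" .
    qed (intro continuous_intros)
    also have "\<dots> \<le> 2 * C * integral {0..2*pi} (\<lambda>t. norm (T t) powr p)"
      using bA bB by (subst integral_add) (auto intro!: integrable_norm_powr p0 contA contB)
    finally show "integral {0..2*pi} (\<lambda>t. norm (\<Sum>k\<le>N. \<alpha> k * cis (real k * t)) powr p)
     \<le> 2 * C * integral {0..2*pi} (\<lambda>t. norm (\<alpha> 0 + (\<Sum>k=1..N. \<alpha> k * cis (real k * t) + \<beta> k * cis (-
         (real k * t)))) powr p)"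
      by (simp add: T_def)
  qed
qed

lemma sum_symmetric_int_interval:
  fixes g :: "int \<Rightarrow> 'a::comm_monoid_add"
  shows "sum g {m - int N..m + int N} = g m + (\<Sum>k=1..N. g (m + int k) + g (m - int k))"
proof (induction N)
  case (Suc N)
  have "{m - int (Suc N)..m + int (Suc N)} = insert (m + int (Suc N)) (insert (m - int (Suc N)) {m -
      int N..m + int N})"
    by auto
  then have "sum g {m - int (Suc N)..m + int (Suc N)} = g (m + int (Suc N)) + (g (m - int (Suc N)) +
      sum g {m - int N..m + int N})"
    by simp
  then show ?case using Suc by (simp add: ac_simps)
qed simp

lemma sum_int_interval_from:
  fixes g :: "int \<Rightarrow> 'a::comm_monoid_add"
  shows "sum g {m..m + int N} = (\<Sum>k\<le>N. g (m + int k))"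
proof (induction N)
  case (Suc N)
  have "{m..m + int (Suc N)} = insert (m + int (Suc N)) {m..m + int N}"
    by auto
  then show ?case using Suc by (simp add: ac_simps)
qed simp

text \<open>Factoring out \<open>cis (of_int m * t)\<close>, of modulus one, moves the cut from
  \<open>m\<close> to 0 without changing norms, so one constant serves every
  \<open>m\<close>.\<close>

lemma half_line_projection_bound:
  fixes p :: real
  assumes p: "1 < p"
  shows "\<exists>C\<ge>0. \<forall>c K m. finite K \<longrightarrow>
     integral {0..2*pi} (\<lambda>t. norm (trig_sum c (K \<inter> {m..}) t) powr p)
     \<le> C * integral {0..2*pi} (\<lambda>t. norm (trig_sum c K t) powr p)"
proof -
  obtain C where C: "C \<ge> 0" and bound: "\<And>\<alpha> \<beta> (N::nat).
     integral {0..2*pi} (\<lambda>t. norm (\<Sum>k\<le>N. \<alpha> k * cis (real k * t)) powr p)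
     \<le> C * integral {0..2*pi} (\<lambda>t. norm (\<alpha> 0 + (\<Sum>k=1..N. \<alpha> k * cis (real k * t) + \<beta> k * cis (- (real
         k * t)))) powr p)"
    using analytic_part_bound[OF p] by auto
  have "integral {0..2*pi} (\<lambda>t. norm (trig_sum c (K \<inter> {m..}) t) powr p)
     \<le> C * integral {0..2*pi} (\<lambda>t. norm (trig_sum c K t) powr p)" if K: "finite K" for c K m
  proof -
    \<comment> \<open>Any upper bound for all |k - m| would do; with the zero extension
      \<open>c'\<close> it replaces the arbitrary finite \<open>K\<close> by an interval centred at
      \<open>m\<close>.\<close>
    define N where "N = (\<Sum>k\<in>K. nat \<bar>k - m\<bar>)"
    have "nat \<bar>k - m\<bar> \<le> N" if "k \<in> K" for k
      unfolding N_def using K that by (rule member_le_sum[of k K "\<lambda>k. nat \<bar>k - m\<bar>", rotated 2]) auto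
    then have sub: "K \<subseteq> {m - int N..m + int N}" by force
    define c' where "c' = (\<lambda>k. if k \<in> K then c k else 0)"
    define g where "g = (\<lambda>t k. c' k * cis (of_int k * t))"
    have T: "trig_sum c K t = sum (g t) {m - int N..m + int N}" for t
      unfolding trig_sum_def using sub by (intro sum.mono_neutral_cong_left) (auto simp: g_def
          c'_def)
    have P: "trig_sum c (K \<inter> {m..}) t = sum (g t) {m..m + int N}" for t
      unfolding trig_sum_def using sub by (intro sum.mono_neutral_cong_left) (auto simp: g_def
          c'_def)
    have shift: "cis (of_int (m + int k) * t) = cis (of_int m * t) * cis (real k * t)"
      "cis (of_int (m - int k) * t) = cis (of_int m * t) * cis (- (real k * t))" for k t
      by (simp_all add: cis_mult algebra_simps)
    have 1: "norm (trig_sum c K t) = norm (c' m + (\<Sum>k=1..N. c' (m + int k) * cis (real k * t) + c'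
        (m - int k) * cis (- (real k * t))))" for t
    proof -
      have "trig_sum c K t = cis (of_int m * t) * (c' m + (\<Sum>k=1..N. c' (m + int k) * cis (real k *
          t) + c' (m - int k) * cis (- (real k * t))))"
        unfolding T sum_symmetric_int_interval
        unfolding g_def shift by (simp add: sum_distrib_left algebra_simps)
      then show ?thesis by (simp add: norm_mult)
    qed
    have 2: "norm (trig_sum c (K \<inter> {m..}) t) = norm (\<Sum>k\<le>N. c' (m + int k) * cis (real k * t))" for t
    proof -
      have "trig_sum c (K \<inter> {m..}) t = cis (of_int m * t) * (\<Sum>k\<le>N. c' (m + int k) * cis (real k *
          t))"
        unfolding P sum_int_interval_from
        unfolding g_def shift by (simp add: sum_distrib_left algebra_simps)
      then show ?thesis by (simp add: norm_mult)
    qed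
    show ?thesis unfolding 1 2 using bound[of "\<lambda>k. c' (m + int k)" N "\<lambda>k. c' (m - int k)"] by simp
  qed
  with C show ?thesis by blast
qed

text \<open>A band is the difference of two half lines, cut at \<open>- int n\<close> and
  \<open>int n + 1\<close>. The constant depends neither on \<open>n\<close> nor on the degree,
  which is what the passage to general functions requires.\<close>

theorem trig_sum_partial_sum_bound:
  fixes p :: real
  assumes p: "1 < p"
  shows "\<exists>C\<ge>0. \<forall>c K (n::nat). finite K \<longrightarrow>
     integral {0..2*pi} (\<lambda>t. norm (trig_sum c (K \<inter> {- int n..int n}) t) powr p)
     \<le> C * integral {0..2*pi} (\<lambda>t. norm (trig_sum c K t) powr p)"
proof -
  obtain C where C: "C \<ge> 0" and bound: "\<And>c K m. finite K \<Longrightarrow>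
     integral {0..2*pi} (\<lambda>t. norm (trig_sum c (K \<inter> {m..}) t) powr p)
     \<le> C * integral {0..2*pi} (\<lambda>t. norm (trig_sum c K t) powr p)"
    using half_line_projection_bound[OF p] by auto
  have p0: "p > 0" using p by simp
  have cont: "continuous_on {0..2*pi} (trig_sum c K)" for c K
    unfolding trig_sum_def by (intro continuous_intros)
  have "integral {0..2*pi} (\<lambda>t. norm (trig_sum c (K \<inter> {- int n..int n}) t) powr p)
     \<le> 2 powr p * (2 * C) * integral {0..2*pi} (\<lambda>t. norm (trig_sum c K t) powr p)" if K: "finite K"
         for c K and n :: nat
  proof -
    have eq: "trig_sum c (K \<inter> {- int n..int n}) t = trig_sum c (K \<inter> {- int n..}) t - trig_sum c (K \<inter>
        {int n + 1..}) t" for t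
    proof -
      have "K \<inter> {- int n..} = (K \<inter> {- int n..int n}) \<union> (K \<inter> {int n + 1..})" by auto
      then have "trig_sum c (K \<inter> {- int n..}) t = trig_sum c (K \<inter> {- int n..int n}) t + trig_sum c
          (K \<inter> {int n + 1..}) t"
        unfolding trig_sum_def using K by (subst sum.union_disjoint[symmetric]) auto
      then show ?thesis by simp
    qed
    have "integral {0..2*pi} (\<lambda>t. norm (trig_sum c (K \<inter> {- int n..int n}) t) powr p)
      \<le> integral {0..2*pi} (\<lambda>t. 2 powr p * (norm (trig_sum c (K \<inter> {- int n..}) t) powr p + norm
          (trig_sum c (K \<inter> {int n + 1..}) t) powr p))"
      using p by (intro integral_le integrable_norm_powr integrable_on_mult_right
          Henstock_Kurzweil_Integration.integrable_add cont p0)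
        (auto simp: eq intro!: norm_diff_powr_le)
    also have "\<dots> = 2 powr p * (integral {0..2*pi} (\<lambda>t. norm (trig_sum c (K \<inter> {- int n..}) t) powr p)
        +
        integral {0..2*pi} (\<lambda>t. norm (trig_sum c (K \<inter> {int n + 1..}) t) powr p))"
      by (simp add: integral_add integrable_norm_powr cont p0)
    also have "\<dots> \<le> 2 powr p * (C * integral {0..2*pi} (\<lambda>t. norm (trig_sum c K t) powr p) + C *
        integral {0..2*pi} (\<lambda>t. norm (trig_sum c K t) powr p))"
      by (intro mult_left_mono add_mono bound K) auto
    finally show ?thesis by (simp add: algebra_simps)
  qed
  moreover have "2 powr p * (2 * C) \<ge> 0" using C by simp
  ultimately show ?thesis by blast
qed

section \<open>Lebesgue spaces on subsets of a period\<close>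

text \<open>Allows values in any Euclidean space, since besides complex functions the real averages
  inside strong convergence have to be handled.\<close>

definition in_Lp :: "real \<Rightarrow> real set \<Rightarrow> (real \<Rightarrow> 'b::euclidean_space) \<Rightarrow> bool" where
  "in_Lp p A f \<longleftrightarrow> f \<in> borel_measurable (lebesgue_on A) \<and> integrable (lebesgue_on A) (\<lambda>t. norm (f t)
      powr p)"

definition Lp_int :: "real \<Rightarrow> real set \<Rightarrow> (real \<Rightarrow> 'b::real_normed_vector) \<Rightarrow> real" where
  "Lp_int p A f = (LINT t|lebesgue_on A. norm (f t) powr p)"

lemma Lp_on_iff: "f \<in> Lp_on p A \<longleftrightarrow> in_Lp p A f"
  by (simp add: Lp_on_def in_Lp_def)

lemma Lp_norm_eq: "Lp_norm p A f = Lp_int p A f powr (1 / p)"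
  by (simp add: Lp_norm_def Lp_int_def)

lemma Lp_int_nonneg [simp]: "Lp_int p A f \<ge> 0"
  by (simp add: Lp_int_def)

lemma Lp_norm_tendsto_0_iff:
  assumes "p > 0"
  shows "(\<lambda>n. Lp_norm p A (f n)) \<longlonglongrightarrow> 0 \<longleftrightarrow> (\<lambda>n. Lp_int p A (f n)) \<longlonglongrightarrow> 0"
proof
  assume "(\<lambda>n. Lp_norm p A (f n)) \<longlonglongrightarrow> 0"
  then have "(\<lambda>n. Lp_norm p A (f n) powr p) \<longlonglongrightarrow> 0 powr p"
    using assms by (intro tendsto_powr') (auto simp: Lp_norm_eq)
  then show "(\<lambda>n. Lp_int p A (f n)) \<longlonglongrightarrow> 0"
    using assms by (simp add: Lp_norm_eq powr_powr)
next
  assume "(\<lambda>n. Lp_int p A (f n)) \<longlonglongrightarrow> 0"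
  then have "(\<lambda>n. Lp_int p A (f n) powr (1 / p)) \<longlonglongrightarrow> 0 powr (1 / p)"
    using assms by (intro tendsto_powr') auto
  then show "(\<lambda>n. Lp_norm p A (f n)) \<longlonglongrightarrow> 0"
    by (simp add: Lp_norm_eq)
qed

lemma in_Lp_measurable: "in_Lp p A f \<Longrightarrow> f \<in> borel_measurable (lebesgue_on A)"
  by (simp add: in_Lp_def)

lemma in_Lp_integrable: "in_Lp p A f \<Longrightarrow> integrable (lebesgue_on A) (\<lambda>t. norm (f t) powr p)"
  by (simp add: in_Lp_def)

lemma in_Lp_dominated:
  assumes "f \<in> borel_measurable (lebesgue_on A)" "integrable (lebesgue_on A) g" "\<And>t. norm (f t) powr
      p \<le> g t"
  shows "in_Lp p A f"
  unfolding in_Lp_def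
proof
  show "integrable (lebesgue_on A) (\<lambda>t. norm (f t) powr p)"
    by (rule Bochner_Integration.integrable_bound[OF assms(2)]) (use assms in \<open>auto intro!: AE_I2
        order_trans[OF assms(3)]\<close>)
qed (rule assms)

lemma in_Lp_norm: "in_Lp p A f \<Longrightarrow> in_Lp p A (\<lambda>t. norm (f t))"
  by (auto simp: in_Lp_def intro!: borel_measurable_norm)

lemma in_Lp_add:
  assumes "in_Lp p A f" "in_Lp p A g" "p \<ge> 0"
  shows "in_Lp p A (\<lambda>t. f t + g t)"
  by (rule in_Lp_dominated[where g = "\<lambda>t. 2 powr p * (norm (f t) powr p + norm (g t) powr p)"])
     (use assms in \<open>auto simp: in_Lp_def intro!: norm_add_powr_le\<close>)

lemma in_Lp_diff:
  assumes "in_Lp p A f" "in_Lp p A g" "p \<ge> 0"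
  shows "in_Lp p A (\<lambda>t. f t - g t)"
  by (rule in_Lp_dominated[where g = "\<lambda>t. 2 powr p * (norm (f t) powr p + norm (g t) powr p)"])
     (use assms in \<open>auto simp: in_Lp_def intro!: norm_diff_powr_le\<close>)

lemma in_Lp_cmult:
  fixes f :: "real \<Rightarrow> 'a::{euclidean_space,real_normed_field}"
  assumes "in_Lp p A f"
  shows "in_Lp p A (\<lambda>t. c * f t)"
  using assms by (auto simp: in_Lp_def norm_mult powr_mult)

lemma in_Lp_zero: "in_Lp p A (\<lambda>t. 0)"
  by (simp add: in_Lp_def)

lemma in_Lp_sum:
  assumes "\<And>k. k \<in> K \<Longrightarrow> in_Lp p A (f k)" "p \<ge> 0"
  shows "in_Lp p A (\<lambda>t. \<Sum>k\<in>K. f k t)"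
  using assms(1) by (induction K rule: infinite_finite_induct) (auto simp: in_Lp_zero intro!:
      in_Lp_add \<open>p \<ge> 0\<close>)

lemma Lp_int_add_le:
  fixes f g :: "real \<Rightarrow> 'a::euclidean_space"
  assumes "in_Lp p A f" "in_Lp p A g" "p \<ge> 0"
  shows "Lp_int p A (\<lambda>t. f t + g t) \<le> 2 powr p * (Lp_int p A f + Lp_int p A g)"
proof -
  have "Lp_int p A (\<lambda>t. f t + g t) \<le> (LINT t|lebesgue_on A. 2 powr p * (norm (f t) powr p + norm (g
      t) powr p))"
    unfolding Lp_int_def using assms
    by (intro integral_mono in_Lp_integrable in_Lp_add Bochner_Integration.integrable_mult_right
        Bochner_Integration.integrable_add norm_add_powr_le)
  then show ?thesis using assms by (simp add: Lp_int_def in_Lp_def)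
qed

lemma Lp_int_mono:
  fixes f :: "real \<Rightarrow> 'a::euclidean_space" and g :: "real \<Rightarrow> 'b::euclidean_space"
  assumes "in_Lp p A f" "in_Lp p A g" "\<And>t. norm (f t) \<le> norm (g t)" "p \<ge> 0"
  shows "Lp_int p A f \<le> Lp_int p A g"
  unfolding Lp_int_def using assms by (intro integral_mono in_Lp_integrable powr_mono2) auto

lemma finite_measure_lebesgue_on:
  assumes "A \<subseteq> {0..<2*pi}" "A \<in> sets lebesgue"
  shows "finite_measure (lebesgue_on A)"
proof -
  have "A \<in> lmeasurable" by (rule bounded_set_imp_lmeasurable[OF bounded_subset[OF _ assms(1)]
      assms(2)]) simp
  then show ?thesis by (simp add: finite_measure_lebesgue_on)
qed

text \<open>Replaces Hoelder's inequality when \<open>L\<^sup>p\<close> convergence is weakened to \<open>L\<^sup>1\<close> convergence.\<close>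

lemma le_eps_powr:
  fixes x p e :: real
  assumes "x \<ge> 0" "e > 0" "p \<ge> 1"
  shows "x \<le> e + e powr (1 - p) * x powr p"
proof (cases "x \<le> e")
  case True
  then show ?thesis by (meson add_increasing2 mult_nonneg_nonneg order_trans powr_ge_zero)
next
  case False
  then have "x = x powr (1 - p) * x powr p" using assms by (simp flip: powr_add)
  also have "\<dots> \<le> e powr (1 - p) * x powr p"
    using False assms by (intro mult_right_mono powr_mono2') auto
  finally show ?thesis using assms(2) by simp
qed

lemma in_Lp_imp_integrable:
  assumes "in_Lp p A f" "p \<ge> 1" "A \<subseteq> {0..<2*pi}" "A \<in> sets lebesgue"
  shows "integrable (lebesgue_on A) f"
proof -
  interpret finite_measure "lebesgue_on A" by (rule finite_measure_lebesgue_on[OF assms(3,4)])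
  show ?thesis
  proof (rule Bochner_Integration.integrable_bound)
    show "integrable (lebesgue_on A) (\<lambda>t. 1 + norm (f t) powr p)" using assms(1) by (simp add:
        in_Lp_def)
    show "AE t in lebesgue_on A. norm (f t) \<le> norm (1 + norm (f t) powr p)"
      using le_eps_powr[of "norm (f _)" 1 p] assms(2) by (auto simp: abs_of_nonneg intro!: AE_I2)
  qed (rule in_Lp_measurable[OF assms(1)])
qed

text \<open>The parameter \<open>e\<close> is free: it is fixed so that the measure term is small,
  after which only the p-th power integral has to be small.\<close>

lemma integral_norm_le_Lp_int:
  assumes "in_Lp p A f" "p \<ge> 1" "A \<subseteq> {0..<2*pi}" "A \<in> sets lebesgue" "e > 0"
  shows "(LINT t|lebesgue_on A. norm (f t)) \<le> e * measure lebesgue A + e powr (1 - p) * Lp_int p A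
      f"
proof -
  interpret finite_measure "lebesgue_on A" by (rule finite_measure_lebesgue_on[OF assms(3,4)])
  have "(LINT t|lebesgue_on A. norm (f t)) \<le> (LINT t|lebesgue_on A. e + e powr (1 - p) * norm (f t)
      powr p)"
    using assms by (intro integral_mono integrable_norm in_Lp_imp_integrable[OF assms(1-4)]
        le_eps_powr)
       (auto simp: in_Lp_def)
  also have "\<dots> = e * measure lebesgue A + e powr (1 - p) * Lp_int p A f"
    using assms by (simp add: in_Lp_def Lp_int_def measure_restrict_space)
  finally show ?thesis .
qed

lemma integral_norm_tendsto_0:
  assumes "\<And>n. in_Lp p A (f n)" "p \<ge> 1" "A \<subseteq> {0..<2*pi}" "A \<in> sets lebesgue" "(\<lambda>n. Lp_int p A (f n))
      \<longlonglongrightarrow> 0"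
  shows "(\<lambda>n::nat. LINT t|lebesgue_on A. norm (f n t)) \<longlonglongrightarrow> 0"
proof (rule LIMSEQ_I)
  fix r :: real assume "r > 0"
  \<comment> \<open>Half of \<open>r\<close> is reserved for the measure term; the added 1 keeps the
    denominator positive when \<open>A\<close> is a null set.\<close>
  define e where "e = r / (2 * (measure lebesgue A + 1))"
  have e: "e > 0" "e * measure lebesgue A \<le> r / 2"
    using \<open>r > 0\<close> by (auto simp: e_def field_simps add_pos_nonneg intro!: divide_pos_pos)
  have "(\<lambda>n. e powr (1 - p) * Lp_int p A (f n)) \<longlonglongrightarrow> e powr (1 - p) * 0"
    by (intro tendsto_intros assms)
  then have "\<forall>\<^sub>F n in sequentially. e powr (1 - p) * Lp_int p A (f n) < r / 2"
    by (rule order_tendstoD) (use \<open>r > 0\<close> in simp)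
  then obtain N where N: "\<And>n. n \<ge> N \<Longrightarrow> e powr (1 - p) * Lp_int p A (f n) < r / 2"
    unfolding eventually_sequentially by blast
  have "norm ((LINT t|lebesgue_on A. norm (f n t)) - 0) < r" if "n \<ge> N" for n
  proof -
    have "(LINT t|lebesgue_on A. norm (f n t)) < r"
      using integral_norm_le_Lp_int[OF assms(1-4) e(1), of n] e(2) N[OF that] by linarith
    then show ?thesis by simp
  qed
  then show "\<exists>no. \<forall>n\<ge>no. norm ((LINT t|lebesgue_on A. norm (f n t)) - 0) < r" by blast
qed

lemma in_Lp_bounded:
  assumes "f \<in> borel_measurable (lebesgue_on A)" "\<And>t. norm (f t) \<le> B" "p \<ge> 0" "A \<subseteq> {0..<2*pi}" "A \<in>
      sets lebesgue"
  shows "in_Lp p A f"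
proof -
  interpret finite_measure "lebesgue_on A" by (rule finite_measure_lebesgue_on[OF assms(4,5)])
  show ?thesis
    by (rule in_Lp_dominated[where g = "\<lambda>t. B powr p"]) (use assms in \<open>auto intro!: powr_mono2\<close>)
qed

lemma in_Lp_const:
  assumes "A \<subseteq> {0..<2*pi}" "A \<in> sets lebesgue" "p \<ge> 0"
  shows "in_Lp p A (\<lambda>t. c)"
  by (rule in_Lp_bounded[of _ _ "norm c"]) (use assms in auto)

lemma in_Lp_continuous_bounded:
  assumes "continuous_on UNIV f" "\<And>t. norm (f t) \<le> B" "p \<ge> 0" "A \<subseteq> {0..<2*pi}" "A \<in> sets lebesgue"
  shows "in_Lp p A f"
  using assms by (intro in_Lp_bounded[of f A B] borel_measurable_continuous_onI
      continuous_imp_measurable_on_sets_lebesgue continuous_on_subset[OF assms(1)]) auto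

lemma integrable_mult_bounded:
  fixes f g :: "real \<Rightarrow> complex"
  assumes "integrable M f" "g \<in> borel_measurable M" "\<And>t. norm (g t) \<le> 1"
  shows "integrable M (\<lambda>t. f t * g t)"
  by (rule Bochner_Integration.integrable_bound[OF assms(1)])
     (use assms in \<open>auto simp: norm_mult intro!: AE_I2 mult_left_le\<close>)

text \<open>Riesz's bound is phrased with gauge integrals over the closed period, the definitions
  with Lebesgue integrals over the half-open one; they differ by a negligible endpoint.\<close>

lemma lebesgue_integral_period:
  fixes g :: "real \<Rightarrow> 'a::euclidean_space"
  assumes "continuous_on {0..2*pi} g"
  shows "integrable (lebesgue_on {0..<2*pi}) g"
    and "(LINT t|lebesgue_on {0..<2*pi}. g t) = integral {0..2*pi} g"
proof -
  have "integrable (lebesgue_on {0..2*pi}) g"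
    using continuous_imp_integrable[of 0 "2*pi" g] assms by simp
  then show i: "integrable (lebesgue_on {0..<2*pi}) g"
    by (simp add: integrable_restrict_space flip: set_integrable_def)
       (erule set_integrable_subset; auto)
  have "{0..2*pi} - {0..<2*pi} \<subseteq> {2*pi}" by auto
  then have "negligible ({0..2*pi} - {0..<2*pi})" using negligible_subset negligible_sing by blast
  then have "integral {0..<2*pi} g = integral {0..2*pi} g"
    by (intro integral_subset_negligible) auto
  then show "(LINT t|lebesgue_on {0..<2*pi}. g t) = integral {0..2*pi} g"
    using lebesgue_integral_eq_integral[OF i] by simp
qed

lemma Lp_int_period:
  assumes "continuous_on {0..2*pi} f" "p > 0"
  shows "Lp_int p {0..<2*pi} f = integral {0..2*pi} (\<lambda>t. norm (f t) powr p)"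
  unfolding Lp_int_def using assms
  by (intro lebesgue_integral_period(2) continuous_on_powr' continuous_on_norm continuous_on_const)
      auto

lemma norm_trig_sum_le: "norm (trig_sum c K t) \<le> (\<Sum>k\<in>K. norm (c k))"
  unfolding trig_sum_def by (rule sum_norm_le) (simp add: norm_mult)

lemma continuous_on_trig_sum: "continuous_on S (trig_sum c K)"
  unfolding trig_sum_def by (intro continuous_intros)

lemma in_Lp_trig_sum:
  assumes "p \<ge> 0"
  shows "in_Lp p {0..<2*pi} (trig_sum c K)"
  by (rule in_Lp_continuous_bounded[OF continuous_on_trig_sum norm_trig_sum_le assms]) auto

text \<open>In exponential form a symmetric partial sum is a \<open>trig_sum\<close> over an integer
  interval, to which the band projection bound applies.\<close>

definition fourier_exp_coeff :: "(real \<Rightarrow> complex) \<Rightarrow> int \<Rightarrow> complex" where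
  "fourier_exp_coeff f k = of_real (1 / (2 * pi)) * (LINT t|lebesgue_on {0..<2 * pi}. f t * cis (-
      (of_int k * t)))"

lemma borel_measurable_lebesgue_on_continuous:
  fixes f :: "real \<Rightarrow> 'a::euclidean_space"
  assumes "continuous_on UNIV f"
  shows "f \<in> borel_measurable (lebesgue_on {0..<2*pi})"
  by (intro continuous_imp_measurable_on_sets_lebesgue continuous_on_subset[OF assms]) auto

lemma integral_cis:
  fixes m :: int
  shows "integral {0..2*pi} (\<lambda>t. cis (of_int m * t)) = (if m = 0 then 2 * pi else 0)"
proof (cases "m = 0")
  case False
  have "((\<lambda>t. cis (of_int m * t)) has_integral (cis (of_int m * (2 * pi)) / (\<i> * of_int m) - cis
      (of_int m * 0) / (\<i> * of_int m))) {0..2*pi}"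
  proof (rule fundamental_theorem_of_calculus)
    fix t :: real
    show "((\<lambda>t. cis (of_int m * t) / (\<i> * of_int m)) has_vector_derivative cis (of_int m * t)) (at t
        within {0..2*pi})"
    proof -
      have "((\<lambda>z. exp (\<i> * of_int m * z) / (\<i> * of_int m)) has_field_derivative exp (\<i> * of_int m *
          of_real t)) (at (of_real t))"
        using False by (auto intro!: derivative_eq_intros)
      from has_vector_derivative_real_field[OF this, of "{0..2*pi}"] show ?thesis
        by (simp add: cis_conv_exp mult.assoc)
    qed
  qed simp
  moreover have "cis (of_int m * (2 * pi)) = 1"
    using cis_multiple_2pi[of "of_int m"] by (simp add: mult.commute)
  ultimately show ?thesis using False by (simp add: integral_unique)
qed (simp add: cis.code complex_eq_iff)

lemma fourier_exp_coeff_trig_sum: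
  assumes "finite K"
  shows "fourier_exp_coeff (trig_sum c K) k = (if k \<in> K then c k else 0)"
proof -
  have "trig_sum c K t * cis (- (of_int k * t)) = (\<Sum>j\<in>K. c j * cis (of_int (j - k) * t))" for t
    unfolding trig_sum_def sum_distrib_right
    by (intro sum.cong refl) (simp add: cis_mult mult.assoc algebra_simps)
  then have "(LINT t|lebesgue_on {0..<2*pi}. trig_sum c K t * cis (- (of_int k * t)))
     = integral {0..2*pi} (\<lambda>t. \<Sum>j\<in>K. c j * cis (of_int (j - k) * t))"
    by (simp only:) (intro lebesgue_integral_period(2) continuous_intros)
  also have "\<dots> = (\<Sum>j\<in>K. c j * integral {0..2*pi} (\<lambda>t. cis (of_int (j - k) * t)))"
    by (subst integral_sum[OF assms]) (auto intro!: integrable_continuous_real continuous_intros)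
  also have "\<dots> = (\<Sum>j\<in>K. if j = k then c j * (2 * pi) else 0)"
    unfolding integral_cis by (intro sum.cong) auto
  also have "\<dots> = (if k \<in> K then c k * (2 * pi) else 0)"
    using assms by simp
  finally show ?thesis by (simp add: fourier_exp_coeff_def)
qed

text \<open>This L^1 continuity allows a function to be replaced by a nearby polynomial inside a
  partial sum of fixed order. The factor 1 / (2 pi) is simply estimated by 1.\<close>

lemma fourier_exp_coeff_diff_le:
  assumes "integrable (lebesgue_on {0..<2*pi}) f" "integrable (lebesgue_on {0..<2*pi}) g"
  shows "norm (fourier_exp_coeff f k - fourier_exp_coeff g k) \<le> (LINT t|lebesgue_on {0..<2*pi}. norm
      (f t - g t))"
proof -
  have m: "(\<lambda>t. cis (- (of_int k * t))) \<in> borel_measurable (lebesgue_on {0..<2*pi})"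
    by (intro borel_measurable_lebesgue_on_continuous continuous_intros)
  note i = integrable_mult_bounded[OF _ m]
  have "fourier_exp_coeff f k - fourier_exp_coeff g k = of_real (1 / (2 * pi)) * (LINT t|lebesgue_on
      {0..<2 * pi}. (f t - g t) * cis (- (of_int k * t)))"
    unfolding fourier_exp_coeff_def left_diff_distrib using assms
    by (subst Bochner_Integration.integral_diff) (auto intro!: i simp: right_diff_distrib)
  also have "norm \<dots> = 1 / (2 * pi) * norm (LINT t|lebesgue_on {0..<2 * pi}. (f t - g t) * cis (-
      (of_int k * t)))"
    by (simp add: norm_mult norm_divide)
  also have "\<dots> \<le> 1 * (LINT t|lebesgue_on {0..<2 * pi}. norm ((f t - g t) * cis (- (of_int k * t))))"
    using pi_gt3 by (intro mult_mono integral_norm_bound) (auto simp: field_simps)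
  finally show ?thesis by (simp add: norm_mult)
qed

lemma fourier_partial_sum_eq_trig_sum:
  assumes f: "integrable (lebesgue_on {0..<2*pi}) f" and ab: "has_fourier_series f a b"
  shows "fourier_partial_sum a b n t = trig_sum (fourier_exp_coeff f) {- int n..int n} t"
proof -
  let ?M = "lebesgue_on {0..<2*pi}"
  have mc: "(\<lambda>t. of_real (cos (x * t)) :: complex) \<in> borel_measurable ?M" and ms: "(\<lambda>t. of_real (sin
      (x * t)) :: complex) \<in> borel_measurable ?M" for x
    by (intro borel_measurable_lebesgue_on_continuous continuous_intros)+
  have ic: "integrable ?M (\<lambda>t. f t * of_real (cos (x * t)))" and isn: "integrable ?M (\<lambda>t. f t *
      of_real (sin (x * t)))" for x
    by (rule integrable_mult_bounded[OF f]; (simp add: mc ms norm_of_real))+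
  have pos: "fourier_exp_coeff f (int k) = (fourier_cos_coeff f k - \<i> * fourier_sin_coeff f k) / 2"
      for k
  proof -
    have "(\<lambda>t. f t * cis (- (of_int (int k) * t))) = (\<lambda>t. f t * of_real (cos (real k * t)) - \<i> * (f
        t * of_real (sin (real k * t))))"
      by (auto simp: fun_eq_iff cis.ctr complex_eq_iff)
    then have "(LINT t|?M. f t * cis (- (of_int (int k) * t))) =
        (LINT t|?M. f t * of_real (cos (real k * t))) - \<i> * (LINT t|?M. f t * of_real (sin (real k *
            t)))"
      using ic[of "real k"] isn[of "real k"] by (simp add: Bochner_Integration.integral_diff)
    then show ?thesis unfolding fourier_exp_coeff_def fourier_cos_coeff_def fourier_sin_coeff_def
      by (simp add: field_simps)
  qed
  have neg: "fourier_exp_coeff f (- int k) = (fourier_cos_coeff f k + \<i> * fourier_sin_coeff f k) /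
      2" for k
  proof -
    have "(\<lambda>t. f t * cis (- (of_int (- int k) * t))) = (\<lambda>t. f t * of_real (cos (real k * t)) + \<i> *
        (f t * of_real (sin (real k * t))))"
      by (auto simp: fun_eq_iff cis.ctr complex_eq_iff)
    then have "(LINT t|?M. f t * cis (- (of_int (- int k) * t))) =
        (LINT t|?M. f t * of_real (cos (real k * t))) + \<i> * (LINT t|?M. f t * of_real (sin (real k *
            t)))"
      using ic[of "real k"] isn[of "real k"] by (simp add: Bochner_Integration.integral_add)
    then show ?thesis unfolding fourier_exp_coeff_def fourier_cos_coeff_def fourier_sin_coeff_def
      by (simp add: field_simps)
  qed
  \<comment> \<open>\<open>has_fourier_series\<close> says nothing about \<open>b 0\<close>; the
    sine coefficient of order 0 vanishes by itself, and \<open>pos\<close> at 0 then yields half of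
    \<open>a 0\<close>.\<close>
  have "fourier_sin_coeff f 0 = 0" by (simp add: fourier_sin_coeff_def)
  then have "fourier_exp_coeff f 0 = a 0 / 2" using pos[of 0] ab by (simp add:
      has_fourier_series_def)
  moreover have "fourier_exp_coeff f (int k) * cis (of_int (int k) * t) + fourier_exp_coeff f (- int
      k) * cis (of_int (- int k) * t)
     = a k * of_real (cos (real k * t)) + b k * of_real (sin (real k * t))" if "k \<ge> 1" for k
  proof -
    have "fourier_cos_coeff f k = a k" "fourier_sin_coeff f k = b k" using ab that by (auto simp:
        has_fourier_series_def)
    then show ?thesis unfolding pos neg by (simp add: cis.ctr complex_eq_iff field_simps)
  qed
  ultimately show ?thesis
    using sum_symmetric_int_interval[of "\<lambda>k. fourier_exp_coeff f k * cis (of_int k * t)" 0 n]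
    unfolding trig_sum_def fourier_partial_sum_def by simp
qed

section \<open>Convergence of Fourier series in the mean\<close>

definition trig_polys :: "(real \<Rightarrow> complex) set" where
  "trig_polys = {trig_sum c K | c K. finite K}"

lemma trig_polys_monomial: "(\<lambda>t. a * cis (of_int k * t)) \<in> trig_polys"
proof -
  have "(\<lambda>t. a * cis (of_int k * t)) = trig_sum (\<lambda>_. a) {k}" by (simp add: trig_sum_def fun_eq_iff)
  then show ?thesis unfolding trig_polys_def by blast
qed

lemma trig_polys_add:
  assumes "f \<in> trig_polys" "g \<in> trig_polys"
  shows "(\<lambda>t. f t + g t) \<in> trig_polys"
proof -
  obtain c K d J where fg: "f = trig_sum c K" "finite K" "g = trig_sum d J" "finite J"
    using assms unfolding trig_polys_def by blast
  define c' where "c' = (\<lambda>k. (if k \<in> K then c k else 0) + (if k \<in> J then d k else 0))"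
  have "f t + g t = trig_sum c' (K \<union> J) t" for t
  proof -
    have "f t = (\<Sum>k\<in>K \<union> J. (if k \<in> K then c k else 0) * cis (of_int k * t))"
      unfolding fg trig_sum_def using fg by (intro sum.mono_neutral_cong_left) auto
    moreover have "g t = (\<Sum>k\<in>K \<union> J. (if k \<in> J then d k else 0) * cis (of_int k * t))"
      unfolding fg trig_sum_def using fg by (intro sum.mono_neutral_cong_left) auto
    ultimately show ?thesis by (simp add: c'_def trig_sum_def distrib_right sum.distrib)
  qed
  then have "(\<lambda>t. f t + g t) = trig_sum c' (K \<union> J)" by blast
  moreover have "finite (K \<union> J)" using fg by simp
  ultimately show ?thesis unfolding trig_polys_def by blast
qed

lemma trig_polys_const: "(\<lambda>t. a) \<in> trig_polys"
  using trig_polys_monomial[of a 0] by simp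

lemma trig_polys_sum:
  assumes "\<And>k. k \<in> K \<Longrightarrow> f k \<in> trig_polys"
  shows "(\<lambda>t. \<Sum>k\<in>K. f k t) \<in> trig_polys"
  using assms by (induction K rule: infinite_finite_induct) (auto simp: trig_polys_const
      trig_polys_add)

lemma trig_polys_mult:
  assumes "f \<in> trig_polys" "g \<in> trig_polys"
  shows "(\<lambda>t. f t * g t) \<in> trig_polys"
proof -
  obtain c K d J where fg: "f = trig_sum c K" "finite K" "g = trig_sum d J" "finite J"
    using assms unfolding trig_polys_def by blast
  have "f t * g t = (\<Sum>k\<in>K. \<Sum>j\<in>J. c k * d j * cis (of_int (k + j) * t))" for t
    unfolding fg trig_sum_def sum_product
    by (intro sum.cong refl) (simp add: distrib_right flip: cis_mult)
  then show ?thesis by (simp only:) (intro trig_polys_sum trig_polys_monomial)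
qed

lemma real_polynomial_function_cis_trig_polys:
  assumes "real_polynomial_function (r :: complex \<Rightarrow> real)"
  shows "(\<lambda>t. of_real (r (cis t))) \<in> trig_polys"
  using assms
proof (induction r rule: real_polynomial_function.induct)
  case (linear f)
  interpret bounded_linear f by (rule linear)
  have "f (cis t) = cos t * f 1 + sin t * f \<i>" for t
  proof -
    have "cis t = cos t *\<^sub>R 1 + sin t *\<^sub>R \<i>" by (simp add: complex_eq_iff)
    then show ?thesis by (simp only: add scale real_scaleR_def)
  qed
  then have "of_real (f (cis t)) = (of_real (f 1) / 2 - \<i> * of_real (f \<i>) / 2) * cis (of_int 1 * t)
      + (of_real (f 1) / 2 + \<i> * of_real (f \<i>) / 2) * cis (of_int (-1) * t)" for t
    by (simp add: complex_eq_iff field_simps)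
  then show ?case by (simp only:) (intro trig_polys_add trig_polys_monomial)
qed (simp_all add: trig_polys_const trig_polys_add trig_polys_mult)

text \<open>Equal values at both ends make \<open>h\<close> a function on the unit circle, where
  Stone-Weierstrass applies; polynomials in the real coordinates become trigonometric under
  \<open>cis\<close>.\<close>

lemma trig_polys_dense_continuous:
  fixes h :: "real \<Rightarrow> complex"
  assumes cont: "continuous_on {0..2*pi} h" and per: "h 0 = h (2*pi)" and e: "e > 0"
  obtains T where "T \<in> trig_polys" "\<And>t. t \<in> {0..2*pi} \<Longrightarrow> norm (h t - T t) < e"
proof -
  define H where "H = (\<lambda>z. h (Arg2pi z))"
  have Hcis: "H (cis t) = h t" if "t \<in> {0..2*pi}" for t
  proof (cases "t = 2*pi")
    case True
    moreover have "Arg2pi 1 = 0" by (rule Arg2pi_unique[of 1]) auto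
    ultimately show ?thesis using per by (simp add: H_def)
  next
    case False
    then have "Arg2pi (cis t) = t" using that by (intro Arg2pi_unique[of 1]) (auto simp:
        cis_conv_exp)
    then show ?thesis by (simp add: H_def)
  qed
  have sph: "\<exists>t\<in>{0..2*pi}. z = cis t" if "z \<in> sphere 0 1" for z
  proof
    have "z = of_real (norm z) * exp (\<i> * of_real (Arg2pi z))" by (rule Arg2pi_eq)
    also have "\<dots> = cis (Arg2pi z)" using that by (simp add: cis_conv_exp)
    finally show "z = cis (Arg2pi z)" .
    show "Arg2pi z \<in> {0..2*pi}" using Arg2pi_ge_0[of z] Arg2pi_lt_2pi[of z] by simp
  qed
  \<comment> \<open>\<open>Arg2pi\<close> jumps at 1, so \<open>H\<close> is not treated as a
    composition of continuous maps. Instead, preimages of closed sets under \<open>H\<close> are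
    images under \<open>cis\<close> of compact subsets of the closed period.\<close>
  have "continuous_on (sphere 0 1) H"
    unfolding continuous_on_closed_vimage[OF closed_sphere]
  proof (intro allI impI)
    fix B :: "complex set" assume B: "closed B"
    have "closed (h -` B \<inter> {0..2*pi})"
      using cont B by (simp add: continuous_on_closed_vimage[OF closed_atLeastAtMost])
    then have "compact ({0..2*pi} \<inter> (h -` B \<inter> {0..2*pi}))" by (intro compact_Int_closed) auto
    then have "compact (cis ` ({0..2*pi} \<inter> (h -` B \<inter> {0..2*pi})))"
      by (intro compact_continuous_image continuous_intros)
    moreover have "H -` B \<inter> sphere 0 1 = cis ` ({0..2*pi} \<inter> (h -` B \<inter> {0..2*pi}))"
    proof safe
      fix z assume "H z \<in> B" "z \<in> sphere 0 1"
      moreover obtain t where "t \<in> {0..2*pi}" "z = cis t" using sph[OF \<open>z \<in> sphere 0 1\<close>] by blast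
      ultimately show "z \<in> cis ` ({0..2*pi} \<inter> (h -` B \<inter> {0..2*pi}))" using Hcis by auto
    qed (use Hcis in auto)
    ultimately show "closed (H -` B \<inter> sphere 0 1)" by (simp add: compact_imp_closed)
  qed
  from Stone_Weierstrass_polynomial_function[OF compact_sphere this e]
  obtain g where g: "polynomial_function g" "\<And>z. z \<in> sphere 0 1 \<Longrightarrow> norm (H z - g z) < e"
    by (elim exE conjE) (rule that, assumption, blast)
  have "real_polynomial_function (Re \<circ> g)" "real_polynomial_function (Im \<circ> g)"
    using g(1) bounded_linear_Re bounded_linear_Im unfolding polynomial_function_def by blast+
  from this[THEN real_polynomial_function_cis_trig_polys]
  have "(\<lambda>t. of_real (Re (g (cis t))) + \<i> * of_real (Im (g (cis t)))) \<in> trig_polys"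
    unfolding o_def by (rule trig_polys_add[OF _ trig_polys_mult[OF trig_polys_const]])
  moreover have "of_real (Re z) + \<i> * of_real (Im z) = z" for z by (simp add: complex_eq_iff)
  ultimately have "(\<lambda>t. g (cis t)) \<in> trig_polys" by (simp only:)
  moreover have "norm (h t - g (cis t)) < e" if "t \<in> {0..2*pi}" for t
    using g(2)[of "cis t"] Hcis[OF that] by simp
  ultimately show thesis using that by blast
qed

text \<open>For \<open>M > 0\<close> this is the radial retraction onto the disc of radius
  \<open>M\<close>, written without a case distinction so that continuity is immediate.\<close>

definition clip :: "real \<Rightarrow> complex \<Rightarrow> complex" where
  "clip M z = z / of_real (max 1 (inverse M * norm z))"

lemma continuous_on_clip: "continuous_on S (clip M)"
  unfolding clip_def by (intro continuous_intros) (auto simp: max_def simp del: of_real_mult)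

lemma norm_clip_le:
  assumes "M > 0"
  shows "norm (clip M z) \<le> M" "norm (clip M z) \<le> norm z" "norm (clip M z - z) \<le> norm z"
proof -
  define d where "d = max 1 (inverse M * norm z)"
  have d: "d \<ge> 1" "norm z / M \<le> d" by (auto simp: d_def divide_inverse mult.commute)
  have c: "clip M z = z / of_real d" by (simp add: clip_def d_def)
  show "norm (clip M z) \<le> M" using d assms by (simp add: c norm_divide field_simps)
  show "norm (clip M z) \<le> norm z" using d by (simp add: c norm_divide divide_le_eq
      mult_le_cancel_left1)
  have "clip M z - z = - (of_real (1 - 1 / d) * z)" by (simp add: c algebra_simps)
  then have "norm (clip M z - z) = \<bar>1 - 1 / d\<bar> * norm z" by (simp add: norm_mult norm_minus_cancel
      del: of_real_diff of_real_divide)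
  also have "\<dots> \<le> 1 * norm z" using d by (intro mult_right_mono) (auto simp: abs_le_iff)
  finally show "norm (clip M z - z) \<le> norm z" by simp
qed

lemma clip_eq: "norm z \<le> M \<Longrightarrow> M > 0 \<Longrightarrow> clip M z = z"
  by (simp add: clip_def max_def field_simps)

lemma Lp_int_tendsto_0_dominated:
  fixes f :: "nat \<Rightarrow> real \<Rightarrow> complex"
  assumes "\<And>n. f n \<in> borel_measurable (lebesgue_on A)" "integrable (lebesgue_on A) g" "p > 0"
    and "AE t in lebesgue_on A. (\<lambda>n. f n t) \<longlonglongrightarrow> 0"
    and "\<And>n t. norm (f n t) powr p \<le> g t"
  shows "(\<lambda>n. Lp_int p A (f n)) \<longlonglongrightarrow> 0"
proof -
  have "(\<lambda>n. LINT t|lebesgue_on A. norm (f n t) powr p) \<longlonglongrightarrow> (LINT t|lebesgue_on A. 0)"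
  proof (rule integral_dominated_convergence[OF _ _ assms(2)])
    show "AE t in lebesgue_on A. (\<lambda>n. norm (f n t) powr p) \<longlonglongrightarrow> 0"
      using assms(4)
    proof eventually_elim
      case (elim t)
      then have "(\<lambda>n. norm (f n t)) \<longlonglongrightarrow> 0" by (rule tendsto_norm_zero)
      then have "(\<lambda>n. norm (f n t) powr p) \<longlonglongrightarrow> 0 powr p" using \<open>p > 0\<close> by (intro tendsto_powr') auto
      then show ?case by simp
    qed
  qed (use assms in \<open>auto intro!: AE_I2\<close>)
  then show ?thesis by (simp add: Lp_int_def)
qed

lemma clip_approximation:
  assumes f: "in_Lp p {0..<2*pi} f" and p: "p > 0" and e: "e > 0"
  obtains M where "M > 0" "Lp_int p {0..<2*pi} (\<lambda>t. clip M (f t) - f t) < e"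
proof -
  have "(\<lambda>n. Lp_int p {0..<2*pi} (\<lambda>t. clip (real (Suc n)) (f t) - f t)) \<longlonglongrightarrow> 0"
  proof (rule Lp_int_tendsto_0_dominated[OF _ in_Lp_integrable[OF f] p])
    show "AE t in lebesgue_on {0..<2 * pi}. (\<lambda>n. clip (real (Suc n)) (f t) - f t) \<longlonglongrightarrow> 0"
    proof (rule AE_I2)
      fix t
      obtain N :: nat where N: "norm (f t) \<le> real N" using real_arch_simple by blast
      have "\<forall>\<^sub>F n in sequentially. 0 = clip (real (Suc n)) (f t) - f t"
        using eventually_ge_at_top[of N] by eventually_elim (use N in \<open>simp add: clip_eq\<close>)
      then show "(\<lambda>n. clip (real (Suc n)) (f t) - f t) \<longlonglongrightarrow> 0"
        by (rule tendsto_eventually[OF eventually_mono]) simp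
    qed
    show "(\<lambda>t. clip (real (Suc n)) (f t) - f t) \<in> borel_measurable (lebesgue_on {0..<2 * pi})" for n
      using measurable_compose[OF in_Lp_measurable[OF f] borel_measurable_continuous_onI[OF
          continuous_on_clip]] in_Lp_measurable[OF f]
      by simp
    show "norm (clip (real (Suc n)) (f t) - f t) powr p \<le> norm (f t) powr p" for n t
      using p norm_clip_le(3) by (intro powr_mono2) auto
  qed
  from order_tendstoD(2)[OF this e] obtain n where "Lp_int p {0..<2*pi} (\<lambda>t. clip (real (Suc n)) (f
      t) - f t) < e"
    unfolding eventually_sequentially by blast
  then show thesis using that[of "real (Suc n)"] by simp
qed

text \<open>A measurable function is a limit almost everywhere of continuous ones, but without
  domination; clipping the approximants supplies the bound \<open>2 * M\<close>, and a cutoff gives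
  them equal values at both ends of the period.\<close>

lemma continuous_approximation_clip:
  assumes f: "f \<in> borel_measurable (lebesgue_on {0..<2*pi})" and p: "p > 0" and M: "M > 0" and e: "e
      > 0"
  obtains h where "continuous_on UNIV h" "h 0 = 0" "h (2*pi) = 0" "\<And>t. norm (h t) \<le> M"
    "Lp_int p {0..<2*pi} (\<lambda>t. h t - clip M (f t)) < e"
proof -
  have "f measurable_on {0..<2*pi}" using f by (subst measurable_on_iff_borel_measurable) auto
  then obtain N g where N: "negligible N" and g: "\<And>n. continuous_on UNIV (g n)"
    and lim: "\<And>x. x \<notin> N \<Longrightarrow> (\<lambda>n. g n x) \<longlonglongrightarrow> (if x \<in> {0..<2*pi} then f x else 0)"
    unfolding measurable_on_def by blast
  \<comment> \<open>Vanishes at both ends of the period and, for large \<open>n\<close>, equals 1 at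
    any given interior point.\<close>
  define \<phi> where "\<phi> = (\<lambda>n t. max 0 (min 1 (real n * t)) * max 0 (min 1 (real n * (2 * pi - t))))"
  define h where "h = (\<lambda>n t. of_real (\<phi> n t) * clip M (g n t))"
  have \<phi>: "0 \<le> \<phi> n t" "\<phi> n t \<le> 1" for n t
    by (auto simp: \<phi>_def intro!: mult_nonneg_nonneg mult_le_one)
  have conth: "continuous_on UNIV (h n)" for n
    unfolding h_def \<phi>_def by (intro continuous_intros continuous_on_compose2[OF continuous_on_clip
        g]) auto
  have hM: "norm (h n t) \<le> M" for n t
  proof -
    have "norm (h n t) \<le> 1 * M" unfolding h_def norm_mult using \<phi> M by (intro mult_mono
        norm_clip_le) auto
    then show ?thesis by simp
  qed
  have fin: "finite_measure (lebesgue_on {0..<2*pi})" by (rule finite_measure_lebesgue_on) auto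
  have "(\<lambda>n. Lp_int p {0..<2*pi} (\<lambda>t. h n t - clip M (f t))) \<longlonglongrightarrow> 0"
  proof (rule Lp_int_tendsto_0_dominated[where g = "\<lambda>t. (2 * M) powr p"])
    show "integrable (lebesgue_on {0..<2*pi}) (\<lambda>t. (2 * M) powr p)"
      using fin by (simp add: finite_measure.integrable_const)
    show "(\<lambda>t. h n t - clip M (f t)) \<in> borel_measurable (lebesgue_on {0..<2*pi})" for n
      using measurable_compose[OF f borel_measurable_continuous_onI[OF continuous_on_clip]]
          borel_measurable_lebesgue_on_continuous[OF conth]
      by simp
    show "norm (h n t - clip M (f t)) powr p \<le> (2 * M) powr p" for n t
      using p hM[of n t] norm_clip_le(1)[OF M, of "f t"] norm_triangle_ineq4[of "h n t" "clip M (f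
          t)"] by (intro powr_mono2) auto
    \<comment> \<open>At 0 the cutoff vanishes for every \<open>n\<close>, so this point joins the
      exceptional null set.\<close>
    have "AE t in lebesgue. t \<notin> N \<union> {0}"
      using N by (intro AE_not_in) (simp add: negligible_iff_null_sets flip: insert_is_Un)
    then have "AE t in lebesgue. t \<in> {0..<2*pi} \<longrightarrow> t \<notin> N \<union> {0}"
      by (rule eventually_mono) blast
    then have "AE t in lebesgue_on {0..<2*pi}. t \<notin> N \<union> {0}"
      by (rule AE_restrict_space_iff[THEN iffD2, rotated]) simp
    moreover have "AE t in lebesgue_on {0..<2*pi}. t \<in> {0..<2*pi}"
      by (rule AE_I2) simp
    ultimately show "AE t in lebesgue_on {0..<2*pi}. (\<lambda>n. h n t - clip M (f t)) \<longlonglongrightarrow> 0"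
    proof eventually_elim
      case (elim t)
      have "(\<lambda>n. g n t) \<longlonglongrightarrow> f t" using lim[of t] elim by simp
      moreover have "isCont (clip M) (f t)" using continuous_on_clip[of UNIV M] by (simp add:
          continuous_on_eq_continuous_at)
      ultimately have 1: "(\<lambda>n. clip M (g n t)) \<longlonglongrightarrow> clip M (f t)" by (rule
          isCont_tendsto_compose[rotated])
      have t: "t > 0" "2 * pi - t > 0" using elim by auto
      obtain K :: nat where K: "real K \<ge> 1 / t + 1 / (2 * pi - t)" using real_arch_simple by blast
      have "\<phi> n t = 1" if "n \<ge> K" for n
      proof -
        have "1 / t \<ge> 0" "1 / (2 * pi - t) \<ge> 0" using t by auto
        then have "1 / t \<le> real n" "1 / (2 * pi - t) \<le> real n" using K that by linarith+
        then have "1 \<le> real n * t" "1 \<le> real n * (2 * pi - t)" using t by (simp_all only: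
            pos_divide_le_eq)
        then show ?thesis by (simp add: \<phi>_def min_def max_def)
      qed
      then have "(\<lambda>n. of_real (\<phi> n t) :: complex) \<longlonglongrightarrow> 1"
        by (intro tendsto_eventually) (auto simp: eventually_sequentially)
      from tendsto_mult[OF this 1] have "(\<lambda>n. h n t) \<longlonglongrightarrow> clip M (f t)" by (simp add: h_def)
      then show ?case by (simp add: LIM_zero)
    qed
  qed (use p in auto)
  from order_tendstoD(2)[OF this e] obtain n where "Lp_int p {0..<2*pi} (\<lambda>t. h n t - clip M (f t)) <
      e"
    unfolding eventually_sequentially by blast
  moreover have "h n 0 = 0" "h n (2*pi) = 0" by (simp_all add: h_def \<phi>_def)
  ultimately show thesis using that conth hM by blast
qed

theorem trig_polys_dense_Lp:
  assumes f: "in_Lp p {0..<2*pi} f" and p: "p > 0" and e: "e > 0"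
  obtains c K where "finite K" "Lp_int p {0..<2*pi} (\<lambda>t. f t - trig_sum c K t) < e"
proof -
  let ?A = "{0..<2*pi}"
  \<comment> \<open>The total factor when three errors, each at most \<open>d\<close>, are combined
    by two nested uses of \<open>Lp_int_add_le\<close>.\<close>
  define D where "D = 2 powr p * (1 + 2 powr p * 2)"
  have D: "D > 0" by (auto simp: D_def intro!: mult_pos_pos add_pos_nonneg)
  define d where "d = e / D"
  have d: "d > 0" using e D by (simp add: d_def)
  obtain M where M: "M > 0" "Lp_int p ?A (\<lambda>t. clip M (f t) - f t) < d"
    using clip_approximation[OF f p d] .
  obtain h where h: "continuous_on UNIV h" "h 0 = 0" "h (2*pi) = 0" "\<And>t. norm (h t) \<le> M"
    "Lp_int p ?A (\<lambda>t. h t - clip M (f t)) < d"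
    by (rule continuous_approximation_clip[OF in_Lp_measurable[OF f] p M(1) d]) blast
  \<comment> \<open>Chosen so that a uniform error \<open>r\<close> contributes
    \<open>r powr p * (2 * pi) = d\<close> over the period.\<close>
  define r where "r = (d / (2 * pi)) powr (1 / p)"
  have r: "r > 0" using d by (simp add: r_def)
  obtain T where T: "T \<in> trig_polys" "\<And>t. t \<in> {0..2*pi} \<Longrightarrow> norm (h t - T t) < r"
    using trig_polys_dense_continuous[OF continuous_on_subset[OF h(1)] _ r] h(2,3) by (metis
        subset_UNIV)
  obtain c K where cK: "finite K" "T = trig_sum c K" using T(1) unfolding trig_polys_def by blast
  have p0: "p \<ge> 0" using p by simp
  have Lh: "in_Lp p ?A h" by (rule in_Lp_continuous_bounded[OF h(1,4) p0]) auto
  have LT: "in_Lp p ?A T" unfolding cK by (rule in_Lp_trig_sum[OF p0])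
  have Lc: "in_Lp p ?A (\<lambda>t. clip M (f t))"
    using measurable_compose[OF in_Lp_measurable[OF f] borel_measurable_continuous_onI[OF
        continuous_on_clip]] norm_clip_le(1)[OF M(1)] p0
    by (intro in_Lp_bounded[of _ _ M]) auto
  have "Lp_int p ?A (\<lambda>t. h t - T t) = integral {0..2*pi} (\<lambda>t. norm (h t - T t) powr p)"
    unfolding cK by (intro Lp_int_period[OF _ p] continuous_on_diff continuous_on_trig_sum
        continuous_on_subset[OF h(1)]) auto
  also have "\<dots> \<le> integral {0..2*pi} (\<lambda>t. r powr p)"
    unfolding cK using T(2) p
    by (intro integral_le integrable_norm_powr continuous_on_diff continuous_on_trig_sum
        continuous_on_subset[OF h(1)])
       (auto intro!: powr_mono2 simp: cK less_imp_le)
  also have "\<dots> = d" using d p by (simp add: r_def powr_powr)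
  finally have hT: "Lp_int p ?A (\<lambda>t. h t - T t) \<le> d" .
  have sw: "Lp_int p ?A (\<lambda>t. x t - y t) = Lp_int p ?A (\<lambda>t. y t - x t)" for x y :: "real \<Rightarrow> complex"
    by (simp add: Lp_int_def norm_minus_commute)
  have "Lp_int p ?A (\<lambda>t. (f t - clip M (f t)) + ((clip M (f t) - h t) + (h t - T t)))
    \<le> 2 powr p * (Lp_int p ?A (\<lambda>t. f t - clip M (f t)) + Lp_int p ?A (\<lambda>t. (clip M (f t) - h t) + (h
        t - T t)))"
    by (intro Lp_int_add_le in_Lp_add in_Lp_diff f Lc Lh LT p0)
  also have "\<dots> \<le> 2 powr p * (Lp_int p ?A (\<lambda>t. f t - clip M (f t)) + 2 powr p * (Lp_int p ?A (\<lambda>t.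
      clip M (f t) - h t) + Lp_int p ?A (\<lambda>t. h t - T t)))"
    by (intro mult_left_mono add_left_mono Lp_int_add_le in_Lp_add in_Lp_diff f Lc Lh LT p0) auto
  also have "\<dots> < 2 powr p * (d + 2 powr p * (d + d))"
    using M(2) h(5) hT by (intro mult_strict_left_mono add_less_le_mono mult_left_mono add_mono)
        (auto simp: sw[of f] sw[of _ h])
  also have "\<dots> = D * d" by (simp add: D_def algebra_simps)
  also have "\<dots> = e" using D by (simp add: d_def)
  finally have "Lp_int p ?A (\<lambda>t. f t - trig_sum c K t) < e" by (simp add: cK)
  then show thesis using that cK(1) by blast
qed

text \<open>The uniform bound is available for trigonometric polynomials only. For each
  \<open>n\<close>, \<open>f\<close> is therefore replaced by a polynomial \<open>T'\<close>
  depending on \<open>n\<close>, so close that the n-th partial sums nearly coincide, and the bound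
  is applied to \<open>T' - T\<close> for a fixed approximant \<open>T\<close>.\<close>

theorem fourier_partial_sums_converge_Lp:
  assumes p: "p > 1" and f: "in_Lp p {0..<2*pi} f"
  shows "(\<lambda>n. Lp_int p {0..<2*pi} (\<lambda>t. trig_sum (fourier_exp_coeff f) {- int n..int n} t - f t)) \<longlonglongrightarrow>
      0"
proof (rule LIMSEQ_I)
  fix e :: real assume e: "e > 0"
  let ?A = "{0..<2*pi}"
  define S where "S = (\<lambda>u (n::nat). trig_sum (fourier_exp_coeff u) {- int n..int n})"
  obtain C where C: "C \<ge> 0" and bound: "\<And>c K (n::nat). finite K \<Longrightarrow>
     integral {0..2*pi} (\<lambda>t. norm (trig_sum c (K \<inter> {- int n..int n}) t) powr p)
     \<le> C * integral {0..2*pi} (\<lambda>t. norm (trig_sum c K t) powr p)"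
    using trig_sum_partial_sum_bound[OF p] by auto
  have p0: "p \<ge> 0" "p > 0" "p \<ge> 1" using p by auto
  have int: "integrable (lebesgue_on ?A) u" if "in_Lp p ?A u" for u :: "real \<Rightarrow> complex"
    using in_Lp_imp_integrable[OF that p0(3)] by simp
  define q where "q = (2::real) powr p"
  have q: "q > 0" by (simp add: q_def)
  define D where "D = q * (1 + q * (C * (q * 2) + 1))"
  have D: "D > 0" using q C by (auto simp: D_def intro!: mult_pos_pos add_pos_nonneg)
  define d where "d = e / D"
  have d: "d > 0" using e D by (simp add: d_def)
  obtain c K where K: "finite K" and cK: "Lp_int p ?A (\<lambda>t. f t - trig_sum c K t) < d"
    using trig_polys_dense_Lp[OF f p0(2) d] .
  define N where "N = (\<Sum>k\<in>K. nat \<bar>k\<bar>)"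
  have "nat \<bar>k\<bar> \<le> N" if "k \<in> K" for k
    unfolding N_def using K that by (rule member_le_sum[of k K "\<lambda>k. nat \<bar>k\<bar>", rotated 2]) auto
  then have sub: "K \<subseteq> {- int N..int N}" by force
  have "Lp_int p ?A (\<lambda>t. S f n t - f t) < e" if n: "n \<ge> N" for n
  proof -
    \<comment> \<open>The error allowed per coefficient: \<open>S f n - S T' n\<close> has
      \<open>2 * n + 1\<close> of them.\<close>
    define r where "r = (d / (2 * pi)) powr (1 / p) / (2 * real n + 1)"
    have r: "r > 0" using d by (simp add: r_def)
    define \<eta> where "\<eta> = r / (2 * measure lebesgue ?A + 1)"
    have \<eta>: "\<eta> > 0" "\<eta> * measure lebesgue ?A \<le> r / 2"
      using r by (auto simp: \<eta>_def field_simps add_nonneg_pos intro!: divide_pos_pos)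
    \<comment> \<open>Small enough that, by \<open>integral_norm_le_Lp_int\<close> with parameter
      \<open>\<eta>\<close>, the L^1 distance of \<open>f\<close> and \<open>T'\<close> is at most
      \<open>r\<close>.\<close>
    define d' where "d' = min d (r / (2 * \<eta> powr (1 - p)))"
    have d': "d' > 0" using d r \<eta> by (simp add: d'_def)
    obtain c' K' where K': "finite K'" and cK': "Lp_int p ?A (\<lambda>t. f t - trig_sum c' K' t) < d'"
      using trig_polys_dense_Lp[OF f p0(2) d'] .
    define T where "T = trig_sum c K"
    define T' where "T' = trig_sum c' K'"
    have L: "in_Lp p ?A T" "in_Lp p ?A T'" "in_Lp p ?A (S u n)" for u
      unfolding T_def T'_def S_def by (rule in_Lp_trig_sum[OF p0(1)])+
    have "(LINT t|lebesgue_on ?A. norm (f t - T' t)) \<le> \<eta> * measure lebesgue ?A + \<eta> powr (1 - p) *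
        Lp_int p ?A (\<lambda>t. f t - T' t)"
      by (rule integral_norm_le_Lp_int) (use \<eta> p0 in \<open>auto intro!: in_Lp_diff f L\<close>)
    also have "\<eta> powr (1 - p) * Lp_int p ?A (\<lambda>t. f t - T' t) \<le> \<eta> powr (1 - p) * (r / (2 * \<eta> powr (1
        - p)))"
      using cK' by (intro mult_left_mono) (auto simp: d'_def T'_def)
    also have "\<dots> = r / 2" using \<eta> by simp
    finally have L1: "(LINT t|lebesgue_on ?A. norm (f t - T' t)) \<le> r" using \<eta> by linarith
    have unif: "norm (S f n t - S T' n t) \<le> (d / (2 * pi)) powr (1 / p)" for t
    proof -
      have "S f n t - S T' n t = trig_sum (\<lambda>k. fourier_exp_coeff f k - fourier_exp_coeff T' k) {-
          int n..int n} t"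
        by (simp add: S_def trig_sum_def left_diff_distrib sum_subtractf)
      also have "norm \<dots> \<le> (\<Sum>k\<in>{- int n..int n}. norm (fourier_exp_coeff f k - fourier_exp_coeff T'
          k))"
        by (rule norm_trig_sum_le)
      also have "\<dots> \<le> (\<Sum>k\<in>{- int n..int n}. r)"
        using L1 by (intro sum_mono order_trans[OF fourier_exp_coeff_diff_le]) (auto intro!: int f
            L)
      also have "\<dots> = (2 * real n + 1) * r" by simp
      also have "\<dots> = (d / (2 * pi)) powr (1 / p)" by (simp add: r_def)
      finally show ?thesis .
    qed
    have 1: "Lp_int p ?A (\<lambda>t. S f n t - S T' n t) \<le> d"
    proof -
      have "Lp_int p ?A (\<lambda>t. S f n t - S T' n t) = integral {0..2*pi} (\<lambda>t. norm (S f n t - S T' n t)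
          powr p)"
        unfolding S_def by (intro Lp_int_period[OF _ p0(2)] continuous_on_diff
            continuous_on_trig_sum)
      also have "\<dots> \<le> integral {0..2*pi} (\<lambda>t. ((d / (2 * pi)) powr (1 / p)) powr p)"
        using unif p0 unfolding S_def
        by (intro integral_le integrable_norm_powr continuous_on_diff continuous_on_trig_sum) (auto
            intro!: powr_mono2)
      also have "\<dots> = d" using d p by (simp add: powr_powr)
      finally show ?thesis .
    qed
    have ST: "S T n t = T t" for t
    proof -
      have "S T n t = trig_sum c K t"
        unfolding S_def T_def trig_sum_def[of "fourier_exp_coeff _"] fourier_exp_coeff_trig_sum[OF
            K]
        unfolding trig_sum_def using sub n by (intro sum.mono_neutral_cong_right) auto
      then show ?thesis by (simp add: T_def)
    qed
    \<comment> \<open>For \<open>n \<ge> N\<close> the polynomial \<open>T\<close> is its own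
      partial sum, so the difference is a partial sum of \<open>T' - T\<close>; \<open>C\<close> is
      insensitive to the degree of \<open>T'\<close>, which may grow with \<open>n\<close>.\<close>
    have 2: "Lp_int p ?A (\<lambda>t. S T' n t - T t) \<le> C * Lp_int p ?A (\<lambda>t. T' t - T t)"
    proof -
      have "(\<lambda>t. T' t + (-1) * T t) \<in> trig_polys"
        unfolding T_def T'_def using K K'
        by (intro trig_polys_add trig_polys_mult trig_polys_const) (auto simp: trig_polys_def)
      then obtain b J where J: "finite J" and bJ: "(\<lambda>t. T' t - T t) = trig_sum b J"
        unfolding trig_polys_def by auto
      have lin: "fourier_exp_coeff (\<lambda>t. T' t - T t) k = fourier_exp_coeff T' k - fourier_exp_coeff T
          k" for k
      proof -
        have m: "(\<lambda>t. cis (- (of_int k * t))) \<in> borel_measurable (lebesgue_on ?A)"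
          by (intro borel_measurable_lebesgue_on_continuous continuous_intros)
        have "integrable (lebesgue_on ?A) (\<lambda>t. T' t * cis (- (of_int k * t)))" "integrable
            (lebesgue_on ?A) (\<lambda>t. T t * cis (- (of_int k * t)))"
          by (intro integrable_mult_bounded m int L; simp)+
        then show ?thesis unfolding fourier_exp_coeff_def left_diff_distrib
          by (simp add: Bochner_Integration.integral_diff right_diff_distrib)
      qed
      have "S T' n t - T t = trig_sum b (J \<inter> {- int n..int n}) t" for t
      proof -
        have "S T' n t - T t = S T' n t - S T n t" by (simp only: ST)
        also have "\<dots> = trig_sum (fourier_exp_coeff (\<lambda>t. T' t - T t)) {- int n..int n} t"
          by (simp add: S_def trig_sum_def lin left_diff_distrib sum_subtractf)
        also have "\<dots> = trig_sum b (J \<inter> {- int n..int n}) t"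
          unfolding bJ trig_sum_def[of "fourier_exp_coeff _"] fourier_exp_coeff_trig_sum[OF J]
          unfolding trig_sum_def by (intro sum.mono_neutral_cong_right) auto
        finally show ?thesis .
      qed
      then show ?thesis unfolding bJ
        using bound[OF J, of b n] by (simp add: Lp_int_period[OF continuous_on_trig_sum p0(2)])
    qed
    have sw: "Lp_int p ?A (\<lambda>t. x t - y t) = Lp_int p ?A (\<lambda>t. y t - x t)" for x y :: "real \<Rightarrow> complex"
      by (simp add: Lp_int_def norm_minus_commute)
    have 3: "Lp_int p ?A (\<lambda>t. T' t - T t) \<le> q * (d + d)"
    proof -
      have "Lp_int p ?A (\<lambda>t. T' t - f t) \<le> d" "Lp_int p ?A (\<lambda>t. f t - T t) \<le> d"
        using cK cK' unfolding sw[of T' f] by (simp_all add: T_def T'_def d'_def)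
      note le = this
      have "Lp_int p ?A (\<lambda>t. (T' t - f t) + (f t - T t)) \<le> q * (Lp_int p ?A (\<lambda>t. T' t - f t) +
          Lp_int p ?A (\<lambda>t. f t - T t))"
        unfolding q_def by (intro Lp_int_add_le in_Lp_diff L f p0)
      also have "\<dots> \<le> q * (d + d)"
        using q by (intro mult_left_mono add_mono le) auto
      finally show ?thesis by simp
    qed
    have "Lp_int p ?A (\<lambda>t. (S f n t - S T' n t) + ((S T' n t - T t) + (T t - f t)))
        \<le> q * (Lp_int p ?A (\<lambda>t. S f n t - S T' n t) + Lp_int p ?A (\<lambda>t. (S T' n t - T t) + (T t - f
            t)))"
      unfolding q_def by (intro Lp_int_add_le in_Lp_add in_Lp_diff L f p0)
    also have "\<dots> \<le> q * (Lp_int p ?A (\<lambda>t. S f n t - S T' n t) + q * (Lp_int p ?A (\<lambda>t. S T' n t - T t)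
        + Lp_int p ?A (\<lambda>t. T t - f t)))"
      unfolding q_def by (intro mult_left_mono add_left_mono Lp_int_add_le in_Lp_diff L f p0) auto
    also have "\<dots> < q * (d + q * (C * (q * (d + d)) + d))"
    proof (intro mult_strict_left_mono add_le_less_mono 1 q)
      show "Lp_int p ?A (\<lambda>t. S T' n t - T t) \<le> C * (q * (d + d))"
        using 2 mult_left_mono[OF 3 C] by linarith
      show "Lp_int p ?A (\<lambda>t. T t - f t) < d" using cK unfolding sw[of T f] by (simp add: T_def)
    qed
    also have "\<dots> = D * d" by (simp add: D_def algebra_simps)
    also have "\<dots> = e" using D by (simp add: d_def)
    finally show ?thesis by simp
  qed
  then show "\<exists>no. \<forall>n\<ge>no. norm (Lp_int p ?A (\<lambda>t. trig_sum (fourier_exp_coeff f) {- int n..int n} t -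
      f t) - 0) < e"
    by (auto simp: S_def intro!: exI[of _ N])
qed

section \<open>Strong convergence\<close>

lemma convex_on_powr_nonneg:
  assumes "p \<ge> 1"
  shows "convex_on {0..} (\<lambda>x::real. x powr p)"
proof (rule convex_onI)
  have scale: "(u * x) powr p \<le> u * x powr p" if "0 < u" "u \<le> 1" "x \<ge> 0" for u x :: real
  proof -
    have "u powr p \<le> u powr 1" using that assms by (intro powr_mono') auto
    then show ?thesis using that by (simp add: powr_mult mult_right_mono)
  qed
  fix u x y :: real
  assume u: "0 < u" "u < 1" and xy: "x \<in> {0..}" "y \<in> {0..}"
  show "((1 - u) *\<^sub>R x + u *\<^sub>R y) powr p \<le> (1 - u) * x powr p + u * y powr p"
  proof (cases "x = 0 \<or> y = 0")
    case True
    then show ?thesis using scale[of u y] scale[of "1 - u" x] u xy by auto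
  next
    case False
    then show ?thesis using convex_onD[OF powr_convex[OF assms], of u x y] u xy by auto
  qed
qed simp

text \<open>Jensen's inequality for the normalized weights \<open>w k / W\<close>; replacing the
  total mass by the comparable \<open>L\<close> costs a factor 2 inside the power.\<close>

lemma weighted_sum_powr_le:
  fixes w x :: "nat \<Rightarrow> real"
  assumes w: "\<And>k. w k \<ge> 0" and x: "\<And>k. x k \<ge> 0" and p: "p \<ge> 1"
    and L: "L > 0" "L \<le> sum w {0..n}" "sum w {0..n} \<le> 2 * L"
  shows "(1 / L * (\<Sum>k=0..n. w k * x k)) powr p \<le> 2 powr p * (1 / L * (\<Sum>k=0..n. w k * x k powr p))"
proof -
  define W where "W = sum w {0..n}"
  have W: "W > 0" "L \<le> W" "W \<le> 2 * L" using L by (auto simp: W_def)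
  have nn: "(\<Sum>k=0..n. w k * x k) \<ge> 0" "(\<Sum>k=0..n. w k * x k powr p) \<ge> 0"
    using w x by (auto intro!: sum_nonneg)
  have "1 / L * (\<Sum>k=0..n. w k * x k) = W / L * (\<Sum>k=0..n. (w k / W) *\<^sub>R x k)"
    using W by (simp flip: sum_divide_distrib)
  also have "\<dots> \<le> 2 * (\<Sum>k=0..n. (w k / W) *\<^sub>R x k)"
    using W L w x by (intro mult_right_mono sum_nonneg) (auto simp: divide_le_eq)
  finally have "(1 / L * (\<Sum>k=0..n. w k * x k)) powr p \<le> (2 * (\<Sum>k=0..n. (w k / W) *\<^sub>R x k)) powr p"
    using nn L p by (intro powr_mono2) auto
  also have "\<dots> = 2 powr p * (\<Sum>k=0..n. (w k / W) *\<^sub>R x k) powr p"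
    by (rule powr_mult)
  also have "(\<Sum>k=0..n. (w k / W) *\<^sub>R x k) powr p \<le> (\<Sum>k=0..n. w k / W * x k powr p)"
    using W w x by (intro convex_on_sum[OF _ _ convex_on_powr_nonneg[OF p]]) (auto simp: W_def simp
        flip: sum_divide_distrib)
  also have "\<dots> = 1 / W * (\<Sum>k=0..n. w k * x k powr p)"
    by (simp add: sum_divide_distrib)
  also have "\<dots> \<le> 1 / L * (\<Sum>k=0..n. w k * x k powr p)"
    using W L nn by (intro mult_right_mono) (auto simp: frac_le)
  finally show ?thesis by simp
qed

section \<open>Averages with the weights \<lambda>_k - \<lambda>_(k-2) and pointwise estimates of
  the increments\<close>

locale lambda_seq =
  fixes lam :: "nat \<Rightarrow> real"
  assumes mono: "mono lam" and pos: "\<And>k. lam k > 0" and unbounded: "filterlim lam at_top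
      sequentially"
begin

definition weight :: "nat \<Rightarrow> real" where "weight k = lam k - back2 lam k"

lemma back2_nonneg: "back2 lam k \<ge> 0"
  using pos by (simp add: back2_def less_imp_le)

lemma weight_nonneg: "weight k \<ge> 0"
  using pos monoD[OF mono, of "k - 2" k] by (auto simp: weight_def back2_def less_imp_le)

lemma sum_weight: "sum weight {0..Suc n} = lam (Suc n) + lam n"
  by (induction n) (auto simp: weight_def back2_def)

lemma sum_weight_bounds: "lam n \<le> sum weight {0..n}" "sum weight {0..n} \<le> 2 * lam n"
proof -
  have "lam n \<le> sum weight {0..n} \<and> sum weight {0..n} \<le> 2 * lam n"
  proof (cases n)
    case 0
    then show ?thesis using pos[of 0] by (simp add: weight_def back2_def)
  next
    case (Suc m)
    then show ?thesis using sum_weight[of m] pos[of m] monoD[OF mono, of m "Suc m"] by simp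
  qed
  then show "lam n \<le> sum weight {0..n}" "sum weight {0..n} \<le> 2 * lam n" by auto
qed

text \<open>A Toeplitz argument: an initial block of terms stays fixed while \<open>lam n\<close>
  tends to infinity, and the remainder has mass at most \<open>2 * lam n\<close>, whence the
  threshold \<open>e / 4\<close>.\<close>

lemma weighted_mean_tendsto_0:
  assumes x: "x \<longlonglongrightarrow> 0" "\<And>k. x k \<ge> 0"
  shows "(\<lambda>n. 1 / lam n * (\<Sum>k=0..n. weight k * x k)) \<longlonglongrightarrow> 0"
proof (rule LIMSEQ_I)
  fix e :: real assume e: "e > 0"
  then have "\<forall>\<^sub>F k in sequentially. x k < e / 4" using x(1) by (intro order_tendstoD) auto
  then obtain K where K: "\<And>k. k \<ge> K \<Longrightarrow> x k < e / 4" unfolding eventually_sequentially by blast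
  define B where "B = (\<Sum>k<K. weight k * x k)"
  have "(\<lambda>n. B / lam n) \<longlonglongrightarrow> 0"
    by (rule tendsto_divide_0[OF tendsto_const filterlim_at_top_imp_at_infinity[OF unbounded]])
  then have "\<forall>\<^sub>F n in sequentially. B / lam n < e / 2" using e by (intro order_tendstoD) auto
  then obtain N where N: "\<And>n. n \<ge> N \<Longrightarrow> B / lam n < e / 2" unfolding eventually_sequentially by blast
  have "norm (1 / lam n * (\<Sum>k=0..n. weight k * x k) - 0) < e" if "n \<ge> N" for n
  proof -
    have "(\<Sum>k=0..n. weight k * x k) \<le> (\<Sum>k=0..n. (if k < K then weight k * x k else 0) + weight k *
        (e / 4))"
    proof (rule sum_mono)
      fix k
      show "weight k * x k \<le> (if k < K then weight k * x k else 0) + weight k * (e / 4)"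
        using e weight_nonneg[of k] mult_left_mono[OF less_imp_le[OF K[of k]] weight_nonneg[of k]]
            by auto
    qed
    also have "\<dots> = (\<Sum>k=0..n. if k < K then weight k * x k else 0) + sum weight {0..n} * (e / 4)"
      by (simp add: sum.distrib sum_distrib_right sum_divide_distrib)
    also have "\<dots> \<le> B + 2 * lam n * (e / 4)"
    proof (intro add_mono mult_right_mono sum_weight_bounds)
      have "(\<Sum>k=0..n. if k < K then weight k * x k else 0) = (\<Sum>k\<in>{0..n} \<inter> {..<K}. weight k * x k)"
        by (subst sum.inter_restrict) auto
      also have "\<dots> \<le> B" unfolding B_def using weight_nonneg x(2) by (intro sum_mono2) auto
      finally show "(\<Sum>k=0..n. if k < K then weight k * x k else 0) \<le> B" .
    qed (use e in auto)
    finally have "1 / lam n * (\<Sum>k=0..n. weight k * x k) \<le> 1 / lam n * (B + 2 * lam n * (e / 4))"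
      using pos[of n] by (intro mult_left_mono) auto
    also have "\<dots> = B / lam n + e / 2" using pos[of n] by (simp add: field_simps)
    also have "\<dots> < e" using N[OF that] by linarith
    finally have "1 / lam n * (\<Sum>k=0..n. weight k * x k) < e" .
    moreover have "1 / lam n * (\<Sum>k=0..n. weight k * x k) \<ge> 0"
      using pos[of n] weight_nonneg x(2) by (intro mult_nonneg_nonneg sum_nonneg) (auto simp:
          less_imp_le)
    ultimately show ?thesis by simp
  qed
  then show "\<exists>no. \<forall>n\<ge>no. norm (1 / lam n * (\<Sum>k=0..n. weight k * x k) - 0) < e" by blast
qed

text \<open>For \<open>k < 2\<close> the difference \<open>back2 (\<lambda>j. s j t) k - h t\<close>
  need not vanish, but its factor \<open>back2 lam k\<close> does.\<close>

definition incr :: "(nat \<Rightarrow> real \<Rightarrow> complex) \<Rightarrow> (real \<Rightarrow> complex) \<Rightarrow> nat \<Rightarrow> real \<Rightarrow> real" where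
  "incr s h k t = cmod (of_real (lam k) * (s k t - h t) - of_real (back2 lam k) * (back2 (\<lambda>j. s j t)
      k - h t))"

definition incr_mean :: "(nat \<Rightarrow> real \<Rightarrow> complex) \<Rightarrow> (real \<Rightarrow> complex) \<Rightarrow> nat \<Rightarrow> real \<Rightarrow> real" where
  "incr_mean s h n t = 1 / lam n * (\<Sum>k=0..n. incr s h k t)"

lemma Lambda2_strongly_to_iff:
  "Lambda2_strongly_to lam p A s h \<longleftrightarrow> (\<forall>k. in_Lp p A (s k)) \<and> in_Lp p A h \<and> (\<lambda>n. Lp_norm p A
      (incr_mean s h n)) \<longlonglongrightarrow> 0"
  unfolding Lambda2_strongly_to_def Lp_on_iff incr_mean_def[abs_def] incr_def by (rule refl)

text \<open>The telescoping runs down the indices of the parity of \<open>n\<close>; increments of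
  the other parity are nonnegative and merely added.\<close>

lemma norm_diff_le_sum_incr: "lam n * cmod (s n t - h t) \<le> (\<Sum>k=0..n. incr s h k t)"
proof (induction n rule: less_induct)
  case (less n)
  show ?case
  proof (cases "n < 2")
    case True
    then have "lam n * cmod (s n t - h t) = incr s h n t"
      using pos[of n] by (simp add: incr_def back2_def norm_mult)
    also have "\<dots> \<le> (\<Sum>k=0..n. incr s h k t)" by (rule member_le_sum) (auto simp: incr_def)
    finally show ?thesis .
  next
    case False
    then have b: "back2 lam n = lam (n - 2)" "back2 (\<lambda>j. s j t) n = s (n - 2) t" by (auto simp:
        back2_def)
    have "lam n * cmod (s n t - h t) = cmod (of_real (lam n) * (s n t - h t))"
      using pos[of n] by (simp add: norm_mult)
    also have "\<dots> \<le> incr s h n t + cmod (of_real (lam (n - 2)) * (s (n - 2) t - h t))"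
      unfolding incr_def b
      using norm_triangle_sub[of "of_real (lam n) * (s n t - h t)" "of_real (lam (n - 2)) * (s (n -
          2) t - h t)"] by simp
    also have "cmod (of_real (lam (n - 2)) * (s (n - 2) t - h t)) = lam (n - 2) * cmod (s (n - 2) t
        - h t)"
      using pos[of "n - 2"] by (simp add: norm_mult)
    also have "\<dots> \<le> (\<Sum>k=0..n - 2. incr s h k t)" using False by (intro less) auto
    also have "incr s h n t + (\<Sum>k=0..n - 2. incr s h k t) = (\<Sum>k\<in>insert n {0..n - 2}. incr s h k t)"
      using False by (subst sum.insert) auto
    also have "\<dots> \<le> (\<Sum>k=0..n. incr s h k t)" by (intro sum_mono2) (auto simp: incr_def)
    finally show ?thesis by simp
  qed
qed

lemma incr_eq: "incr s h k t = cmod (of_real (weight k) * (s k t - h t) + of_real (back2 lam k) * (s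
    k t - back2 (\<lambda>j. s j t) k))"
  unfolding incr_def weight_def by (simp add: algebra_simps)

lemma incr_le: "incr s h k t \<le> weight k * cmod (s k t - h t) + back2 lam k * cmod (s k t - back2
    (\<lambda>j. s j t) k)"
  unfolding incr_eq using norm_triangle_ineq[of "of_real (weight k) * (s k t - h t)"] weight_nonneg
      back2_nonneg
  by (metis abs_of_nonneg norm_mult norm_of_real)

lemma back2_step_le: "back2 lam k * cmod (s k t - back2 (\<lambda>j. s j t) k) \<le> incr s h k t + weight k *
    cmod (s k t - h t)"
proof -
  let ?x = "of_real (weight k) * (s k t - h t)" and ?y = "of_real (back2 lam k) * (s k t - back2
      (\<lambda>j. s j t) k)"
  have "cmod ?y \<le> cmod (?x + ?y) + cmod ?x" using norm_triangle_ineq4[of "?x + ?y" ?x] by simp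
  then show ?thesis unfolding incr_eq using weight_nonneg back2_nonneg by (simp add: norm_mult)
qed

context
  fixes p :: real and A :: "real set"
  assumes p: "p \<ge> 1" and A: "A \<subseteq> {0..<2*pi}" "A \<in> sets lebesgue"
begin

lemma integrable_Lp:
  fixes f :: "real \<Rightarrow> 'a::euclidean_space"
  shows "in_Lp p A f \<Longrightarrow> integrable (lebesgue_on A) f"
  by (rule in_Lp_imp_integrable[OF _ p A])

lemma in_Lp_back2:
  assumes "\<And>k. in_Lp p A (s k)"
  shows "in_Lp p A (\<lambda>t. back2 (\<lambda>j. s j t) k)"
  using assms by (cases "k < 2") (simp_all add: back2_def in_Lp_zero)

lemma in_Lp_incr_mean:
  assumes "\<And>k. in_Lp p A (s k)" "in_Lp p A h"
  shows "in_Lp p A (incr_mean s h n)"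
  unfolding incr_mean_def incr_def using p assms
  by (intro in_Lp_cmult in_Lp_sum in_Lp_norm in_Lp_diff in_Lp_back2) auto

text \<open>On the L^1 level integration commutes with the sums over \<open>k\<close>. The second
  limit costs a weighted mean of the quantities in the first one, which is covered by
  \<open>weighted_mean_tendsto_0\<close>.\<close>

lemma strongly_imp_L1:
  assumes "Lambda2_strongly_to lam p A s h"
  shows "(\<lambda>n. LINT t|lebesgue_on A. cmod (s n t - h t)) \<longlonglongrightarrow> 0"
    and "(\<lambda>n. 1 / lam n * (\<Sum>k=0..n. back2 lam k * (LINT t|lebesgue_on A. cmod (s k t - back2 (\<lambda>j. s
        j t) k)))) \<longlonglongrightarrow> 0"
proof -
  have L: "\<And>k. in_Lp p A (s k)" "in_Lp p A h" using assms by (auto simp: Lambda2_strongly_to_iff)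
  have p0: "p \<ge> 0" using p by simp
  note LX = in_Lp_incr_mean[OF L]
  have X0: "(\<lambda>n. LINT t|lebesgue_on A. norm (incr_mean s h n t)) \<longlonglongrightarrow> 0"
  proof (rule integral_norm_tendsto_0[OF LX p A])
    show "(\<lambda>n. Lp_int p A (incr_mean s h n)) \<longlonglongrightarrow> 0"
      using assms p Lp_norm_tendsto_0_iff[of p A "incr_mean s h"] by (simp add:
          Lambda2_strongly_to_iff)
  qed
  have nn: "incr_mean s h n t \<ge> 0" for n t
    using pos[of n] by (simp add: incr_mean_def incr_def sum_nonneg less_imp_le)
  then have X: "(\<lambda>n. LINT t|lebesgue_on A. incr_mean s h n t) \<longlonglongrightarrow> 0" using X0 by simp
  have ie: "integrable (lebesgue_on A) (\<lambda>t. cmod (s k t - h t))" for k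
    by (intro integrable_norm integrable_Lp in_Lp_diff L p0)
  have ib: "integrable (lebesgue_on A) (\<lambda>t. cmod (s k t - back2 (\<lambda>j. s j t) k))" for k
    by (intro integrable_norm integrable_Lp in_Lp_diff in_Lp_back2 L p0)
  have iX: "integrable (lebesgue_on A) (incr_mean s h n)" for n by (rule integrable_Lp[OF LX])
  show e0: "(\<lambda>n. LINT t|lebesgue_on A. cmod (s n t - h t)) \<longlonglongrightarrow> 0"
  proof (rule tendsto_sandwich[OF _ _ tendsto_const X])
    have "cmod (s n t - h t) \<le> incr_mean s h n t" for n t
      using norm_diff_le_sum_incr[of n s t h] pos[of n] by (simp add: incr_mean_def field_simps)
    then show "\<forall>\<^sub>F n in sequentially. (LINT t|lebesgue_on A. cmod (s n t - h t)) \<le> (LINT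
        t|lebesgue_on A. incr_mean s h n t)"
      by (intro always_eventually allI integral_mono ie iX)
  qed (auto intro!: always_eventually)
  have lim: "(\<lambda>n. (LINT t|lebesgue_on A. incr_mean s h n t) + 1 / lam n * (\<Sum>k=0..n. weight k * (LINT
      t|lebesgue_on A. cmod (s k t - h t)))) \<longlonglongrightarrow> 0 + 0"
    by (intro tendsto_add X weighted_mean_tendsto_0 e0) auto
  show "(\<lambda>n. 1 / lam n * (\<Sum>k=0..n. back2 lam k * (LINT t|lebesgue_on A. cmod (s k t - back2 (\<lambda>j. s j
      t) k)))) \<longlonglongrightarrow> 0"
  proof (rule tendsto_sandwich[OF _ _ tendsto_const lim[simplified]])
    have "1 / lam n * (\<Sum>k=0..n. back2 lam k * (LINT t|lebesgue_on A. cmod (s k t - back2 (\<lambda>j. s j t)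
        k)))
      \<le> (LINT t|lebesgue_on A. incr_mean s h n t) + 1 / lam n * (\<Sum>k=0..n. weight k * (LINT
          t|lebesgue_on A. cmod (s k t - h t)))" for n
    proof -
      have "1 / lam n * (\<Sum>k=0..n. back2 lam k * (LINT t|lebesgue_on A. cmod (s k t - back2 (\<lambda>j. s j
          t) k)))
        = (LINT t|lebesgue_on A. 1 / lam n * (\<Sum>k=0..n. back2 lam k * cmod (s k t - back2 (\<lambda>j. s j t)
            k)))"
        by (simp add: Bochner_Integration.integral_sum ib)
      also have "\<dots> \<le> (LINT t|lebesgue_on A. incr_mean s h n t + 1 / lam n * (\<Sum>k=0..n. weight k *
          cmod (s k t - h t)))"
      proof (intro integral_mono Bochner_Integration.integrable_add
          Bochner_Integration.integrable_mult_right Bochner_Integration.integrable_sum iX ib ie)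
        fix t
        have "(\<Sum>k=0..n. back2 lam k * cmod (s k t - back2 (\<lambda>j. s j t) k)) \<le> (\<Sum>k=0..n. incr s h k t)
            + (\<Sum>k=0..n. weight k * cmod (s k t - h t))"
          unfolding sum.distrib[symmetric] by (intro sum_mono back2_step_le)
        then have "1 / lam n * (\<Sum>k=0..n. back2 lam k * cmod (s k t - back2 (\<lambda>j. s j t) k))
          \<le> 1 / lam n * ((\<Sum>k=0..n. incr s h k t) + (\<Sum>k=0..n. weight k * cmod (s k t - h t)))"
          using pos[of n] by (intro mult_left_mono) (auto simp: less_imp_le)
        then show "1 / lam n * (\<Sum>k=0..n. back2 lam k * cmod (s k t - back2 (\<lambda>j. s j t) k))
          \<le> incr_mean s h n t + 1 / lam n * (\<Sum>k=0..n. weight k * cmod (s k t - h t))"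
          by (simp only: incr_mean_def distrib_left)
      qed
      also have "\<dots> = (LINT t|lebesgue_on A. incr_mean s h n t) + 1 / lam n * (\<Sum>k=0..n. weight k *
          (LINT t|lebesgue_on A. cmod (s k t - h t)))"
        by (simp add: Bochner_Integration.integral_sum Bochner_Integration.integral_add iX ie)
      finally show ?thesis .
    qed
    then show "\<forall>\<^sub>F n in sequentially. 1 / lam n * (\<Sum>k=0..n. back2 lam k * (LINT t|lebesgue_on A.
        cmod (s k t - back2 (\<lambda>j. s j t) k)))
      \<le> (LINT t|lebesgue_on A. incr_mean s h n t) + (\<Sum>k=0..n. weight k * (LINT t|lebesgue_on A. cmod
          (s k t - h t))) / lam n"
      by (intro always_eventually allI) simp
    show "\<forall>\<^sub>F n in sequentially. 0 \<le> 1 / lam n * (\<Sum>k=0..n. back2 lam k * (LINT t|lebesgue_on A. cmod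
        (s k t - back2 (\<lambda>j. s j t) k)))"
      using pos back2_nonneg by (intro always_eventually allI mult_nonneg_nonneg sum_nonneg) (auto
          simp: less_imp_le)
  qed
qed

end

text \<open>The weight \<open>lam (k - 1)\<close> of \<open>x k\<close> is
  \<open>back2 lam (k + 1)\<close>, hence it occurs in the increment of the next index; the last
  index has no such partner.\<close>

lemma sum_shift_back2:
  fixes x :: "nat \<Rightarrow> real"
  shows "(\<Sum>k=1..Suc n. lam (k - 1) * x k) = (\<Sum>k=0..Suc n. back2 lam k * x (k - 1)) + lam n * x (Suc
      n)"
  by (induction n) (simp_all add: back2_def)

end

section \<open>Necessity of the coefficient condition\<close>

lemma measure_lebesgue_pos:
  assumes A: "A \<subseteq> {0..<2*pi}" "A \<in> sets lebesgue" "emeasure lebesgue A > 0"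
  shows "measure lebesgue A > 0"
proof -
  have "A \<in> lmeasurable" by (rule bounded_set_imp_lmeasurable[OF bounded_subset[OF _ A(1)] A(2)])
      simp
  then have eq: "emeasure lebesgue A = ennreal (measure lebesgue A)"
    by (rule emeasure_eq_ennreal_measure[OF fmeasurableD2])
  show ?thesis using A(3) unfolding eq by simp
qed

text \<open>Nothing is known about \<open>a\<close>, so its term has to be projected away. This
  works since \<open>cis\<close> is injective on the period and thus not constant almost everywhere
  on \<open>A\<close>.\<close>

lemma integral_affine_cis_lower_bound:
  assumes A: "A \<subseteq> {0..<2*pi}" "A \<in> sets lebesgue" "emeasure lebesgue A > 0"
  shows "\<exists>c>0. \<forall>a b. c * norm b \<le> (LINT t|lebesgue_on A. norm (a * cis t + b))"
proof -
  let ?M = "lebesgue_on A"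
  interpret finite_measure ?M by (rule finite_measure_lebesgue_on[OF A(1,2)])
  define m where "m = measure lebesgue A"
  have mM: "measure ?M (space ?M) = m" using A(2) by (simp add: m_def measure_restrict_space)
  have bm: "g \<in> borel_measurable ?M" if "continuous_on UNIV g" for g :: "real \<Rightarrow> complex"
    by (intro continuous_imp_measurable_on_sets_lebesgue continuous_on_subset[OF that] A) auto
  have ic: "integrable ?M cis"
    by (rule integrable_const_bound[where B = 1]) (auto intro!: AE_I2 bm continuous_intros)
  have ic': "integrable ?M (\<lambda>t. cis (- t))"
    by (rule integrable_const_bound[where B = 1]) (auto intro!: AE_I2 bm continuous_intros)
  have m: "m > 0" unfolding m_def by (rule measure_lebesgue_pos[OF A])
  define \<alpha> where "\<alpha> = (LINT t|?M. cis t) / of_real m"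
  \<comment> \<open>This test function annihilates \<open>cis\<close> on \<open>A\<close>, so that only \<open>b\<close> survives in \<open>I\<close>.\<close>
  define \<phi> where "\<phi> = (\<lambda>t. 1 - \<alpha> * cis (- t))"
  have c\<phi>: "continuous_on UNIV \<phi>" unfolding \<phi>_def by (intro continuous_intros)
  have I1: "(LINT t|?M. cis t) = \<alpha> * of_real m" using m by (simp add: \<alpha>_def)
  have I2: "(LINT t|?M. cis (- t)) = cnj \<alpha> * of_real m"
    using Bochner_Integration.integral_cnj[of ?M cis] I1 by (simp add: cis_cnj)
  have prod: "(a * cis t + b) * \<phi> t = a * cis t + b - a * \<alpha> - b * \<alpha> * cis (- t)" for a b t
    by (simp add: \<phi>_def algebra_simps cis_mult)
  have I: "(LINT t|?M. (a * cis t + b) * \<phi> t) = b * of_real (m * (1 - (norm \<alpha>)\<^sup>2))" for a b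
  proof -
    have "(LINT t|?M. (a * cis t + b) * \<phi> t) = a * (\<alpha> * m) + b * m - a * \<alpha> * m - b * \<alpha> * (cnj \<alpha> *
        m)"
      unfolding prod using ic ic' mM by (simp add: I1 I2 scaleR_conv_of_real)
    also have "\<dots> = b * of_real m * (1 - \<alpha> * cnj \<alpha>)" by (simp add: algebra_simps)
    also have "\<alpha> * cnj \<alpha> = of_real ((norm \<alpha>)\<^sup>2)" by (rule complex_norm_square[symmetric])
    finally show ?thesis by (simp add: algebra_simps)
  qed
  \<comment> \<open>A mean of unimodular values has modulus 1 only if they are constant almost
    everywhere. \<open>I\<close> itself evaluates the integral of |\<phi>|^2, with
    \<open>a = - cnj \<alpha>\<close> and \<open>b = 1\<close>.\<close>
  have "(norm \<alpha>)\<^sup>2 < 1"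
  proof (rule ccontr)
    assume ge: "\<not> (norm \<alpha>)\<^sup>2 < 1"
    have n2: "of_real ((norm (\<phi> t))\<^sup>2) = (- cnj \<alpha> * cis t + 1) * \<phi> t" for t
      unfolding complex_norm_square by (simp add: \<phi>_def cis_cnj mult.commute)
    have "(LINT t|?M. of_real ((norm (\<phi> t))\<^sup>2)) = complex_of_real (m * (1 - (norm \<alpha>)\<^sup>2))"
      unfolding n2 I by simp
    then have int: "(LINT t|?M. (norm (\<phi> t))\<^sup>2) = m * (1 - (norm \<alpha>)\<^sup>2)"
      by (simp only: integral_complex_of_real of_real_eq_iff)
    have "norm (\<phi> t) \<le> 1 + norm \<alpha>" for t
      unfolding \<phi>_def using norm_triangle_ineq4[of 1 "\<alpha> * cis (- t)"] by (simp add: norm_mult)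
    then have i2: "integrable ?M (\<lambda>t. (norm (\<phi> t))\<^sup>2)"
      using measurable_compose[OF bm[OF c\<phi>] borel_measurable_norm]
      by (intro integrable_const_bound[where B = "(1 + norm \<alpha>)\<^sup>2"] borel_measurable_power)
         (auto intro!: AE_I2 power_mono)
    have "m * (1 - (norm \<alpha>)\<^sup>2) \<le> 0" using ge m by (simp add: mult_le_0_iff)
    moreover have "(LINT t|?M. (norm (\<phi> t))\<^sup>2) \<ge> 0" by simp
    ultimately have "(LINT t|?M. (norm (\<phi> t))\<^sup>2) = 0" using int by linarith
    then have "AE t in ?M. (norm (\<phi> t))\<^sup>2 = 0" using integral_nonneg_eq_0_iff_AE[OF i2] by simp
    then have ae: "AE t in ?M. cis t = \<alpha>"
    proof (rule eventually_mono)
      fix t assume "(norm (\<phi> t))\<^sup>2 = 0"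
      then have "\<alpha> * cis (- t) = 1" by (simp add: \<phi>_def)
      then have "\<alpha> * (cis (- t) * cis t) = cis t" by (simp flip: mult.assoc)
      then show "cis t = \<alpha>" by (simp add: cis_mult)
    qed
    have "A \<inter> {t. cis t = \<alpha>} \<subseteq> {Arg2pi \<alpha>}"
    proof
      fix t assume "t \<in> A \<inter> {t. cis t = \<alpha>}"
      then have "Arg2pi \<alpha> = t" using A(1) by (intro Arg2pi_unique[of 1]) (auto simp: cis_conv_exp)
      then show "t \<in> {Arg2pi \<alpha>}" by simp
    qed
    then have "A \<inter> {t. cis t = \<alpha>} \<in> null_sets lebesgue"
      using negligible_subset[OF negligible_sing] by (simp add: negligible_iff_null_sets)
    then have "AE t in lebesgue. t \<notin> A \<inter> {t. cis t = \<alpha>}" by (rule AE_not_in)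
    moreover have "AE t in lebesgue. t \<in> A \<longrightarrow> cis t = \<alpha>"
      using ae A(2) by (simp add: AE_restrict_space_iff)
    ultimately have "AE t in lebesgue. t \<notin> A" by eventually_elim auto
    then have "emeasure lebesgue A = 0" using A(2) by (simp add: AE_iff_null_sets null_setsD1)
    with A(3) show False by simp
  qed
  then have \<alpha>1: "norm \<alpha> < 1" using power_less_imp_less_base[of "norm \<alpha>" 2 1] by simp
  \<comment> \<open>The factor 1/2 pays for |\<phi>| \<le> 2.\<close>
  define c where "c = m * (1 - (norm \<alpha>)\<^sup>2) / 2"
  have c: "c > 0" using m \<open>(norm \<alpha>)\<^sup>2 < 1\<close> by (simp add: c_def)
  have "c * norm b \<le> (LINT t|?M. norm (a * cis t + b))" for a b
  proof -
    have ib: "integrable ?M (\<lambda>t. a * cis t + b)" using ic by simp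
    have "2 * c * norm b = norm (LINT t|?M. (a * cis t + b) * \<phi> t)"
      unfolding I norm_mult using c by (simp add: c_def del: of_real_mult of_real_diff)
    also have "\<dots> \<le> (LINT t|?M. norm ((a * cis t + b) * \<phi> t))" by (rule integral_norm_bound)
    also have "\<dots> \<le> (LINT t|?M. 2 * norm (a * cis t + b))"
    proof (rule integral_mono)
      show "integrable ?M (\<lambda>t. norm ((a * cis t + b) * \<phi> t))"
        unfolding prod using ic ic' by (intro integrable_norm) simp
      show "integrable ?M (\<lambda>t. 2 * norm (a * cis t + b))" using ib by simp
      fix t
      have "norm (\<phi> t) \<le> 2"
        unfolding \<phi>_def using norm_triangle_ineq4[of 1 "\<alpha> * cis (- t)"] \<alpha>1 by (simp add: norm_mult)
      then show "norm ((a * cis t + b) * \<phi> t) \<le> 2 * norm (a * cis t + b)"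
        by (simp add: norm_mult mult.commute[of _ "norm (\<phi> t)"] mult_right_mono)
    qed
    finally show ?thesis by simp
  qed
  with c show ?thesis by blast
qed

context lambda_seq begin

text \<open>The increments control every coefficient of the sum except the last; that summand is at
  most the modulus of the last coefficient and is treated separately in \<open>lim2\<close>.\<close>

lemma strongly_convergent_imp_coeff_condition:
  assumes p: "p \<ge> 1" and A: "A \<in> sets lebesgue" "A \<subseteq> {0..<2*pi}" "emeasure lebesgue A > 0"
    and c: "Lambda2_strongly_convergent lam p A (\<lambda>n t. \<Sum>k=1..n. a k * of_real (cos (real k * t)))"
    and s: "Lambda2_strongly_convergent lam p A (\<lambda>n t. \<Sum>k=1..n. a k * of_real (sin (real k * t)))"
  shows "(\<lambda>n. 1 / lam n * (\<Sum>k=1..n. lam (k - 1) * cmod (a k))) \<longlonglongrightarrow> 0"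
proof -
  let ?M = "lebesgue_on A"
  define C where "C = (\<lambda>n t. \<Sum>k=1..n. a k * of_real (cos (real k * t)))"
  define S where "S = (\<lambda>n t. \<Sum>k=1..n. a k * of_real (sin (real k * t)))"
  obtain f g where fg: "Lambda2_strongly_to lam p A C f" "Lambda2_strongly_to lam p A S g"
    using c s unfolding Lambda2_strongly_convergent_def C_def S_def by blast
  interpret M: finite_measure ?M by (rule finite_measure_lebesgue_on[OF A(2,1)])
  have p0: "p \<ge> 0" using p by simp
  have L: "in_Lp p A (C k)" "in_Lp p A (S k)" "in_Lp p A f" "in_Lp p A g" for k
    using fg by (auto simp: Lambda2_strongly_to_iff)
  note int = integrable_Lp[OF p A(2,1)]
  obtain d where d: "d > 0" "\<And>a b. d * norm b \<le> (LINT t|?M. norm (a * cis t + b))"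
    using integral_affine_cis_lower_bound[OF A(2,1,3)] by blast
  \<comment> \<open>The coefficients are complex, so the two combinations are not real and imaginary
    parts; the triangle inequality for \<open>z + \<i> * w\<close> suffices.\<close>
  have cmb: "cmod (x * of_real (cos u) + y * of_real (cos v)) + cmod (x * of_real (sin u) + y *
      of_real (sin v)) \<ge> cmod (x * cis u + y * cis v)" for x y u v
  proof -
    have "x * cis u + y * cis v = (x * of_real (cos u) + y * of_real (cos v)) + \<i> * (x * of_real
        (sin u) + y * of_real (sin v))"
      by (simp add: cis.ctr complex_eq_iff algebra_simps)
    also have "cmod \<dots> \<le> cmod (x * of_real (cos u) + y * of_real (cos v)) + cmod (\<i> * (x * of_real
        (sin u) + y * of_real (sin v)))"
      by (rule norm_triangle_ineq)
    finally show ?thesis by (simp add: norm_mult)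
  qed
  define IC where "IC = (\<lambda>k. LINT t|?M. cmod (C k t - back2 (\<lambda>j. C j t) k))"
  define IS where "IS = (\<lambda>k. LINT t|?M. cmod (S k t - back2 (\<lambda>j. S j t) k))"
  have key: "d * cmod (a (k - 1)) \<le> IC k + IS k" if k: "k \<ge> 2" for k
  proof -
    obtain j where j: "k = Suc (Suc j)" using k by (metis Suc_le_D numeral_2_eq_2 Suc_le_mono)
    have Ck: "C k t - back2 (\<lambda>j. C j t) k = a k * of_real (cos (real k * t)) + a (k - 1) * of_real
        (cos (real (k - 1) * t))" for t
      by (simp add: j C_def back2_def)
    have Sk: "S k t - back2 (\<lambda>j. S j t) k = a k * of_real (sin (real k * t)) + a (k - 1) * of_real
        (sin (real (k - 1) * t))" for t
      by (simp add: j S_def back2_def)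
    have "d * cmod (a (k - 1)) \<le> (LINT t|?M. cmod (a k * cis t + a (k - 1)))" by (rule d)
    also have "\<dots> \<le> (LINT t|?M. cmod (C k t - back2 (\<lambda>j. C j t) k) + cmod (S k t - back2 (\<lambda>j. S j t)
        k))"
    proof (rule integral_mono)
      have "continuous_on A (\<lambda>t. a k * cis t + a (k - 1))" by (intro continuous_intros)
      then have "(\<lambda>t. a k * cis t + a (k - 1)) \<in> borel_measurable ?M"
        by (intro continuous_imp_measurable_on_sets_lebesgue A)
      then have "integrable ?M (\<lambda>t. a k * cis t + a (k - 1))"
        by (rule M.integrable_const_bound[where B = "cmod (a k) + cmod (a (k - 1))", rotated])
           (auto intro!: AE_I2 norm_triangle_le simp: norm_mult)
      then show "integrable ?M (\<lambda>t. cmod (a k * cis t + a (k - 1)))" by (rule integrable_norm)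
      show "integrable ?M (\<lambda>t. cmod (C k t - back2 (\<lambda>j. C j t) k) + cmod (S k t - back2 (\<lambda>j. S j t)
          k))"
        by (intro Bochner_Integration.integrable_add integrable_norm int in_Lp_diff in_Lp_back2[OF p
            A(2,1)] L p0)
      fix t
      \<comment> \<open>Dividing out \<open>cis (real (k - 1) * t)\<close> leaves frequencies 1 and
        0 for every \<open>k\<close>, hence the single constant \<open>d\<close>.\<close>
      have "cis (real k * t) = cis (real (k - 1) * t) * cis t" by (simp add: j cis_mult
          algebra_simps)
      then have "a k * cis (real k * t) + a (k - 1) * cis (real (k - 1) * t) = cis (real (k - 1) *
          t) * (a k * cis t + a (k - 1))"
        by (simp add: algebra_simps)
      then have "cmod (a k * cis t + a (k - 1)) = cmod (a k * cis (real k * t) + a (k - 1) * cis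
          (real (k - 1) * t))"
        by (simp add: norm_mult)
      then show "cmod (a k * cis t + a (k - 1)) \<le> cmod (C k t - back2 (\<lambda>j. C j t) k) + cmod (S k t -
          back2 (\<lambda>j. S j t) k)"
        unfolding Ck Sk using cmb by simp
    qed
    also have "\<dots> = IC k + IS k"
      unfolding IC_def IS_def
      by (intro Bochner_Integration.integral_add integrable_norm int in_Lp_diff in_Lp_back2[OF p
          A(2,1)] L p0)
    finally show ?thesis .
  qed
  have lim1: "(\<lambda>n. 1 / lam n * (\<Sum>k=0..n. back2 lam k * cmod (a (k - 1)))) \<longlonglongrightarrow> 0"
  proof (rule tendsto_sandwich[OF _ _ tendsto_const])
    have "(\<lambda>n. 1 / d * (1 / lam n * (\<Sum>k=0..n. back2 lam k * IC k) + 1 / lam n * (\<Sum>k=0..n. back2 lam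
        k * IS k))) \<longlonglongrightarrow> 1 / d * (0 + 0)"
      unfolding IC_def IS_def by (intro tendsto_intros strongly_imp_L1(2)[OF p A(2,1) fg(1)]
          strongly_imp_L1(2)[OF p A(2,1) fg(2)])
    then show "(\<lambda>n. 1 / d * (1 / lam n * (\<Sum>k=0..n. back2 lam k * IC k) + 1 / lam n * (\<Sum>k=0..n. back2
        lam k * IS k))) \<longlonglongrightarrow> 0" by simp
    have "1 / lam n * (\<Sum>k=0..n. back2 lam k * cmod (a (k - 1))) \<le> 1 / d * (1 / lam n * (\<Sum>k=0..n.
        back2 lam k * IC k) + 1 / lam n * (\<Sum>k=0..n. back2 lam k * IS k))" for n
    proof -
      have "(\<Sum>k=0..n. back2 lam k * cmod (a (k - 1))) \<le> (\<Sum>k=0..n. back2 lam k * (1 / d * (IC k + IS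
          k)))"
      proof (rule sum_mono)
        fix k
        show "back2 lam k * cmod (a (k - 1)) \<le> back2 lam k * (1 / d * (IC k + IS k))"
        proof (cases "k < 2")
          case True
          then show ?thesis by (simp add: back2_def)
        next
          case False
          then have "cmod (a (k - 1)) \<le> 1 / d * (IC k + IS k)" using key[of k] d(1) by (simp add:
              field_simps)
          then show ?thesis by (rule mult_left_mono[OF _ back2_nonneg])
        qed
      qed
      then have "1 / lam n * (\<Sum>k=0..n. back2 lam k * cmod (a (k - 1))) \<le> 1 / lam n * (\<Sum>k=0..n. back2
          lam k * (1 / d * (IC k + IS k)))"
        using pos[of n] by (intro mult_left_mono) (auto simp: less_imp_le)
      also have "\<dots> = 1 / d * (1 / lam n * (\<Sum>k=0..n. back2 lam k * IC k) + 1 / lam n * (\<Sum>k=0..n.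
          back2 lam k * IS k))"
        by (simp add: sum_distrib_left sum.distrib algebra_simps sum_divide_distrib
            add_divide_distrib)
      finally show ?thesis .
    qed
    then show "\<forall>\<^sub>F n in sequentially. 1 / lam n * (\<Sum>k=0..n. back2 lam k * cmod (a (k - 1))) \<le> 1 / d
        * (1 / lam n * (\<Sum>k=0..n. back2 lam k * IC k) + 1 / lam n * (\<Sum>k=0..n. back2 lam k * IS k))"
      by (intro always_eventually allI)
    show "\<forall>\<^sub>F n in sequentially. 0 \<le> 1 / lam n * (\<Sum>k=0..n. back2 lam k * cmod (a (k - 1)))"
      using pos back2_nonneg by (intro always_eventually allI mult_nonneg_nonneg sum_nonneg) (auto
          simp: less_imp_le)
  qed
  define m where "m = measure lebesgue A"
  have m: "m > 0" unfolding m_def by (rule measure_lebesgue_pos[OF A(2,1,3)])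
  define eC where "eC = (\<lambda>n. LINT t|?M. cmod (C n t - f t))"
  define eS where "eS = (\<lambda>n. LINT t|?M. cmod (S n t - g t))"
  \<comment> \<open>A single term is the difference of consecutive errors, and
    \<open>a (Suc n) * cis x\<close> has modulus independent of \<open>x\<close>, so integration
    over \<open>A\<close> just produces the factor \<open>m\<close>.\<close>
  have lim2: "(\<lambda>n. cmod (a (Suc n))) \<longlonglongrightarrow> 0"
  proof (rule tendsto_sandwich[OF _ _ tendsto_const])
    have "eC \<longlonglongrightarrow> 0" "eS \<longlonglongrightarrow> 0"
      using strongly_imp_L1(1)[OF p A(2,1) fg(1)] strongly_imp_L1(1)[OF p A(2,1) fg(2)] by (simp_all
          add: eC_def eS_def)
    then have "(\<lambda>n. 1 / m * ((eC (Suc n) + eC n) + (eS (Suc n) + eS n))) \<longlonglongrightarrow> 1 / m * ((0 + 0) + (0 +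
        0))"
      by (intro tendsto_intros LIMSEQ_Suc)
    then show "(\<lambda>n. 1 / m * ((eC (Suc n) + eC n) + (eS (Suc n) + eS n))) \<longlonglongrightarrow> 0" by simp
    have "cmod (a (Suc n)) \<le> 1 / m * ((eC (Suc n) + eC n) + (eS (Suc n) + eS n))" for n
    proof -
      have i: "integrable ?M (\<lambda>t. cmod (C n t - f t))" "integrable ?M (\<lambda>t. cmod (S n t - g t))" for
          n
        by (intro integrable_norm int in_Lp_diff L p0)+
      have "m * cmod (a (Suc n)) = (LINT t|?M. cmod (a (Suc n)))"
        using A(1) by (simp add: m_def measure_restrict_space)
      also have "\<dots> \<le> (LINT t|?M. (cmod (C (Suc n) t - f t) + cmod (C n t - f t)) + (cmod (S (Suc n)
          t - g t) + cmod (S n t - g t)))"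
      proof (rule integral_mono)
        fix t
        have "cmod (a (Suc n)) = cmod (a (Suc n) * cis (real (Suc n) * t))" by (simp add: norm_mult)
        also have "\<dots> \<le> cmod (a (Suc n) * of_real (cos (real (Suc n) * t))) + cmod (a (Suc n) *
            of_real (sin (real (Suc n) * t)))"
          using cmb[of "a (Suc n)" "real (Suc n) * t" 0 0] by simp
        also have "a (Suc n) * of_real (cos (real (Suc n) * t)) = (C (Suc n) t - f t) - (C n t - f
            t)" by (simp add: C_def)
        also have "a (Suc n) * of_real (sin (real (Suc n) * t)) = (S (Suc n) t - g t) - (S n t - g
            t)" by (simp add: S_def)
        also have "cmod ((C (Suc n) t - f t) - (C n t - f t)) + cmod ((S (Suc n) t - g t) - (S n t -
            g t))
           \<le> (cmod (C (Suc n) t - f t) + cmod (C n t - f t)) + (cmod (S (Suc n) t - g t) + cmod (S n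
               t - g t))"
          by (intro add_mono norm_triangle_ineq4)
        finally show "cmod (a (Suc n)) \<le> (cmod (C (Suc n) t - f t) + cmod (C n t - f t)) + (cmod (S
            (Suc n) t - g t) + cmod (S n t - g t))" .
      qed (simp_all add: i)
      also have "\<dots> = (eC (Suc n) + eC n) + (eS (Suc n) + eS n)"
        by (simp add: i eC_def eS_def)
      finally show ?thesis using m by (simp add: field_simps)
    qed
    then show "\<forall>\<^sub>F n in sequentially. cmod (a (Suc n)) \<le> 1 / m * ((eC (Suc n) + eC n) + (eS (Suc n)
        + eS n))"
      by (intro always_eventually allI)
  qed (auto intro!: always_eventually)
  have "(\<lambda>n. 1 / lam (Suc n) * (\<Sum>k=1..Suc n. lam (k - 1) * cmod (a k))) \<longlonglongrightarrow> 0"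
  proof (rule tendsto_sandwich[OF _ _ tendsto_const])
    show "(\<lambda>n. 1 / lam (Suc n) * (\<Sum>k=0..Suc n. back2 lam k * cmod (a (k - 1))) + cmod (a (Suc n))) \<longlonglongrightarrow>
        0"
      using tendsto_add[OF LIMSEQ_Suc[OF lim1] lim2] by simp
    have "1 / lam (Suc n) * (\<Sum>k=1..Suc n. lam (k - 1) * cmod (a k)) \<le> 1 / lam (Suc n) * (\<Sum>k=0..Suc
        n. back2 lam k * cmod (a (k - 1))) + cmod (a (Suc n))" for n
    proof -
      have "1 / lam (Suc n) * (lam n * cmod (a (Suc n))) = (lam n / lam (Suc n)) * cmod (a (Suc n))"
          by simp
      also have "\<dots> \<le> 1 * cmod (a (Suc n))"
        using pos[of "Suc n"] monoD[OF mono, of n "Suc n"] by (intro mult_right_mono) (auto simp: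
            divide_le_eq)
      finally show ?thesis unfolding sum_shift_back2 by (simp only: distrib_left mult_1)
    qed
    then show "\<forall>\<^sub>F n in sequentially. 1 / lam (Suc n) * (\<Sum>k=1..Suc n. lam (k - 1) * cmod (a k)) \<le> 1
        / lam (Suc n) * (\<Sum>k=0..Suc n. back2 lam k * cmod (a (k - 1))) + cmod (a (Suc n))"
      by (intro always_eventually allI)
    show "\<forall>\<^sub>F n in sequentially. 0 \<le> 1 / lam (Suc n) * (\<Sum>k=1..Suc n. lam (k - 1) * cmod (a k))"
      using pos by (intro always_eventually allI mult_nonneg_nonneg sum_nonneg) (auto simp:
          less_imp_le)
  qed
  then show ?thesis by (rule LIMSEQ_imp_Suc)
qed

section \<open>Invariance under constants, and sufficiency of the coefficient condition\<close>

lemma strongly_to_shift: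
  assumes "Lambda2_strongly_to lam p A s h" "p \<ge> 1" "A \<subseteq> {0..<2*pi}" "A \<in> sets lebesgue"
  shows "Lambda2_strongly_to lam p A (\<lambda>k t. s k t - c) (\<lambda>t. h t - c)"
proof -
  \<comment> \<open>The constant cancels in \<open>s k t - h t\<close>; for \<open>k < 2\<close> it
    survives in the back term, whose factor is 0.\<close>
  have "incr (\<lambda>k t. s k t - c) (\<lambda>t. h t - c) k t = incr s h k t" for k t
    by (simp add: incr_def back2_def)
  then have "incr_mean (\<lambda>k t. s k t - c) (\<lambda>t. h t - c) = incr_mean s h" by (simp add: incr_mean_def
      fun_eq_iff)
  then show ?thesis
    using assms by (auto simp: Lambda2_strongly_to_iff intro!: in_Lp_diff in_Lp_const)
qed

text \<open>The means are dominated by \<open>Y\<close>, an average of the errors, plus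
  \<open>Z\<close>, which is constant in \<open>t\<close>. The shape of the series enters through
  \<open>step\<close> alone, so cosine and sine sums are covered alike.\<close>

lemma coeff_condition_imp_strongly:
  assumes p: "p > 1" and A: "A \<subseteq> {0..<2*pi}" "A \<in> sets lebesgue"
    and L: "\<And>k. in_Lp p A (s k)" "in_Lp p A h" and conv: "(\<lambda>k. Lp_int p A (\<lambda>t. s k t - h t)) \<longlonglongrightarrow> 0"
    and step: "\<And>k t. k \<ge> 2 \<Longrightarrow> cmod (s k t - s (k - 2) t) \<le> cmod (a k) + cmod (a (k - 1))"
    and coeff: "(\<lambda>n. 1 / lam n * (\<Sum>k=1..n. lam (k - 1) * cmod (a k))) \<longlonglongrightarrow> 0"
  shows "Lambda2_strongly_to lam p A s h"
proof -
  interpret M: finite_measure "lebesgue_on A" by (rule finite_measure_lebesgue_on[OF A])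
  have p0: "p \<ge> 0" "p \<ge> 1" "p > 0" using p by auto
  define R where "R = (\<lambda>n. \<Sum>k=1..n. lam (k - 1) * cmod (a k))"
  define Y where "Y = (\<lambda>n t. 1 / lam n * (\<Sum>k=0..n. weight k * cmod (s k t - h t)))"
  define Z where "Z = (\<lambda>n. 2 * (1 / lam n * R n))"
  have LY: "in_Lp p A (Y n)" for n
    unfolding Y_def by (intro in_Lp_cmult in_Lp_sum in_Lp_norm in_Lp_diff L p0)
  \<comment> \<open>Of the two coefficients in \<open>step\<close>, \<open>a k\<close> meets the
    weight \<lambda>_(k-2) \<le> \<lambda>_(k-1), and \<open>a (k - 1)\<close> meets exactly its own
    weight; both sums stay below \<open>R\<close>, whence the 2 in \<open>Z\<close>.\<close>
  have R1: "(\<Sum>k=0..n. back2 lam k * cmod (a k)) \<le> R n" for n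
  proof (induction n)
    case (Suc n)
    have "back2 lam (Suc n) \<le> lam n"
      using pos[of n] monoD[OF mono, of "n - 1" n] by (auto simp: back2_def less_imp_le
          numeral_2_eq_2)
    then have "back2 lam (Suc n) * cmod (a (Suc n)) \<le> lam n * cmod (a (Suc n))" by (intro
        mult_right_mono) auto
    then show ?case using Suc by (simp add: R_def)
  qed (simp add: back2_def R_def)
  have R2: "(\<Sum>k=0..n. back2 lam k * cmod (a (k - 1))) \<le> R n" for n
  proof (cases n)
    case (Suc m)
    then show ?thesis using sum_shift_back2[of "\<lambda>k. cmod (a k)" m] pos[of m] by (simp add: R_def)
  qed (simp add: back2_def R_def)
  have XYZ: "incr_mean s h n t \<le> Y n t + Z n" for n t
  proof -
    have "(\<Sum>k=0..n. incr s h k t) \<le> (\<Sum>k=0..n. weight k * cmod (s k t - h t) + (back2 lam k * cmod (a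
        k) + back2 lam k * cmod (a (k - 1))))"
    proof (rule sum_mono)
      fix k
      have "back2 lam k * cmod (s k t - back2 (\<lambda>j. s j t) k) \<le> back2 lam k * (cmod (a k) + cmod (a
          (k - 1)))"
        using step[of k t] back2_nonneg[of k] by (cases "k < 2") (auto simp: back2_def intro!:
            mult_left_mono)
      then show "incr s h k t \<le> weight k * cmod (s k t - h t) + (back2 lam k * cmod (a k) + back2
          lam k * cmod (a (k - 1)))"
        using incr_le[of s h k t] by (simp add: distrib_left)
    qed
    also have "\<dots> \<le> (\<Sum>k=0..n. weight k * cmod (s k t - h t)) + 2 * R n"
      unfolding sum.distrib using R1[of n] R2[of n] by simp
    finally have "incr_mean s h n t \<le> 1 / lam n * ((\<Sum>k=0..n. weight k * cmod (s k t - h t)) + 2 * R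
        n)"
      unfolding incr_mean_def using pos[of n] by (intro mult_left_mono) (auto simp: less_imp_le)
    also have "\<dots> = Y n t + Z n" by (simp add: Y_def Z_def distrib_left add_divide_distrib)
    finally show ?thesis .
  qed
  have nn: "incr_mean s h n t \<ge> 0" for n t
    using pos[of n] by (simp add: incr_mean_def incr_def sum_nonneg less_imp_le)
  have Z0: "Z \<longlonglongrightarrow> 0" unfolding Z_def R_def using tendsto_mult_left[OF coeff, of 2] by simp
  have LZ: "in_Lp p A (\<lambda>t. Z n)" for n by (rule in_Lp_const[OF A p0(1)])
  have "(\<lambda>n. Lp_int p A (\<lambda>t. Z n)) = (\<lambda>n. norm (Z n) powr p * measure lebesgue A)"
    using A by (simp add: Lp_int_def measure_restrict_space fun_eq_iff)
  moreover have "(\<lambda>n. norm (Z n) powr p * measure lebesgue A) \<longlonglongrightarrow> 0 powr p * measure lebesgue A"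
    using p0 by (intro tendsto_intros tendsto_powr' tendsto_norm_zero Z0) auto
  ultimately have Zlim: "(\<lambda>n. Lp_int p A (\<lambda>t. Z n)) \<longlonglongrightarrow> 0" by simp
  have ie: "integrable (lebesgue_on A) (\<lambda>t. cmod (s k t - h t) powr p)" for k
    by (intro in_Lp_integrable in_Lp_diff L p0)
  \<comment> \<open>Jensen moves the power inside the average, leaving weighted means of the
    integrals of |s_k - h|^p, which tend to 0 by \<open>conv\<close>.\<close>
  have Yle: "Lp_int p A (Y n) \<le> 2 powr p * (1 / lam n * (\<Sum>k=0..n. weight k * Lp_int p A (\<lambda>t. s k t -
      h t)))" for n
  proof -
    have "Lp_int p A (Y n) \<le> (LINT t|lebesgue_on A. 2 powr p * (1 / lam n * (\<Sum>k=0..n. weight k *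
        cmod (s k t - h t) powr p)))"
      unfolding Lp_int_def
    proof (rule integral_mono[OF in_Lp_integrable[OF LY]])
      fix t
      have "Y n t \<ge> 0" using pos[of n] weight_nonneg by (auto simp: Y_def less_imp_le intro!:
          divide_nonneg_pos sum_nonneg)
      then have nY: "norm (Y n t) = Y n t" by simp
      show "norm (Y n t) powr p \<le> 2 powr p * (1 / lam n * (\<Sum>k=0..n. weight k * cmod (s k t - h t)
          powr p))"
        unfolding nY unfolding Y_def
        by (rule weighted_sum_powr_le[OF weight_nonneg _ p0(2) pos sum_weight_bounds]) simp
    qed (intro Bochner_Integration.integrable_mult_right Bochner_Integration.integrable_sum ie)
    also have "\<dots> = 2 powr p * (1 / lam n * (\<Sum>k=0..n. weight k * Lp_int p A (\<lambda>t. s k t - h t)))"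
      by (simp add: Lp_int_def Bochner_Integration.integral_sum ie)
    finally show ?thesis .
  qed
  have Ylim: "(\<lambda>n. Lp_int p A (Y n)) \<longlonglongrightarrow> 0"
  proof (rule tendsto_sandwich[OF _ _ tendsto_const])
    show "(\<lambda>n. 2 powr p * (1 / lam n * (\<Sum>k=0..n. weight k * Lp_int p A (\<lambda>t. s k t - h t)))) \<longlonglongrightarrow> 0"
      using tendsto_mult_left[OF weighted_mean_tendsto_0[OF conv Lp_int_nonneg], of "2 powr p"] by
          simp
  qed (use Yle in \<open>auto intro!: always_eventually\<close>)
  have LX: "in_Lp p A (incr_mean s h n)" for n by (rule in_Lp_incr_mean[OF p0(2) A L])
  have "(\<lambda>n. Lp_int p A (incr_mean s h n)) \<longlonglongrightarrow> 0"
  proof (rule tendsto_sandwich[OF _ _ tendsto_const])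
    show "(\<lambda>n. 2 powr p * (Lp_int p A (Y n) + Lp_int p A (\<lambda>t. Z n))) \<longlonglongrightarrow> 0"
      using tendsto_mult_left[OF tendsto_add[OF Ylim Zlim], of "2 powr p"] by simp
    have "Lp_int p A (incr_mean s h n) \<le> 2 powr p * (Lp_int p A (Y n) + Lp_int p A (\<lambda>t. Z n))" for n
    proof -
      have "Lp_int p A (incr_mean s h n) \<le> Lp_int p A (\<lambda>t. Y n t + Z n)"
      proof (rule Lp_int_mono[OF LX in_Lp_add[OF LY LZ p0(1)] _ p0(1)])
        show "norm (incr_mean s h n t) \<le> norm (Y n t + Z n)" for t
          using XYZ[of n t] nn[of n t] by simp
      qed
      also have "\<dots> \<le> 2 powr p * (Lp_int p A (Y n) + Lp_int p A (\<lambda>t. Z n))"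
        by (rule Lp_int_add_le[OF LY LZ p0(1)])
      finally show ?thesis .
    qed
    then show "\<forall>\<^sub>F n in sequentially. Lp_int p A (incr_mean s h n) \<le> 2 powr p * (Lp_int p A (Y n) +
        Lp_int p A (\<lambda>t. Z n))"
      by (intro always_eventually allI)
  qed (auto intro!: always_eventually)
  then show ?thesis using L p0 by (simp add: Lambda2_strongly_to_iff Lp_norm_tendsto_0_iff)
qed

text \<open>Two coefficient sequences, with joint terms bounded by |a_k|, let the cosine series
  (\<open>b = a\<close>, \<open>c = 0\<close>) and the sine series (\<open>b = 0\<close>,
  \<open>c = a\<close>) share one proof.\<close>

lemma fourier_coeff_condition_imp_strongly:
  assumes p: "p > 1" and f: "f \<in> Lp_periodic p" and F: "has_fourier_series f b c"
    and step: "\<And>k t. k \<ge> 1 \<Longrightarrow> cmod (b k * of_real (cos (real k * t)) + c k * of_real (sin (real k *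
        t))) \<le> cmod (a k)"
    and coeff: "(\<lambda>n. 1 / lam n * (\<Sum>k=1..n. lam (k - 1) * cmod (a k))) \<longlonglongrightarrow> 0"
  shows "Lambda2_strongly_to lam p {0..<2*pi} (fourier_partial_sum b c) f"
proof -
  have Lf: "in_Lp p {0..<2*pi} f" using f by (simp add: Lp_periodic_def Lp_on_iff)
  have "integrable (lebesgue_on {0..<2*pi}) f" by (rule in_Lp_imp_integrable[OF Lf]) (use p in auto)
  from fourier_partial_sum_eq_trig_sum[OF this F]
  have eq: "fourier_partial_sum b c n = trig_sum (fourier_exp_coeff f) {- int n..int n}" for n by
      (rule ext)
  show ?thesis
  proof (rule coeff_condition_imp_strongly[OF p _ _ _ Lf _ _ coeff])
    show "in_Lp p {0..<2*pi} (fourier_partial_sum b c k)" for k unfolding eq by (rule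
        in_Lp_trig_sum) (use p in simp)
    show "(\<lambda>k. Lp_int p {0..<2*pi} (\<lambda>t. fourier_partial_sum b c k t - f t)) \<longlonglongrightarrow> 0"
      unfolding eq by (rule fourier_partial_sums_converge_Lp[OF p Lf])
    fix k :: nat and t :: real assume "k \<ge> 2"
    then obtain j where j: "k = Suc (Suc j)" by (metis Suc_le_D numeral_2_eq_2 Suc_le_mono)
    define u where "u = (\<lambda>k. b k * of_real (cos (real k * t)) + c k * of_real (sin (real k * t)))"
    have "fourier_partial_sum b c k t - fourier_partial_sum b c (k - 2) t = u k + u (k - 1)"
      by (simp add: fourier_partial_sum_def j u_def)
    moreover have "cmod (u k + u (k - 1)) \<le> cmod (a k) + cmod (a (k - 1))"
      by (rule norm_triangle_le, unfold u_def, rule add_mono; rule step) (simp_all add: j)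
    ultimately show "cmod (fourier_partial_sum b c k t - fourier_partial_sum b c (k - 2) t) \<le> cmod
        (a k) + cmod (a (k - 1))"
      by simp
  qed auto
qed

end

theorem theorem11:
  fixes lam :: "nat \<Rightarrow> real" and a :: "nat \<Rightarrow> complex"
  assumes "mono lam" and "\<forall>k. lam k > 0" and "filterlim lam at_top sequentially"
  shows "(\<forall>(p::real) (A::real set).
            1 \<le> p \<and> A \<in> sets lebesgue \<and> A \<subseteq> {0..<2 * pi} \<and> emeasure lebesgue A > 0 \<and>
            Lambda2_strongly_convergent lam p A
              (\<lambda>n t. \<Sum>k=1..n. a k * of_real (cos (real k * t))) \<and>
            Lambda2_strongly_convergent lam p A
              (\<lambda>n t. \<Sum>k=1..n. a k * of_real (sin (real k * t)))
            \<longrightarrow> (\<lambda>n. 1 / lam n * (\<Sum>k=1..n. lam (k - 1) * cmod (a k))) \<longlonglongrightarrow> 0)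
       \<and> (\<forall>(p::real) (f::real \<Rightarrow> complex) (g::real \<Rightarrow> complex).
            1 < p \<and> f \<in> Lp_periodic p \<and> g \<in> Lp_periodic p \<and>
            has_fourier_series f a (\<lambda>_. 0) \<and> has_fourier_series g (\<lambda>_. 0) a
            \<longrightarrow> (Lambda2_strongly_to lam p {0..<2 * pi} (fourier_partial_sum a (\<lambda>_. 0)) f \<and>
                 Lambda2_strongly_to lam p {0..<2 * pi} (fourier_partial_sum (\<lambda>_. 0) a) g
                 \<longleftrightarrow> (\<lambda>n. 1 / lam n * (\<Sum>k=1..n. lam (k - 1) * cmod (a k))) \<longlonglongrightarrow> 0))"
proof -
  interpret lambda_seq lam using assms by unfold_locales auto
  show ?thesis
  proof (intro conjI allI impI iffI; elim conjE)
    fix p A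
    assume "1 \<le> p" "A \<in> sets lebesgue" "A \<subseteq> {0..<2 * pi}" "emeasure lebesgue A > 0"
      "Lambda2_strongly_convergent lam p A (\<lambda>n t. \<Sum>k=1..n. a k * of_real (cos (real k * t)))"
      "Lambda2_strongly_convergent lam p A (\<lambda>n t. \<Sum>k=1..n. a k * of_real (sin (real k * t)))"
    then show "(\<lambda>n. 1 / lam n * (\<Sum>k=1..n. lam (k - 1) * cmod (a k))) \<longlonglongrightarrow> 0"
      by (rule strongly_convergent_imp_coeff_condition)
  next
    fix p f g
    assume p: "1 < p"
      and f: "Lambda2_strongly_to lam p {0..<2 * pi} (fourier_partial_sum a (\<lambda>_. 0)) f"
      and g: "Lambda2_strongly_to lam p {0..<2 * pi} (fourier_partial_sum (\<lambda>_. 0) a) g"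
    \<comment> \<open>Cosine partial sums start with \<open>a 0 / 2\<close>, which
      \<open>strongly_to_shift\<close> removes from sums and limit at once; the sine sums carry no
      constant.\<close>
    have c: "(\<lambda>n t. fourier_partial_sum a (\<lambda>_. 0) n t - a 0 / 2) = (\<lambda>n t. \<Sum>k=1..n. a k * of_real (cos (real k * t)))"
      by (simp add: fourier_partial_sum_def fun_eq_iff)
    have s: "fourier_partial_sum (\<lambda>_. 0) a = (\<lambda>n t. \<Sum>k=1..n. a k * of_real (sin (real k * t)))"
      by (simp add: fourier_partial_sum_def fun_eq_iff)
    show "(\<lambda>n. 1 / lam n * (\<Sum>k=1..n. lam (k - 1) * cmod (a k))) \<longlonglongrightarrow> 0"
    proof (rule strongly_convergent_imp_coeff_condition[of p "{0..<2 * pi}"])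
      show "Lambda2_strongly_convergent lam p {0..<2 * pi} (\<lambda>n t. \<Sum>k=1..n. a k * of_real (cos (real k * t)))"
        using strongly_to_shift[OF f, of "a 0 / 2"] p unfolding c Lambda2_strongly_convergent_def by auto
      show "Lambda2_strongly_convergent lam p {0..<2 * pi} (\<lambda>n t. \<Sum>k=1..n. a k * of_real (sin (real k * t)))"
        using g unfolding s Lambda2_strongly_convergent_def by blast
    qed (use p in auto)
  next
    fix p f g
    assume A: "1 < p" "f \<in> Lp_periodic p" "has_fourier_series f a (\<lambda>_. 0)"
      "(\<lambda>n. 1 / lam n * (\<Sum>k=1..n. lam (k - 1) * cmod (a k))) \<longlonglongrightarrow> 0"
    show "Lambda2_strongly_to lam p {0..<2 * pi} (fourier_partial_sum a (\<lambda>_. 0)) f"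
      by (rule fourier_coeff_condition_imp_strongly[OF A(1-3) _ A(4)]) (simp add: norm_mult mult_left_le)
  next
    fix p f g
    assume A: "1 < p" "g \<in> Lp_periodic p" "has_fourier_series g (\<lambda>_. 0) a"
      "(\<lambda>n. 1 / lam n * (\<Sum>k=1..n. lam (k - 1) * cmod (a k))) \<longlonglongrightarrow> 0"
    show "Lambda2_strongly_to lam p {0..<2 * pi} (fourier_partial_sum (\<lambda>_. 0) a) g"
      by (rule fourier_coeff_condition_imp_strongly[OF A(1-3) _ A(4)]) (simp add: norm_mult mult_left_le)
  qed
qed

end
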